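(* Let $B$ be a set of objects of $\mathfrak{H}$ closed with respect to direct sums. Let $B'$ be a full additive subcategory of $J'=\mathrm{PreTr}(J)$ such that the objects of $\mathfrak{H}$ corresponding to the objects of $B'$ are exactly the elements of $B$ (up to isomorphism). Let $\mathfrak{B}$ be the smallest triangulated subcategory of $\mathfrak{H}$ containing $B$. Then $\mathfrak{B}$ is canonically isomorphic (i.e. canonically equivalent) to $\mathrm{Tr}^+(B')$.
   Context: $k$ is a field of characteristic $0$; $SmVar\supset SmPrVar$ are the smooth, resp. smooth projective, varieties over $k$. $SmCor$ has objects $SmVar$, and $SmCor(X,Y)$ is the free abelian group on integral closed $U\subset X\times Y$ finite over $X$ and surjective over a connected component of $X$. Cubical Suslin complexes. For $P,Y\in SmVar$, $i\le 0$ put $C'^i(P)(Y)=SmCor(\mathbb{A}^{-i}\times Y,P)$. For $1\le j\le -i$, $x\in\{0,1\}$ let $d_{jx}:C'^i\to C'^{i+1}$ be composition with the map induced by $(x_1,\dots,x_{-1-i})\mapsto(x_1,\dots,x_{j-1},x,x_j,\dots,x_{-1-i})$. Put $C^i(P)(Y)=\bigcap_{1\le j\le -i}\ker d_{j0}$, $\delta^i=\sum_{1\le j\le -i}(-1)^jd_{j1}$, and $C^i=0$ for $i>0$. For $f\in C^i(P)(Y)$, $l\le 0$ let $f^l:C^l(Y)\to C^{l+i}(P)$ send $h\in SmCor(\mathbb{A}^{-l}\times Z,Y)$ to $(-1)^{li}f\circ(\mathrm{id}_{\mathbb{A}^{-i}}\otimes h)$. The differential graded category $J$: objects $[P]$ for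 $P\in SmPrVar$; $J^i([P],[Q])=C^i(Q)(P)$; the composite of $g\in C^j(Y)(Z)$ and $f\in C^i(X)(Y)$ is $f^j(g)\in C^{i+j}(X)(Z)$; the differential is $\delta$. Twisted complexes. For a differential graded category $C$, $\mathrm{PreTr}(C)$ has objects $(P^i,q_{ij})$, where $P^i\in \mathrm{Obj}\,C$, $i\in\mathbb{Z}$, almost all $0$, $q_{ij}\in C^{i-j+1}(P^i,P^j)$, $\delta q_{ij}+\sum_l q_{lj}\circ q_{il}=0$; $\mathrm{PreTr}(C)^l((P^i,q_{ij}),(P'^i,q'_{ij}))=\bigoplus_{i,j}C^{l+i-j}(P^i,P'^j)$; the differential of $f\in C^{l+i-j}(P^i,P'^j)$ is $\delta_Cf+\sum_m(q'_{jm}\circ f-(-1)^{(i-m)l}f\circ q_{mi})$. For a differential graded category $D$, $H(D)$ has the same objects and morphisms $H^0$ of the morphism complexes. $\mathrm{Tr}(C)=H(\mathrm{PreTr}(C))$ is triangulated by shift and cones. For $P\in\mathrm{Obj}\,C$, $[P]$ also denotes the twisted complex with $P$ in degree $0$. $\mathrm{Tr}^+(C)$ is the full strict triangulated subcategory of $\mathrm{Tr}(C)$ generated by $[P]$, $P\in\mathrm{Obj}\,C$. $\mathfrak{H}=\mathrm{Tr}(J)$ $(=\mathrm{Tr}^+(J))$; thus $\mathrm{Obj}\,J'=\mathrm{Obj}\,\mathfrak{H}$ and $H(J')=\mathfrak{H}$.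
   Formalization: With the signs printed for PreTr(C) the differential does not square to zero; Koszul signs (-1)^{deg f} are inserted on q'∘f and in the equation for q. That J is a differential graded category with direct sums is assumed, as in the context. *)

theory Defs
  imports
    "HOL-Algebra.Algebraic_Closure_Type"
    "HOL-Library.Poly_Mapping"
    "HOL-Library.Function_Algebras"
begin

(* otherwise X cannot be used as a variable *)
no_notation Polynomials.var (\<open>X\<index>\<close>)

section \<open>Smooth varieties and finite correspondences\<close>

text \<open>
  A reduced separated scheme of finite type over a field \<open>k\<close> of characteristic 0 is encoded by its
  set of points over the algebraic closure \<open>K\<close> of \<open>k\<close>, together with affine charts: pairs of a
  domain and a coordinate map into some \<open>K\<^sup>n\<close>.  All equations and all regular functions have
  coefficients in \<open>k\<close>; the topology is the Zariski topology over \<open>k\<close> on the set of \<open>K\<close>-points, so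
  that its irreducible closed subsets are exactly the integral closed subschemes over \<open>k\<close>.
\<close>

type_synonym 'k mpol = "(nat \<Rightarrow>\<^sub>0 nat) \<Rightarrow>\<^sub>0 'k"

definition coord :: "'a::zero list \<Rightarrow> nat \<Rightarrow> 'a" where
  "coord xs i = (if i < length xs then xs ! i else 0)"

definition pol_eval :: "'k::field mpol \<Rightarrow> 'k alg_closure list \<Rightarrow> 'k alg_closure" where
  "pol_eval p xs =
     (\<Sum>m\<in>Poly_Mapping.keys p. to_ac (Poly_Mapping.lookup p m)
        * (\<Prod>i\<in>Poly_Mapping.keys m. coord xs i ^ Poly_Mapping.lookup m i))"

text \<open>The value at \<open>xs\<close> of the formal partial derivative with respect to the variable \<open>j\<close>.\<close>

definition pol_deriv_eval :: "nat \<Rightarrow> 'k::field mpol \<Rightarrow> 'k alg_closure list \<Rightarrow> 'k alg_closure" where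
  "pol_deriv_eval j p xs =
     (\<Sum>m\<in>Poly_Mapping.keys p. to_ac (Poly_Mapping.lookup p m) * of_nat (Poly_Mapping.lookup m j)
        * coord xs j ^ (Poly_Mapping.lookup m j - 1)
        * (\<Prod>i\<in>Poly_Mapping.keys m - {j}. coord xs i ^ Poly_Mapping.lookup m i))"

record (overloaded) ('k::field, 'p) var =
  pts :: "'p set"
  charts :: "('p set \<times> ('p \<Rightarrow> 'k alg_closure list)) set"

definition affine_space :: "nat \<Rightarrow> ('k::field, 'k alg_closure list) var" where
  "affine_space n = \<lparr>pts = {xs. length xs = n}, charts = {({xs. length xs = n}, \<lambda>xs. xs)}\<rparr>"

text \<open>
  A point of projective space is represented by its unique vector of homogeneous coordinates whose
  first nonzero entry is 1.
\<close>

definition proj_space :: "nat \<Rightarrow> ('k::field, 'k alg_closure list) var" where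
  "proj_space N =
    (let S = {u. length u = N + 1 \<and> (\<exists>i\<le>N. u ! i = 1 \<and> (\<forall>j<i. u ! j = 0))}
     in \<lparr>pts = S, charts = {({u \<in> S. u ! i \<noteq> 0}, \<lambda>u. map (\<lambda>c. c / u ! i) u) | i. i \<le> N}\<rparr>)"

definition var_prod :: "('k::field, 'p) var \<Rightarrow> ('k, 'q) var \<Rightarrow> ('k, 'p \<times> 'q) var" where
  "var_prod X Y =
    \<lparr>pts = pts X \<times> pts Y,
     charts = {(D \<times> E, \<lambda>(x, y). \<phi> x @ \<psi> y) | D \<phi> E \<psi>. (D, \<phi>) \<in> charts X \<and> (E, \<psi>) \<in> charts Y}\<rparr>"

definition sub_var :: "('k::field, 'p) var \<Rightarrow> 'p set \<Rightarrow> ('k, 'p) var" where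
  "sub_var X Z = \<lparr>pts = Z, charts = {(D \<inter> Z, \<phi>) | D \<phi>. (D, \<phi>) \<in> charts X}\<rparr>"

definition kclosed :: "('k::field, 'p) var \<Rightarrow> 'p set \<Rightarrow> bool" where
  "kclosed X Z \<longleftrightarrow> Z \<subseteq> pts X \<and>
     (\<forall>(D, \<phi>)\<in>charts X. \<exists>S. Z \<inter> D = {x \<in> D. \<forall>p\<in>S. pol_eval p (\<phi> x) = 0})"

definition kopen :: "('k::field, 'p) var \<Rightarrow> 'p set \<Rightarrow> bool" where
  "kopen X V \<longleftrightarrow> V \<subseteq> pts X \<and> kclosed X (pts X - V)"

definition kdense :: "('k::field, 'p) var \<Rightarrow> 'p set \<Rightarrow> bool" where
  "kdense X V \<longleftrightarrow> (\<forall>Z. kclosed X Z \<and> V \<subseteq> Z \<longrightarrow> Z = pts X)"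

definition kirreducible :: "('k::field, 'p) var \<Rightarrow> 'p set \<Rightarrow> bool" where
  "kirreducible X U \<longleftrightarrow> U \<noteq> {} \<and>
     (\<forall>Z Z'. kclosed X Z \<and> kclosed X Z' \<and> U \<subseteq> Z \<union> Z' \<longrightarrow> U \<subseteq> Z \<or> U \<subseteq> Z')"

definition components :: "('k::field, 'p) var \<Rightarrow> 'p set set" where
  "components X = {C. C \<noteq> {} \<and> kclosed X C \<and> kopen X C \<and>
     (\<forall>D\<subseteq>C. kclosed X D \<and> kopen X D \<longrightarrow> D = {} \<or> D = C)}"

text \<open>
  Regular functions on a locally closed subset \<open>W\<close> (with its reduced structure).  Local quotients
  on basic open subsets suffice, since these form a basis of the topology.
\<close>

definition regular :: "('k::field, 'p) var \<Rightarrow> 'p set \<Rightarrow> ('p \<Rightarrow> 'k alg_closure) \<Rightarrow> bool" where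
  "regular X W f \<longleftrightarrow> (\<forall>x\<in>W. \<exists>(D, \<phi>)\<in>charts X. x \<in> D \<and>
     (\<exists>p q. pol_eval q (\<phi> x) \<noteq> 0 \<and>
        (\<forall>y\<in>W \<inter> D. pol_eval q (\<phi> y) \<noteq> 0 \<longrightarrow> f y = pol_eval p (\<phi> y) / pol_eval q (\<phi> y))))"

text \<open>
  A locally closed \<open>W\<close> is affine if some regular map \<open>h\<close> identifies it with a closed subset of an
  affine space; the last condition says that the inverse of \<open>h\<close> is a morphism.
\<close>

definition affine_subset :: "('k::field, 'p) var \<Rightarrow> 'p set \<Rightarrow> bool" where
  "affine_subset X W \<longleftrightarrow> (\<exists>m h.
     (\<forall>x\<in>W. length (h x) = m) \<and> (\<forall>i<m. regular X W (\<lambda>x. h x ! i)) \<and>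
     inj_on h W \<and> kclosed (affine_space m) (h ` W) \<and>
     (\<forall>(D, \<phi>)\<in>charts X. \<forall>x\<in>W \<inter> D. \<exists>q. pol_eval q (h x) \<noteq> 0 \<and>
        (\<forall>y\<in>W. pol_eval q (h y) \<noteq> 0 \<longrightarrow> y \<in> D) \<and>
        (\<forall>i<length (\<phi> x). \<exists>p. \<forall>y\<in>W. pol_eval q (h y) \<noteq> 0 \<longrightarrow>
            coord (\<phi> y) i = pol_eval p (h y) / pol_eval q (h y))))"

text \<open>
  Jacobian criterion: in each chart the image is, near every point, cut out by equations whose
  gradients are linearly independent at the point.
\<close>

definition smooth :: "('k::field, 'p) var \<Rightarrow> bool" where
  "smooth X \<longleftrightarrow> (\<forall>(D, \<phi>)\<in>charts X. \<forall>x\<in>D. \<exists>fs q. pol_eval q (\<phi> x) \<noteq> 0 \<and>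
     (\<forall>z. length z = length (\<phi> x) \<and> pol_eval q z \<noteq> 0 \<longrightarrow>
        (z \<in> \<phi> ` D \<longleftrightarrow> (\<forall>f\<in>set fs. pol_eval f z = 0))) \<and>
     (\<forall>c. (\<forall>j<length (\<phi> x). (\<Sum>i<length fs. c i * pol_deriv_eval j (fs ! i) (\<phi> x)) = 0)
        \<longrightarrow> (\<forall>i<length fs. c i = 0)))"

definition SmPrVar :: "('k::field, 'k alg_closure list) var set" where
  "SmPrVar = {sub_var (proj_space N) Z | N Z.
     kclosed (proj_space N) Z \<and> smooth (sub_var (proj_space N) Z)}"

text \<open>Finiteness of the first projection \<open>U \<rightarrow> X\<close>.\<close>

definition finite_over :: "('k::field, 'p) var \<Rightarrow> ('k, 'q) var \<Rightarrow> ('p \<times> 'q) set \<Rightarrow> bool" where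
  "finite_over X Y U \<longleftrightarrow> (\<forall>x\<in>pts X. \<exists>V. kopen X V \<and> x \<in> V \<and> affine_subset X V \<and>
     (let W = {u \<in> U. fst u \<in> V} in
       affine_subset (var_prod X Y) W \<and>
       (\<exists>G. finite G \<and> (\<forall>g\<in>G. regular (var_prod X Y) W g) \<and>
          (\<forall>f. regular (var_prod X Y) W f \<longrightarrow>
             (\<exists>a. (\<forall>g\<in>G. regular X V (a g)) \<and>
                (\<forall>u\<in>W. f u = (\<Sum>g\<in>G. a g (fst u) * g u)))))))"

definition elem_cor :: "('k::field, 'p) var \<Rightarrow> ('k, 'q) var \<Rightarrow> ('p \<times> 'q) set set" where
  "elem_cor X Y = {U. kclosed (var_prod X Y) U \<and> kirreducible (var_prod X Y) U \<and>
     finite_over X Y U \<and> fst ` U \<in> components X}"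

definition SmCor :: "('k::field, 'p) var \<Rightarrow> ('k, 'q) var \<Rightarrow> (('p \<times> 'q) set \<Rightarrow>\<^sub>0 int) set" where
  "SmCor X Y = {\<alpha>. Poly_Mapping.keys \<alpha> \<subseteq> elem_cor X Y}"

text \<open>
  The coefficients of the cycle-theoretic fibres of an elementary correspondence \<open>U\<close> over smooth \<open>X\<close>:
  \<open>cor_mult X Y U x y\<close> is the multiplicity of \<open>(x, y)\<close> in the fibre over the geometric point \<open>x\<close>.
  In characteristic 0 the generic fibres are reduced.  Since \<open>X\<close> is normal, the trace of a regular
  function on \<open>U\<close> is regular on \<open>X\<close>, and its value at \<open>x\<close> is the sum over the fibre with
  multiplicities; these two properties determine the multiplicities.
\<close>

definition cor_mult :: "('k::field_char_0, 'p) var \<Rightarrow> ('k, 'q) var \<Rightarrow> ('p \<times> 'q) set \<Rightarrow>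
    'p \<Rightarrow> 'q \<Rightarrow> int" where
  "cor_mult X Y U = (THE m.
     (\<forall>x y. (x, y) \<notin> U \<longrightarrow> m x y = 0) \<and>
     (\<exists>V. kopen X V \<and> kdense X V \<and> (\<forall>x\<in>V. \<forall>y. (x, y) \<in> U \<longrightarrow> m x y = 1)) \<and>
     (\<forall>\<Omega> g. kopen (var_prod X Y) \<Omega> \<and> regular (var_prod X Y) \<Omega> g \<longrightarrow>
        regular X {x \<in> pts X. \<forall>y. (x, y) \<in> U \<longrightarrow> (x, y) \<in> \<Omega>}
          (\<lambda>x. \<Sum>y | (x, y) \<in> U. of_int (m x y) * g (x, y))))"

definition cor_fib :: "('k::field_char_0, 'p) var \<Rightarrow> ('k, 'q) var \<Rightarrow> (('p \<times> 'q) set \<Rightarrow>\<^sub>0 int) \<Rightarrow>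
    'p \<Rightarrow> 'q \<Rightarrow> int" where
  "cor_fib X Y \<alpha> x y = (\<Sum>U\<in>Poly_Mapping.keys \<alpha>. Poly_Mapping.lookup \<alpha> U * cor_mult X Y U x y)"

text \<open>
  The composite \<open>\<beta> \<circ> \<alpha>\<close> of finite correspondences is the finite correspondence whose fibre over a
  geometric point \<open>x\<close> is the image under \<open>\<beta>\<close> of the zero-cycle that is the fibre of \<open>\<alpha>\<close> over \<open>x\<close>.
  (A finite correspondence is determined by its fibres over geometric points.)
\<close>

definition cor_comp :: "('k::field_char_0, 'p) var \<Rightarrow> ('k, 'q) var \<Rightarrow> ('k, 'r) var \<Rightarrow>
    (('q \<times> 'r) set \<Rightarrow>\<^sub>0 int) \<Rightarrow> (('p \<times> 'q) set \<Rightarrow>\<^sub>0 int) \<Rightarrow> (('p \<times> 'r) set \<Rightarrow>\<^sub>0 int)" where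
  "cor_comp X Y Z \<beta> \<alpha> = (THE \<gamma>. \<gamma> \<in> SmCor X Z \<and>
     (\<forall>x\<in>pts X. \<forall>z\<in>pts Z. cor_fib X Z \<gamma> x z =
        (\<Sum>y | y \<in> pts Y \<and> cor_fib X Y \<alpha> x y \<noteq> 0. cor_fib X Y \<alpha> x y * cor_fib Y Z \<beta> y z)))"

definition graph_cor :: "('k::field, 'p) var \<Rightarrow> ('p \<Rightarrow> 'q) \<Rightarrow> (('p \<times> 'q) set \<Rightarrow>\<^sub>0 int)" where
  "graph_cor X \<phi> = (\<Sum>C\<in>components X. Poly_Mapping.single ((\<lambda>x. (x, \<phi> x)) ` C) 1)"


section \<open>Cubical complexes and the differential graded category \<open>J\<close>\<close>

abbreviation AxV :: "nat \<Rightarrow> ('k::field, 'p) var \<Rightarrow> ('k, 'k alg_closure list \<times> 'p) var" where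
  "AxV n Y \<equiv> var_prod (affine_space n) Y"

type_synonym 'k jobj = "('k, 'k alg_closure list) var"
type_synonym 'k jmor =
  "(('k alg_closure list \<times> 'k alg_closure list) \<times> 'k alg_closure list) set \<Rightarrow>\<^sub>0 int"

text \<open>The face \<open>d\<^sub>j\<^sub>x\<close> from \<open>C'\<^sup>i(P)(Y)\<close> to \<open>C'\<^sup>i\<^sup>+\<^sup>1(P)(Y)\<close>, where \<open>n = - i \<ge> 1\<close>.\<close>

definition cub_face :: "'k::field_char_0 jobj \<Rightarrow> 'k jobj \<Rightarrow> nat \<Rightarrow> nat \<Rightarrow> 'k alg_closure \<Rightarrow>
    'k jmor \<Rightarrow> 'k jmor" where
  "cub_face P Y n j c \<alpha> = cor_comp (AxV (n - 1) Y) (AxV n Y) P \<alpha>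
     (graph_cor (AxV (n - 1) Y) (\<lambda>(xs, y). (take (j - 1) xs @ [c] @ drop (j - 1) xs, y)))"

definition cub :: "'k::field_char_0 jobj \<Rightarrow> 'k jobj \<Rightarrow> int \<Rightarrow> 'k jmor set" where
  "cub P Y i = (if i > 0 then {0} else
     {\<alpha> \<in> SmCor (AxV (nat (- i)) Y) P. \<forall>j\<in>{1..nat (- i)}. cub_face P Y (nat (- i)) j 0 \<alpha> = 0})"

definition sgn_pow :: "int \<Rightarrow> 'a::ab_group_add \<Rightarrow> 'a" where
  "sgn_pow n a = (if even n then a else - a)"

definition cub_diff :: "'k::field_char_0 jobj \<Rightarrow> 'k jobj \<Rightarrow> int \<Rightarrow> 'k jmor \<Rightarrow> 'k jmor" where
  "cub_diff P Y i \<alpha> =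
     (\<Sum>j = 1..nat (- i). sgn_pow (int j) (cub_face P Y (nat (- i)) j 1 \<alpha>))"

text \<open>
  \<open>id \<otimes> h\<close> on \<open>\<bbbA>\<^sup>n \<times> \<bbbA>\<^sup>m \<times> Z = \<bbbA>\<^sup>n\<^sup>+\<^sup>m \<times> Z\<close>, for a finite correspondence \<open>h\<close> from \<open>\<bbbA>\<^sup>m \<times> Z\<close> to \<open>Y\<close>.
\<close>

definition id_tensor :: "nat \<Rightarrow> 'k::field jmor \<Rightarrow>
    ((('k alg_closure list \<times> 'k alg_closure list) \<times> ('k alg_closure list \<times> 'k alg_closure list)) set
       \<Rightarrow>\<^sub>0 int)" where
  "id_tensor n h = (\<Sum>U\<in>Poly_Mapping.keys h.
     Poly_Mapping.single {((t @ s, z), (t, y)) | t s z y. length t = n \<and> ((s, z), y) \<in> U}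
       (Poly_Mapping.lookup h U))"

definition cub_comp :: "'k::field_char_0 jobj \<Rightarrow> 'k jobj \<Rightarrow> 'k jobj \<Rightarrow> int \<Rightarrow> int \<Rightarrow>
    'k jmor \<Rightarrow> 'k jmor \<Rightarrow> 'k jmor" where
  "cub_comp Z Y X i l f h = (if i > 0 \<or> l > 0 then 0 else
     sgn_pow (l * i) (cor_comp (AxV (nat (- i) + nat (- l)) Z) (AxV (nat (- i)) Y) X
       f (id_tensor (nat (- i)) h)))"

text \<open>
  Data of a differential graded category.  For \<open>f \<in> Mor C Y Z i\<close> and \<open>g \<in> Mor C X Y j\<close> the composite
  \<open>f \<circ> g\<close> is \<open>cmp C X Y Z i j f g\<close>.
\<close>

record ('o, 'm) dgcat =
  Ob :: "'o set"
  Mor :: "'o \<Rightarrow> 'o \<Rightarrow> int \<Rightarrow> 'm set"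
  dif :: "'o \<Rightarrow> 'o \<Rightarrow> int \<Rightarrow> 'm \<Rightarrow> 'm"
  cmp :: "'o \<Rightarrow> 'o \<Rightarrow> 'o \<Rightarrow> int \<Rightarrow> int \<Rightarrow> 'm \<Rightarrow> 'm \<Rightarrow> 'm"
  idn :: "'o \<Rightarrow> 'm"

text \<open>
  That \<open>J\<close> is an additive differential graded category rests on the existence and uniqueness of composites
  of finite correspondences, identities as graphs, and disjoint unions of projective varieties.  These
  standard facts are not derived here.
\<close>

definition J :: "('k::field_char_0 jobj, 'k jmor) dgcat" where
  "J = \<lparr>Ob = SmPrVar,
        Mor = (\<lambda>P Q i. cub Q P i),
        dif = (\<lambda>P Q i. cub_diff Q P i),
        cmp = cub_comp,
        idn = (\<lambda>P. graph_cor (AxV 0 P) snd)\<rparr>"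


section \<open>Differential graded categories and twisted complexes\<close>

text \<open>
  The Leibniz rule is the one satisfied by the composition in \<open>J\<close>: the sign sits on the term in which
  the left factor is differentiated.
\<close>

locale dg_category =
  fixes C :: "('o, 'm::ab_group_add) dgcat"
  assumes zero_Mor: "\<lbrakk>X \<in> Ob C; Y \<in> Ob C\<rbrakk> \<Longrightarrow> 0 \<in> Mor C X Y i"
    and diff_Mor: "\<lbrakk>X \<in> Ob C; Y \<in> Ob C; f \<in> Mor C X Y i; g \<in> Mor C X Y i\<rbrakk>
      \<Longrightarrow> f - g \<in> Mor C X Y i"
    and dif_Mor: "\<lbrakk>X \<in> Ob C; Y \<in> Ob C; f \<in> Mor C X Y i\<rbrakk> \<Longrightarrow> dif C X Y i f \<in> Mor C X Y (i + 1)"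
    and dif_add: "\<lbrakk>X \<in> Ob C; Y \<in> Ob C; f \<in> Mor C X Y i; g \<in> Mor C X Y i\<rbrakk>
      \<Longrightarrow> dif C X Y i (f + g) = dif C X Y i f + dif C X Y i g"
    and dif_dif: "\<lbrakk>X \<in> Ob C; Y \<in> Ob C; f \<in> Mor C X Y i\<rbrakk>
      \<Longrightarrow> dif C X Y (i + 1) (dif C X Y i f) = 0"
    and idn_Mor: "X \<in> Ob C \<Longrightarrow> idn C X \<in> Mor C X X 0"
    and dif_idn: "X \<in> Ob C \<Longrightarrow> dif C X X 0 (idn C X) = 0"
    and cmp_Mor: "\<lbrakk>X \<in> Ob C; Y \<in> Ob C; Z \<in> Ob C; f \<in> Mor C Y Z i; g \<in> Mor C X Y j\<rbrakk>
      \<Longrightarrow> cmp C X Y Z i j f g \<in> Mor C X Z (i + j)"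
    and cmp_add_left: "\<lbrakk>X \<in> Ob C; Y \<in> Ob C; Z \<in> Ob C; f \<in> Mor C Y Z i; f' \<in> Mor C Y Z i;
        g \<in> Mor C X Y j\<rbrakk>
      \<Longrightarrow> cmp C X Y Z i j (f + f') g = cmp C X Y Z i j f g + cmp C X Y Z i j f' g"
    and cmp_add_right: "\<lbrakk>X \<in> Ob C; Y \<in> Ob C; Z \<in> Ob C; f \<in> Mor C Y Z i; g \<in> Mor C X Y j;
        g' \<in> Mor C X Y j\<rbrakk>
      \<Longrightarrow> cmp C X Y Z i j f (g + g') = cmp C X Y Z i j f g + cmp C X Y Z i j f g'"
    and cmp_assoc: "\<lbrakk>W \<in> Ob C; X \<in> Ob C; Y \<in> Ob C; Z \<in> Ob C; f \<in> Mor C Y Z i; g \<in> Mor C X Y j;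
        h \<in> Mor C W X l\<rbrakk>
      \<Longrightarrow> cmp C W X Z (i + j) l (cmp C X Y Z i j f g) h =
          cmp C W Y Z i (j + l) f (cmp C W X Y j l g h)"
    and cmp_idn_left: "\<lbrakk>X \<in> Ob C; Y \<in> Ob C; f \<in> Mor C X Y i\<rbrakk> \<Longrightarrow> cmp C X Y Y 0 i (idn C Y) f = f"
    and cmp_idn_right: "\<lbrakk>X \<in> Ob C; Y \<in> Ob C; f \<in> Mor C X Y i\<rbrakk> \<Longrightarrow> cmp C X X Y i 0 f (idn C X) = f"
    and leibniz: "\<lbrakk>X \<in> Ob C; Y \<in> Ob C; Z \<in> Ob C; f \<in> Mor C Y Z i; g \<in> Mor C X Y j\<rbrakk>
      \<Longrightarrow> dif C X Z (i + j) (cmp C X Y Z i j f g) =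
          cmp C X Y Z i (j + 1) f (dif C X Y j g) +
          sgn_pow j (cmp C X Y Z (i + 1) j (dif C Y Z i f) g)"

definition zero_ob :: "('o, 'm::ab_group_add) dgcat \<Rightarrow> 'o \<Rightarrow> bool" where
  "zero_ob C Z \<longleftrightarrow> Z \<in> Ob C \<and> idn C Z = 0"

definition closed_mor :: "('o, 'm::ab_group_add) dgcat \<Rightarrow> 'o \<Rightarrow> 'o \<Rightarrow> 'm set" where
  "closed_mor C X Y = {f \<in> Mor C X Y 0. dif C X Y 0 f = 0}"

definition dg_biproduct :: "('o, 'm::ab_group_add) dgcat \<Rightarrow> 'o \<Rightarrow> 'o \<Rightarrow> 'o \<Rightarrow>
    'm \<Rightarrow> 'm \<Rightarrow> 'm \<Rightarrow> 'm \<Rightarrow> bool" where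
  "dg_biproduct C X Y S \<iota>1 \<iota>2 \<pi>1 \<pi>2 \<longleftrightarrow> S \<in> Ob C \<and>
     \<iota>1 \<in> closed_mor C X S \<and> \<iota>2 \<in> closed_mor C Y S \<and> \<pi>1 \<in> closed_mor C S X \<and> \<pi>2 \<in> closed_mor C S Y \<and>
     cmp C X S X 0 0 \<pi>1 \<iota>1 = idn C X \<and> cmp C Y S Y 0 0 \<pi>2 \<iota>2 = idn C Y \<and>
     cmp C Y S X 0 0 \<pi>1 \<iota>2 = 0 \<and> cmp C X S Y 0 0 \<pi>2 \<iota>1 = 0 \<and>
     cmp C S X S 0 0 \<iota>1 \<pi>1 + cmp C S Y S 0 0 \<iota>2 \<pi>2 = idn C S"

definition dg_additive :: "('o, 'm::ab_group_add) dgcat \<Rightarrow> bool" where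
  "dg_additive C \<longleftrightarrow> (\<exists>Z. zero_ob C Z) \<and>
     (\<forall>X\<in>Ob C. \<forall>Y\<in>Ob C. \<exists>S \<iota>1 \<iota>2 \<pi>1 \<pi>2. dg_biproduct C X Y S \<iota>1 \<iota>2 \<pi>1 \<pi>2)"

definition dg_full :: "('o, 'm) dgcat \<Rightarrow> 'o set \<Rightarrow> ('o, 'm) dgcat" where
  "dg_full C S = C\<lparr>Ob := S\<rparr>"

type_synonym ('o, 'm) tw = "(int \<Rightarrow> 'o) \<times> (int \<Rightarrow> int \<Rightarrow> 'm)"

definition tw_supp :: "('o, 'm::ab_group_add) dgcat \<Rightarrow> ('o, 'm) tw \<Rightarrow> int set" where
  "tw_supp C X = {i. \<not> zero_ob C (fst X i)}"

text \<open>
  Signs.  Without the sign \<open>(-1)\<^bsup>deg f\<^esup>\<close> on \<open>q' \<circ> f\<close>, which is often dropped, the square of the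
  differential of \<open>PreTr(C)\<close> contains the terms \<open>2 (q' \<circ> \<delta> f)\<close> for \<open>q'\<close> of even degree.  With this sign
  (also in the Maurer-Cartan equation) and the composition below, \<open>PreTr(C)\<close> is again a differential
  graded category satisfying the above Leibniz rule.  Up to rescaling the component
  \<open>f \<in> C\<^bsup>l+i-j\<^esup>(P\<^sup>i, P'\<^sup>j)\<close> by \<open>(-1)\<^bsup>il\<^esup>\<close>, the composition is matrix multiplication and the
  differential is \<open>f \<mapsto> (-1)\<^sup>i \<delta> f - f \<circ> q + (-1)\<^sup>l q' \<circ> f\<close>.
\<close>

definition pretr_Ob :: "('o, 'm::ab_group_add) dgcat \<Rightarrow> ('o, 'm) tw set" where
  "pretr_Ob C = {(P, q). (\<forall>i. P i \<in> Ob C) \<and> finite (tw_supp C (P, q)) \<and>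
     (\<forall>i j. q i j \<in> Mor C (P i) (P j) (i - j + 1)) \<and>
     (\<forall>i j. dif C (P i) (P j) (i - j + 1) (q i j) +
        (\<Sum>l\<in>tw_supp C (P, q). sgn_pow (i - l + 1)
           (cmp C (P i) (P l) (P j) (l - j + 1) (i - l + 1) (q l j) (q i l))) = 0)}"

definition pretr_Mor :: "('o, 'm::ab_group_add) dgcat \<Rightarrow> ('o, 'm) tw \<Rightarrow> ('o, 'm) tw \<Rightarrow> int \<Rightarrow>
    (int \<Rightarrow> int \<Rightarrow> 'm) set" where
  "pretr_Mor C X Y l = {f. \<forall>i j. f i j \<in> Mor C (fst X i) (fst Y j) (l + i - j)}"

definition pretr_dif :: "('o, 'm::ab_group_add) dgcat \<Rightarrow> ('o, 'm) tw \<Rightarrow> ('o, 'm) tw \<Rightarrow> int \<Rightarrow>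
    (int \<Rightarrow> int \<Rightarrow> 'm) \<Rightarrow> (int \<Rightarrow> int \<Rightarrow> 'm)" where
  "pretr_dif C X Y l f = (\<lambda>i j.
     dif C (fst X i) (fst Y j) (l + i - j) (f i j)
     + (\<Sum>m\<in>tw_supp C Y. sgn_pow (l + i - m)
          (cmp C (fst X i) (fst Y m) (fst Y j) (m - j + 1) (l + i - m) (snd Y m j) (f i m)))
     - (\<Sum>m\<in>tw_supp C X. sgn_pow ((m - i) * l)
          (cmp C (fst X i) (fst X m) (fst Y j) (l + m - j) (i - m + 1) (f m j) (snd X i m))))"

definition pretr_cmp :: "('o, 'm::ab_group_add) dgcat \<Rightarrow> ('o, 'm) tw \<Rightarrow> ('o, 'm) tw \<Rightarrow> ('o, 'm) tw \<Rightarrow>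
    int \<Rightarrow> int \<Rightarrow> (int \<Rightarrow> int \<Rightarrow> 'm) \<Rightarrow> (int \<Rightarrow> int \<Rightarrow> 'm) \<Rightarrow> (int \<Rightarrow> int \<Rightarrow> 'm)" where
  "pretr_cmp C X Y Z k l f g = (\<lambda>i j.
     \<Sum>m\<in>tw_supp C Y. sgn_pow ((m - i) * k)
       (cmp C (fst X i) (fst Y m) (fst Z j) (k + m - j) (l + i - m) (f m j) (g i m)))"

definition PreTr :: "('o, 'm::ab_group_add) dgcat \<Rightarrow> (('o, 'm) tw, int \<Rightarrow> int \<Rightarrow> 'm) dgcat" where
  "PreTr C = \<lparr>Ob = pretr_Ob C, Mor = pretr_Mor C, dif = pretr_dif C, cmp = pretr_cmp C,
     idn = (\<lambda>X i j. if i = j then idn C (fst X i) else 0)\<rparr>"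

text \<open>The twisted complex with \<open>X\<close> in degree 0, and the evident map on morphisms.\<close>

definition tw_single :: "('o, 'm::ab_group_add) dgcat \<Rightarrow> 'o \<Rightarrow> ('o, 'm) tw" where
  "tw_single C X = ((\<lambda>i. if i = 0 then X else (SOME Z. zero_ob C Z)), (\<lambda>i j. 0))"

definition tw_single_mor :: "'m::ab_group_add \<Rightarrow> int \<Rightarrow> int \<Rightarrow> 'm" where
  "tw_single_mor f = (\<lambda>i j. if i = 0 \<and> j = 0 then f else 0)"


section \<open>Homotopy categories and triangulated structure\<close>

record ('o, 'h) lcat =
  lOb :: "'o set"
  lMor :: "'o \<Rightarrow> 'o \<Rightarrow> 'h set"
  lcmp :: "'o \<Rightarrow> 'o \<Rightarrow> 'o \<Rightarrow> 'h \<Rightarrow> 'h \<Rightarrow> 'h"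
  lidn :: "'o \<Rightarrow> 'h"
  lzero :: "'o \<Rightarrow> 'o \<Rightarrow> 'h"
  ladd :: "'o \<Rightarrow> 'o \<Rightarrow> 'h \<Rightarrow> 'h \<Rightarrow> 'h"

record ('o, 'h) tcat = "('o, 'h) lcat" +
  tsh :: "'o \<Rightarrow> 'o"
  tshm :: "'o \<Rightarrow> 'o \<Rightarrow> 'h \<Rightarrow> 'h"
  tri :: "('o \<times> 'o \<times> 'o \<times> 'h \<times> 'h \<times> 'h) set"

definition hclass :: "('o, 'm::ab_group_add) dgcat \<Rightarrow> 'o \<Rightarrow> 'o \<Rightarrow> 'm \<Rightarrow> 'm set" where
  "hclass D X Y f = {f + dif D X Y (-1) h | h. h \<in> Mor D X Y (-1)}"

definition H0 :: "('o, 'm::ab_group_add) dgcat \<Rightarrow> ('o, 'm set) lcat" where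
  "H0 D = \<lparr>lOb = Ob D,
     lMor = (\<lambda>X Y. hclass D X Y ` closed_mor D X Y),
     lcmp = (\<lambda>X Y Z \<phi> \<psi>. \<Union>f\<in>\<phi>. \<Union>g\<in>\<psi>. hclass D X Z (cmp D X Y Z 0 0 f g)),
     lidn = (\<lambda>X. hclass D X X (idn D X)),
     lzero = (\<lambda>X Y. hclass D X Y 0),
     ladd = (\<lambda>X Y \<phi> \<psi>. {f + g | f g. f \<in> \<phi> \<and> g \<in> \<psi>})\<rparr>"

definition l_iso :: "('o, 'h, 'z) lcat_scheme \<Rightarrow> 'o \<Rightarrow> 'o \<Rightarrow> 'h \<Rightarrow> bool" where
  "l_iso T X Y \<phi> \<longleftrightarrow> \<phi> \<in> lMor T X Y \<and>
     (\<exists>\<psi>\<in>lMor T Y X. lcmp T X Y X \<psi> \<phi> = lidn T X \<and> lcmp T Y X Y \<phi> \<psi> = lidn T Y)"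

definition l_isomorphic :: "('o, 'h, 'z) lcat_scheme \<Rightarrow> 'o \<Rightarrow> 'o \<Rightarrow> bool" where
  "l_isomorphic T X Y \<longleftrightarrow> (\<exists>\<phi>. l_iso T X Y \<phi>)"

definition l_zero_ob :: "('o, 'h, 'z) lcat_scheme \<Rightarrow> 'o \<Rightarrow> bool" where
  "l_zero_ob T Z \<longleftrightarrow> Z \<in> lOb T \<and>
     (\<forall>X\<in>lOb T. lMor T X Z = {lzero T X Z} \<and> lMor T Z X = {lzero T Z X})"

definition l_direct_sum :: "('o, 'h, 'z) lcat_scheme \<Rightarrow> 'o \<Rightarrow> 'o \<Rightarrow> 'o \<Rightarrow> bool" where
  "l_direct_sum T X Y S \<longleftrightarrow> S \<in> lOb T \<and>
     (\<exists>\<iota>1\<in>lMor T X S. \<exists>\<iota>2\<in>lMor T Y S. \<exists>\<pi>1\<in>lMor T S X. \<exists>\<pi>2\<in>lMor T S Y.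
        lcmp T X S X \<pi>1 \<iota>1 = lidn T X \<and> lcmp T Y S Y \<pi>2 \<iota>2 = lidn T Y \<and>
        lcmp T Y S X \<pi>1 \<iota>2 = lzero T Y X \<and> lcmp T X S Y \<pi>2 \<iota>1 = lzero T X Y \<and>
        ladd T S S (lcmp T S X S \<iota>1 \<pi>1) (lcmp T S Y S \<iota>2 \<pi>2) = lidn T S)"

text \<open>With the above signs the shift involves no sign: \<open>((-1)\<^sup>i id)\<close> is a closed isomorphism of degree
  -1 from \<open>X\<close> to its shift.\<close>

definition tw_shift :: "('o, 'm) tw \<Rightarrow> ('o, 'm) tw" where
  "tw_shift X = ((\<lambda>i. fst X (i + 1)), (\<lambda>i j. snd X (i + 1) (j + 1)))"

definition tw_shift_mor :: "(int \<Rightarrow> int \<Rightarrow> 'm) \<Rightarrow> (int \<Rightarrow> int \<Rightarrow> 'm)" where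
  "tw_shift_mor f = (\<lambda>i j. f (i + 1) (j + 1))"

text \<open>\<open>u \<circ> g \<circ> v\<close> with \<open>u\<close> and \<open>v\<close> of degree 0 and \<open>g\<close> of degree \<open>d\<close>.\<close>

definition sandwich :: "('o, 'm::ab_group_add) dgcat \<Rightarrow> 'o \<Rightarrow> 'o \<Rightarrow> 'o \<Rightarrow> 'o \<Rightarrow> int \<Rightarrow>
    'm \<Rightarrow> 'm \<Rightarrow> 'm \<Rightarrow> 'm" where
  "sandwich C A B B' A' d u g v = cmp C A B' A' 0 d u (cmp C A B B' d 0 g v)"

text \<open>
  \<open>Z\<close> is the cone of the closed degree 0 morphism \<open>f\<close> from \<open>X\<close> to \<open>Y\<close>: its terms are direct sums
  \<open>Z\<^sup>i = X\<^sup>i\<^sup>+\<^sup>1 \<oplus> Y\<^sup>i\<close>, with twisting cochain the block matrix with entries \<open>q\<close> of the shift of \<open>X\<close>,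
  \<open>q\<close> of \<open>Y\<close>, and \<open>(-1)\<^sup>i f\<close>.
\<close>

definition tw_cone :: "('o, 'm::ab_group_add) dgcat \<Rightarrow> ('o, 'm) tw \<Rightarrow> ('o, 'm) tw \<Rightarrow>
    (int \<Rightarrow> int \<Rightarrow> 'm) \<Rightarrow> ('o, 'm) tw \<Rightarrow>
    (int \<Rightarrow> 'm) \<Rightarrow> (int \<Rightarrow> 'm) \<Rightarrow> (int \<Rightarrow> 'm) \<Rightarrow> (int \<Rightarrow> 'm) \<Rightarrow> bool" where
  "tw_cone C X Y f Z \<iota>1 \<iota>2 \<pi>1 \<pi>2 \<longleftrightarrow>
     X \<in> Ob (PreTr C) \<and> Y \<in> Ob (PreTr C) \<and> Z \<in> Ob (PreTr C) \<and> f \<in> closed_mor (PreTr C) X Y \<and>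
     (\<forall>i. dg_biproduct C (fst X (i + 1)) (fst Y i) (fst Z i) (\<iota>1 i) (\<iota>2 i) (\<pi>1 i) (\<pi>2 i)) \<and>
     (\<forall>i j. snd Z i j =
        sandwich C (fst Z i) (fst X (i + 1)) (fst X (j + 1)) (fst Z j) (i - j + 1)
          (\<iota>1 j) (snd X (i + 1) (j + 1)) (\<pi>1 i)
        + sandwich C (fst Z i) (fst X (i + 1)) (fst Y j) (fst Z j) (i - j + 1)
          (\<iota>2 j) (sgn_pow i (f (i + 1) j)) (\<pi>1 i)
        + sandwich C (fst Z i) (fst Y i) (fst Y j) (fst Z j) (i - j + 1)
          (\<iota>2 j) (snd Y i j) (\<pi>2 i))"

definition diag_mor :: "(int \<Rightarrow> 'm::zero) \<Rightarrow> int \<Rightarrow> int \<Rightarrow> 'm" where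
  "diag_mor u = (\<lambda>i j. if i = j then u i else 0)"

definition std_tri :: "('o, 'm::ab_group_add) dgcat \<Rightarrow>
    (('o, 'm) tw \<times> ('o, 'm) tw \<times> ('o, 'm) tw \<times>
     (int \<Rightarrow> int \<Rightarrow> 'm) set \<times> (int \<Rightarrow> int \<Rightarrow> 'm) set \<times> (int \<Rightarrow> int \<Rightarrow> 'm) set) set" where
  "std_tri C = {(X, Y, Z, hclass (PreTr C) X Y f, hclass (PreTr C) Y Z (diag_mor \<iota>2),
      hclass (PreTr C) Z (tw_shift X) (diag_mor \<pi>1)) | X Y Z f \<iota>1 \<iota>2 \<pi>1 \<pi>2.
      tw_cone C X Y f Z \<iota>1 \<iota>2 \<pi>1 \<pi>2}"

definition Tr :: "('o, 'm::ab_group_add) dgcat \<Rightarrow> (('o, 'm) tw, (int \<Rightarrow> int \<Rightarrow> 'm) set) tcat" where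
  "Tr C = (let H = H0 (PreTr C) in
     \<lparr>lOb = lOb H, lMor = lMor H, lcmp = lcmp H, lidn = lidn H, lzero = lzero H, ladd = ladd H,
      tsh = tw_shift,
      tshm = (\<lambda>X Y \<phi>. tw_shift_mor ` \<phi>),
      tri = {(X, Y, Z, \<phi>, \<psi>, \<chi>). X \<in> lOb H \<and> Y \<in> lOb H \<and> Z \<in> lOb H \<and>
        \<phi> \<in> lMor H X Y \<and> \<psi> \<in> lMor H Y Z \<and> \<chi> \<in> lMor H Z (tw_shift X) \<and>
        (\<exists>(A, B, E, u, v, w)\<in>std_tri C. \<exists>\<alpha> \<beta> \<gamma>.
           l_iso H A X \<alpha> \<and> l_iso H B Y \<beta> \<and> l_iso H E Z \<gamma> \<and>
           lcmp H A X Y \<phi> \<alpha> = lcmp H A B Y \<beta> u \<and>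
           lcmp H B Y Z \<psi> \<beta> = lcmp H B E Z \<gamma> v \<and>
           lcmp H E Z (tw_shift X) \<chi> \<gamma> =
             lcmp H E (tw_shift A) (tw_shift X) (tw_shift_mor ` \<alpha>) w)}\<rparr>)"

definition t_full :: "('o, 'h) tcat \<Rightarrow> 'o set \<Rightarrow> ('o, 'h) tcat" where
  "t_full T S = T\<lparr>lOb := S,
     tri := {(X, Y, Z, \<phi>, \<psi>, \<chi>) \<in> tri T. X \<in> S \<and> Y \<in> S \<and> Z \<in> S}\<rparr>"

text \<open>Object sets of full strict (closed under isomorphism) triangulated subcategories.\<close>

definition tri_subcat :: "('o, 'h) tcat \<Rightarrow> 'o set \<Rightarrow> bool" where
  "tri_subcat T S \<longleftrightarrow> S \<subseteq> lOb T \<and> (\<exists>Z\<in>S. l_zero_ob T Z) \<and>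
     (\<forall>X\<in>S. \<forall>Y\<in>lOb T. l_isomorphic T X Y \<longrightarrow> Y \<in> S) \<and>
     (\<forall>X\<in>lOb T. tsh T X \<in> S \<longleftrightarrow> X \<in> S) \<and>
     (\<forall>(X, Y, Z, \<phi>, \<psi>, \<chi>)\<in>tri T. X \<in> S \<and> Y \<in> S \<longrightarrow> Z \<in> S)"

definition tri_gen :: "('o, 'h) tcat \<Rightarrow> 'o set \<Rightarrow> 'o set" where
  "tri_gen T S = \<Inter>{S'. tri_subcat T S' \<and> S \<subseteq> S'}"

definition Tr_plus :: "('o, 'm::ab_group_add) dgcat \<Rightarrow>
    (('o, 'm) tw, (int \<Rightarrow> int \<Rightarrow> 'm) set) tcat" where
  "Tr_plus C = t_full (Tr C) (tri_gen (Tr C) (tw_single C ` Ob C))"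


section \<open>Functors\<close>

definition dg_functor :: "('o, 'm::ab_group_add) dgcat \<Rightarrow> ('p, 'n::ab_group_add) dgcat \<Rightarrow>
    ('o \<Rightarrow> 'p) \<Rightarrow> ('o \<Rightarrow> 'o \<Rightarrow> int \<Rightarrow> 'm \<Rightarrow> 'n) \<Rightarrow> bool" where
  "dg_functor C D F Fm \<longleftrightarrow>
     (\<forall>X\<in>Ob C. F X \<in> Ob D) \<and>
     (\<forall>X\<in>Ob C. Fm X X 0 (idn C X) = idn D (F X)) \<and>
     (\<forall>X\<in>Ob C. \<forall>Y\<in>Ob C. \<forall>i. \<forall>f\<in>Mor C X Y i. Fm X Y i f \<in> Mor D (F X) (F Y) i \<and>
        Fm X Y (i + 1) (dif C X Y i f) = dif D (F X) (F Y) i (Fm X Y i f) \<and>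
        (\<forall>g\<in>Mor C X Y i. Fm X Y i (f + g) = Fm X Y i f + Fm X Y i g)) \<and>
     (\<forall>X\<in>Ob C. \<forall>Y\<in>Ob C. \<forall>Z\<in>Ob C. \<forall>i j. \<forall>f\<in>Mor C Y Z i. \<forall>g\<in>Mor C X Y j.
        Fm X Z (i + j) (cmp C X Y Z i j f g) =
          cmp D (F X) (F Y) (F Z) i j (Fm Y Z i f) (Fm X Y j g))"

text \<open>The effect of a differential graded functor on morphisms of the homotopy categories.\<close>

definition H0_mor :: "('p, 'n::ab_group_add) dgcat \<Rightarrow> ('o \<Rightarrow> 'p) \<Rightarrow> ('o \<Rightarrow> 'o \<Rightarrow> int \<Rightarrow> 'm \<Rightarrow> 'n) \<Rightarrow>
    'o \<Rightarrow> 'o \<Rightarrow> 'm set \<Rightarrow> 'n set" where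
  "H0_mor D F Fm X Y \<phi> = (\<Union>f\<in>\<phi>. hclass D (F X) (F Y) (Fm X Y 0 f))"

definition tri_functor :: "('o, 'h) tcat \<Rightarrow> ('p, 'g) tcat \<Rightarrow>
    ('o \<Rightarrow> 'p) \<Rightarrow> ('o \<Rightarrow> 'o \<Rightarrow> 'h \<Rightarrow> 'g) \<Rightarrow> ('o \<Rightarrow> 'g) \<Rightarrow> bool" where
  "tri_functor T T' F Fm \<theta> \<longleftrightarrow>
     (\<forall>X\<in>lOb T. F X \<in> lOb T') \<and>
     (\<forall>X\<in>lOb T. Fm X X (lidn T X) = lidn T' (F X)) \<and>
     (\<forall>X\<in>lOb T. \<forall>Y\<in>lOb T. \<forall>\<phi>\<in>lMor T X Y. Fm X Y \<phi> \<in> lMor T' (F X) (F Y) \<and>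
        (\<forall>\<psi>\<in>lMor T X Y. Fm X Y (ladd T X Y \<phi> \<psi>) = ladd T' (F X) (F Y) (Fm X Y \<phi>) (Fm X Y \<psi>))) \<and>
     (\<forall>X\<in>lOb T. \<forall>Y\<in>lOb T. \<forall>Z\<in>lOb T. \<forall>\<phi>\<in>lMor T Y Z. \<forall>\<psi>\<in>lMor T X Y.
        Fm X Z (lcmp T X Y Z \<phi> \<psi>) = lcmp T' (F X) (F Y) (F Z) (Fm Y Z \<phi>) (Fm X Y \<psi>)) \<and>
     (\<forall>X\<in>lOb T. l_iso T' (F (tsh T X)) (tsh T' (F X)) (\<theta> X)) \<and>
     (\<forall>X\<in>lOb T. \<forall>Y\<in>lOb T. \<forall>\<phi>\<in>lMor T X Y.
        lcmp T' (F (tsh T X)) (F (tsh T Y)) (tsh T' (F Y)) (\<theta> Y) (Fm (tsh T X) (tsh T Y) (tshm T X Y \<phi>)) =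
        lcmp T' (F (tsh T X)) (tsh T' (F X)) (tsh T' (F Y)) (tshm T' (F X) (F Y) (Fm X Y \<phi>)) (\<theta> X)) \<and>
     (\<forall>(X, Y, Z, \<phi>, \<psi>, \<chi>)\<in>tri T.
        (F X, F Y, F Z, Fm X Y \<phi>, Fm Y Z \<psi>,
         lcmp T' (F Z) (F (tsh T X)) (tsh T' (F X)) (\<theta> X) (Fm Z (tsh T X) \<chi>)) \<in> tri T')"

definition tri_equivalence :: "('o, 'h) tcat \<Rightarrow> ('p, 'g) tcat \<Rightarrow>
    ('o \<Rightarrow> 'p) \<Rightarrow> ('o \<Rightarrow> 'o \<Rightarrow> 'h \<Rightarrow> 'g) \<Rightarrow> bool" where
  "tri_equivalence T T' F Fm \<longleftrightarrow> (\<exists>\<theta>. tri_functor T T' F Fm \<theta>) \<and>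
     (\<forall>X\<in>lOb T. \<forall>Y\<in>lOb T. bij_betw (Fm X Y) (lMor T X Y) (lMor T' (F X) (F Y))) \<and>
     (\<forall>Y\<in>lOb T'. \<exists>X\<in>lOb T. l_isomorphic T' (F X) Y)"

end

theory Submission
  imports Defs
begin

text \<open>
  Write \<open>D = PreTr J\<close>.  Every twisted complex \<open>X\<close> over \<open>D\<close> is isomorphic in \<open>PreTr D\<close>, by a closed isomorphism of
  degree 0, to an object of \<open>D\<close> placed in degree 0: form the direct sum of the suitably shifted terms of \<open>X\<close>
  and add the transported twisting cochain to its differential.  Conjugating with these isomorphisms gives
  a differential graded functor \<open>F\<close> from \<open>PreTr D\<close> to \<open>D\<close> that is bijective on morphism complexes, and it is
  restricted to the twisted complexes with terms in \<open>B'\<close>.  Shifts and cones are described by equations between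
  morphisms, so \<open>F\<close> preserves them and induces a fully faithful triangulated functor.  The objects mapped
  into the subcategory generated by \<open>B\<close> form a triangulated subcategory, and so does the essential image of
  \<open>Tr\<^sup>+ B'\<close>, because cones of homotopy equivalent morphisms are homotopy equivalent.
\<close>

section \<open>Signs\<close>

text \<open>Convolution asks two things of the target category, isolated as
  \<open>has_shifted_sums\<close> and \<open>has_twists\<close>. \<open>PreTr C\<close> provides
  both: the sum of \<open>Y\<close> with a shift of \<open>P\<close> is the cone of a zero morphism,
  and a twist by \<open>x\<close> keeps the terms and replaces \<open>snd X\<close> by
  \<open>snd X + x\<close>. The same mechanism gives the axioms for \<open>PreTr C\<close> itself,
  as the category of graded matrices with its differential twisted by \<open>snd\<close>. One
  obstacle is that \<open>tw_cone\<close> speaks of termwise direct sums with chosen structure maps,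
  which a dg functor on \<open>PreTr\<close> need not respect, nor need it commute strictly with the
  shift. Hence \<open>dg_ext\<close>, which keeps of a cone only maps inside \<open>PreTr\<close>
  and their differentials and still determines it up to isomorphism; the shift enters through closed
  invertible maps of degree 1 and -1, whose images give the comparison \<open>th\<close>. Another
  obstacle is the padding of \<open>tw_single\<close> by a chosen zero object: the choices for
  \<open>B'\<close> and for \<open>PreTr J\<close> may differ. For the functor to send singles
  exactly to the elements of \<open>B'\<close>, it is normalised on all \<open>concentrated\<close>
  complexes, whatever their padding.\<close>

lemma sgn_pow_0 [simp]: "sgn_pow 0 a = a"
  by (simp add: sgn_pow_def)

lemma sgn_pow_1 [simp]: "sgn_pow 1 a = - a"
  by (simp add: sgn_pow_def)

lemma sgn_pow_zero [simp]: "sgn_pow n 0 = 0"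
  by (simp add: sgn_pow_def)

lemma sgn_pow_sgn_pow [simp]: "sgn_pow m (sgn_pow n a) = sgn_pow (m + n) a"
  by (simp add: sgn_pow_def)

lemma sgn_pow_add: "sgn_pow n (a + b) = sgn_pow n a + sgn_pow n b"
  by (simp add: sgn_pow_def)

lemma sgn_pow_diff: "sgn_pow n (a - b) = sgn_pow n a - sgn_pow n b"
  by (simp add: sgn_pow_def)

lemma sgn_pow_sum: "sgn_pow n (\<Sum>x\<in>A. f x) = (\<Sum>x\<in>A. sgn_pow n (f x))"
  by (simp add: sgn_pow_def sum_negf)

lemma sgn_pow_cong: "even (m - n) \<Longrightarrow> sgn_pow m a = sgn_pow n a"
  by (auto simp: sgn_pow_def)

lemma sgn_pow_eq_self: "even n \<Longrightarrow> sgn_pow n a = a"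
  by (simp add: sgn_pow_def)

lemma sgn_pow_apply: "sgn_pow n f x = sgn_pow n (f x)"
  by (simp add: sgn_pow_def)

lemma sgn_pow_Suc: "sgn_pow (n + 1) a = - sgn_pow n a"
  by (simp add: sgn_pow_def)

section \<open>Calculus in differential graded categories\<close>

context dg_category
begin

section \<open>Linearity and sign rules derived from the axioms\<close>

lemma minus_Mor: "\<lbrakk>X \<in> Ob C; Y \<in> Ob C; f \<in> Mor C X Y i\<rbrakk> \<Longrightarrow> - f \<in> Mor C X Y i"
  using diff_Mor[OF _ _ zero_Mor, of X Y f i] by simp

lemma add_Mor: "\<lbrakk>X \<in> Ob C; Y \<in> Ob C; f \<in> Mor C X Y i; g \<in> Mor C X Y i\<rbrakk> \<Longrightarrow> f + g \<in> Mor C X Y i"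
  using diff_Mor[of X Y f i "- g"] minus_Mor by simp

lemma sgn_Mor: "\<lbrakk>X \<in> Ob C; Y \<in> Ob C; f \<in> Mor C X Y i\<rbrakk> \<Longrightarrow> sgn_pow n f \<in> Mor C X Y i"
  by (simp add: sgn_pow_def minus_Mor)

lemma sum_Mor:
  assumes "X \<in> Ob C" "Y \<in> Ob C" "\<And>a. a \<in> A \<Longrightarrow> f a \<in> Mor C X Y i"
  shows "(\<Sum>a\<in>A. f a) \<in> Mor C X Y i"
  using assms(3)
  by (induction A rule: infinite_finite_induct) (auto intro: zero_Mor add_Mor assms(1,2))

text \<open>The degree of the result is a variable tied by an equation, because the degrees met
  later are expressions such as \<open>l + i - j\<close> that do not unify with
  \<open>i + j\<close>. The other rules with suffix \<open>_deg\<close> have this form for the same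
  reason.\<close>

lemma cmp_Mor_deg: "\<lbrakk>X \<in> Ob C; Y \<in> Ob C; Z \<in> Ob C; f \<in> Mor C Y Z i; g \<in> Mor C X Y j; n = i + j\<rbrakk>
    \<Longrightarrow> cmp C X Y Z i j f g \<in> Mor C X Z n"
  by (simp add: cmp_Mor)

lemma dif_Mor_deg: "\<lbrakk>X \<in> Ob C; Y \<in> Ob C; f \<in> Mor C X Y i; n = i + 1\<rbrakk> \<Longrightarrow> dif C X Y i f \<in> Mor C X Y n"
  by (simp add: dif_Mor)

lemma dif_dif_deg: "\<lbrakk>X \<in> Ob C; Y \<in> Ob C; f \<in> Mor C X Y i; n = i + 1\<rbrakk> \<Longrightarrow> dif C X Y n (dif C X Y i f) = 0"
  by (simp add: dif_dif)

lemmas Mor_rules = zero_Mor diff_Mor minus_Mor add_Mor sgn_Mor idn_Mor cmp_Mor_deg dif_Mor_deg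

lemma dif_zero: "\<lbrakk>X \<in> Ob C; Y \<in> Ob C\<rbrakk> \<Longrightarrow> dif C X Y i 0 = 0"
  using dif_add[of X Y 0 i 0] zero_Mor[of X Y i] by simp

lemma dif_minus: "\<lbrakk>X \<in> Ob C; Y \<in> Ob C; f \<in> Mor C X Y i\<rbrakk> \<Longrightarrow> dif C X Y i (- f) = - dif C X Y i f"
  using dif_add[of X Y f i "- f"] minus_Mor[of X Y f i] dif_zero[of X Y i]
  by (simp add: add_eq_0_iff)

lemma dif_diff: "\<lbrakk>X \<in> Ob C; Y \<in> Ob C; f \<in> Mor C X Y i; g \<in> Mor C X Y i\<rbrakk>
    \<Longrightarrow> dif C X Y i (f - g) = dif C X Y i f - dif C X Y i g"
  using dif_add[of X Y f i "- g"] minus_Mor[of X Y g i] dif_minus[of X Y g i] by simp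

lemma dif_sgn: "\<lbrakk>X \<in> Ob C; Y \<in> Ob C; f \<in> Mor C X Y i\<rbrakk>
    \<Longrightarrow> dif C X Y i (sgn_pow n f) = sgn_pow n (dif C X Y i f)"
  by (simp add: sgn_pow_def dif_minus)

lemma dif_sum:
  assumes "X \<in> Ob C" "Y \<in> Ob C" "\<And>a. a \<in> A \<Longrightarrow> f a \<in> Mor C X Y i"
  shows "dif C X Y i (\<Sum>a\<in>A. f a) = (\<Sum>a\<in>A. dif C X Y i (f a))"
  using assms(3)
  by (induction A rule: infinite_finite_induct) (auto simp: dif_zero dif_add sum_Mor assms(1,2))

lemma cmp_zero_left: "\<lbrakk>X \<in> Ob C; Y \<in> Ob C; Z \<in> Ob C; g \<in> Mor C X Y j\<rbrakk> \<Longrightarrow> cmp C X Y Z i j 0 g = 0"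
  using cmp_add_left[of X Y Z 0 i 0 g j] zero_Mor[of Y Z i] by simp

lemma cmp_zero_right: "\<lbrakk>X \<in> Ob C; Y \<in> Ob C; Z \<in> Ob C; f \<in> Mor C Y Z i\<rbrakk> \<Longrightarrow> cmp C X Y Z i j f 0 = 0"
  using cmp_add_right[of X Y Z f i 0 j 0] zero_Mor[of X Y j] by simp

lemma cmp_minus_left: "\<lbrakk>X \<in> Ob C; Y \<in> Ob C; Z \<in> Ob C; f \<in> Mor C Y Z i; g \<in> Mor C X Y j\<rbrakk>
    \<Longrightarrow> cmp C X Y Z i j (- f) g = - cmp C X Y Z i j f g"
  using cmp_add_left[of X Y Z f i "- f" g j] minus_Mor[of Y Z f i] cmp_zero_left[of X Y Z g j i]
  by (simp add: add_eq_0_iff)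

lemma cmp_minus_right: "\<lbrakk>X \<in> Ob C; Y \<in> Ob C; Z \<in> Ob C; f \<in> Mor C Y Z i; g \<in> Mor C X Y j\<rbrakk>
    \<Longrightarrow> cmp C X Y Z i j f (- g) = - cmp C X Y Z i j f g"
  using cmp_add_right[of X Y Z f i g j "- g"] minus_Mor[of X Y g j] cmp_zero_right[of X Y Z f i j]
  by (simp add: add_eq_0_iff)

lemma cmp_diff_left: "\<lbrakk>X \<in> Ob C; Y \<in> Ob C; Z \<in> Ob C; f \<in> Mor C Y Z i; f' \<in> Mor C Y Z i; g \<in> Mor C X Y j\<rbrakk>
    \<Longrightarrow> cmp C X Y Z i j (f - f') g = cmp C X Y Z i j f g - cmp C X Y Z i j f' g"
  using cmp_add_left[of X Y Z f i "- f'" g j] minus_Mor[of Y Z f' i] cmp_minus_left[of X Y Z f' i g j]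
  by simp

lemma cmp_diff_right: "\<lbrakk>X \<in> Ob C; Y \<in> Ob C; Z \<in> Ob C; f \<in> Mor C Y Z i; g \<in> Mor C X Y j; g' \<in> Mor C X Y j\<rbrakk>
    \<Longrightarrow> cmp C X Y Z i j f (g - g') = cmp C X Y Z i j f g - cmp C X Y Z i j f g'"
  using cmp_add_right[of X Y Z f i g j "- g'"] minus_Mor[of X Y g' j] cmp_minus_right[of X Y Z f i g' j]
  by simp

lemma cmp_sgn_left: "\<lbrakk>X \<in> Ob C; Y \<in> Ob C; Z \<in> Ob C; f \<in> Mor C Y Z i; g \<in> Mor C X Y j\<rbrakk>
    \<Longrightarrow> cmp C X Y Z i j (sgn_pow n f) g = sgn_pow n (cmp C X Y Z i j f g)"
  by (simp add: sgn_pow_def cmp_minus_left)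

lemma cmp_sgn_right: "\<lbrakk>X \<in> Ob C; Y \<in> Ob C; Z \<in> Ob C; f \<in> Mor C Y Z i; g \<in> Mor C X Y j\<rbrakk>
    \<Longrightarrow> cmp C X Y Z i j f (sgn_pow n g) = sgn_pow n (cmp C X Y Z i j f g)"
  by (simp add: sgn_pow_def cmp_minus_right)

lemma cmp_sum_left:
  assumes "X \<in> Ob C" "Y \<in> Ob C" "Z \<in> Ob C" "\<And>a. a \<in> A \<Longrightarrow> f a \<in> Mor C Y Z i" "g \<in> Mor C X Y j"
  shows "cmp C X Y Z i j (\<Sum>a\<in>A. f a) g = (\<Sum>a\<in>A. cmp C X Y Z i j (f a) g)"
  using assms(4)
  by (induction A rule: infinite_finite_induct)
    (auto simp: cmp_zero_left cmp_add_left sum_Mor assms(1,2,3,5))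

lemma cmp_sum_right:
  assumes "X \<in> Ob C" "Y \<in> Ob C" "Z \<in> Ob C" "f \<in> Mor C Y Z i" "\<And>a. a \<in> A \<Longrightarrow> g a \<in> Mor C X Y j"
  shows "cmp C X Y Z i j f (\<Sum>a\<in>A. g a) = (\<Sum>a\<in>A. cmp C X Y Z i j f (g a))"
  using assms(5)
  by (induction A rule: infinite_finite_induct)
    (auto simp: cmp_zero_right cmp_add_right sum_Mor assms(1-4))

lemma cmp_assoc_deg: "\<lbrakk>W \<in> Ob C; X \<in> Ob C; Y \<in> Ob C; Z \<in> Ob C; f \<in> Mor C Y Z i; g \<in> Mor C X Y j;
        h \<in> Mor C W X l; n = i + j; m = j + l\<rbrakk>
      \<Longrightarrow> cmp C W X Z n l (cmp C X Y Z i j f g) h = cmp C W Y Z i m f (cmp C W X Y j l g h)"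
  by (simp add: cmp_assoc)

lemma leibniz_deg: "\<lbrakk>X \<in> Ob C; Y \<in> Ob C; Z \<in> Ob C; f \<in> Mor C Y Z i; g \<in> Mor C X Y j; n = i + j\<rbrakk>
      \<Longrightarrow> dif C X Z n (cmp C X Y Z i j f g) =
          cmp C X Y Z i (j + 1) f (dif C X Y j g) +
          sgn_pow j (cmp C X Y Z (i + 1) j (dif C Y Z i f) g)"
  by (simp add: leibniz)

lemmas cmp_linear = cmp_add_left cmp_add_right cmp_diff_left cmp_diff_right cmp_minus_left cmp_minus_right
  cmp_sgn_left cmp_sgn_right cmp_zero_left cmp_zero_right

lemmas dif_linear = dif_add dif_diff dif_minus dif_sgn dif_zero

text \<open>Such a morphism equals its composite with the identity of \<open>Z\<close>, which is
  0.\<close>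

lemma zero_ob_Mor_to: "\<lbrakk>X \<in> Ob C; zero_ob C Z; f \<in> Mor C X Z i\<rbrakk> \<Longrightarrow> f = 0"
  using cmp_idn_left[of X Z f i] cmp_zero_left[of X Z Z f i 0] by (simp add: zero_ob_def)

lemma zero_ob_Mor_from: "\<lbrakk>X \<in> Ob C; zero_ob C Z; f \<in> Mor C Z X i\<rbrakk> \<Longrightarrow> f = 0"
  using cmp_idn_right[of Z X f i] cmp_zero_right[of Z Z X f i 0] by (simp add: zero_ob_def)

end

lemma dg_full_simps [simp]:
  "Ob (dg_full C S) = S" "Mor (dg_full C S) = Mor C" "dif (dg_full C S) = dif C"
  "cmp (dg_full C S) = cmp C" "idn (dg_full C S) = idn C"
  by (simp_all add: dg_full_def)

lemma dg_category_full:
  assumes "dg_category C" "S \<subseteq> Ob C"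
  shows "dg_category (dg_full C S)"
proof -
  interpret dg_category C by fact
  have S: "X \<in> S \<Longrightarrow> X \<in> Ob C" for X using assms(2) by blast
  show ?thesis
    by unfold_locales
      (simp_all add: S zero_Mor diff_Mor dif_Mor dif_add dif_dif idn_Mor dif_idn cmp_Mor cmp_add_left
        cmp_add_right cmp_idn_left cmp_idn_right leibniz cmp_assoc)
qed

section \<open>Twisting the differential\<close>

text \<open>The new differential squares to zero because \<open>q\<close> solves the Maurer-Cartan
  equation \<open>dq = q q\<close>. The Leibniz rule survives because the inner terms
  \<open>f q g\<close> coming from the two factors cancel. Composition and identities are those of
  \<open>M\<close>.\<close>

lemma dg_category_twist:
  fixes M D :: "('o, 'm::ab_group_add) dgcat"
  assumes "dg_category M"
    and sub: "Ob D \<subseteq> Ob M" and Mor_eq: "Mor D = Mor M" and cmp_eq: "cmp D = cmp M" and idn_eq: "idn D = idn M"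
    and q: "\<And>X. X \<in> Ob D \<Longrightarrow> q X \<in> Mor M X X 1"
    and mc: "\<And>X. X \<in> Ob D \<Longrightarrow> dif M X X 1 (q X) = cmp M X X X 1 1 (q X) (q X)"
    and dif_eq: "\<And>X Y l f. \<lbrakk>X \<in> Ob D; Y \<in> Ob D; f \<in> Mor M X Y l\<rbrakk> \<Longrightarrow>
      dif D X Y l f = dif M X Y l f + sgn_pow l (cmp M X Y Y 1 l (q Y) f) - cmp M X X Y l 1 f (q X)"
  shows "dg_category D"
proof -
  interpret M: dg_category M by fact
  have O: "X \<in> Ob D \<Longrightarrow> X \<in> Ob M" for X using sub by blast
  note Mr = M.Mor_rules O q
  have dM: "dif D X Y l f \<in> Mor M X Y (l + 1)" if "X \<in> Ob D" "Y \<in> Ob D" "f \<in> Mor M X Y l" for X Y l f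
    using that by (simp add: dif_eq Mr)
  show ?thesis
  proof (unfold_locales, goal_cases)
    \<comment> \<open>Goals are numbered in the order of the axioms of \<open>dg_category\<close>: 5
      is \<open>dif_dif\<close>, 14 is \<open>leibniz\<close>, 7 is \<open>dif_idn\<close>, 4 is
      \<open>dif_add\<close>.\<close>
    case (5 X Y f i)
    then have *: "X \<in> Ob D" "Y \<in> Ob D" "f \<in> Mor M X Y i" by (simp_all add: Mor_eq)
    have 1: "dif M X Y (i + 1) (cmp M X Y Y 1 i (q Y) f) =
       cmp M X Y Y 1 (i + 1) (q Y) (dif M X Y i f) + sgn_pow i (cmp M X Y Y 1 (i + 1) (q Y) (cmp M X Y Y 1 i (q Y) f))"
      using * by (simp add: Mr M.leibniz_deg mc M.cmp_assoc_deg add.commute)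
    have 2: "dif M X Y (i + 1) (cmp M X X Y i 1 f (q X)) =
       cmp M X X Y (i + 1) 1 (cmp M X X Y i 1 f (q X)) (q X) - cmp M X X Y (i + 1) 1 (dif M X Y i f) (q X)"
      using * by (simp add: Mr M.leibniz_deg mc M.cmp_assoc_deg)
    have 3: "dif D X Y (i + 1) (dif D X Y i f) =
       dif M X Y (i + 1) (dif M X Y i f) + sgn_pow i (dif M X Y (i + 1) (cmp M X Y Y 1 i (q Y) f))
       - dif M X Y (i + 1) (cmp M X X Y i 1 f (q X))
       + sgn_pow (i + 1) (cmp M X Y Y 1 (i + 1) (q Y) (dif M X Y i f)
           + sgn_pow i (cmp M X Y Y 1 (i + 1) (q Y) (cmp M X Y Y 1 i (q Y) f))
           - cmp M X Y Y 1 (i + 1) (q Y) (cmp M X X Y i 1 f (q X)))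
       - (cmp M X X Y (i + 1) 1 (dif M X Y i f) (q X)
           + sgn_pow i (cmp M X X Y (i + 1) 1 (cmp M X Y Y 1 i (q Y) f) (q X))
           - cmp M X X Y (i + 1) 1 (cmp M X X Y i 1 f (q X)) (q X))"
      using * by (simp add: dM dif_eq Mr M.dif_linear M.cmp_linear)
    \<comment> \<open>The mixed terms \<open>q f q\<close> occur twice in the square with opposite
      signs; bracketed alike, they cancel.\<close>
    have 4: "cmp M X X Y (i + 1) 1 (cmp M X Y Y 1 i (q Y) f) (q X) =
       cmp M X Y Y 1 (i + 1) (q Y) (cmp M X X Y i 1 f (q X))"
      using * by (simp add: Mr M.cmp_assoc_deg)
    show ?case
      unfolding 3 1 2 4 using * by (simp add: Mr M.dif_dif sgn_pow_Suc
          sgn_pow_add sgn_pow_diff  sgn_pow_eq_self)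
  next
    case (14 X Y Z f i g j)
    then have *: "X \<in> Ob D" "Y \<in> Ob D" "Z \<in> Ob D" "f \<in> Mor M Y Z i" "g \<in> Mor M X Y j"
      by (simp_all add: Mor_eq)
    show ?case
      using * by (simp add: cmp_eq dif_eq Mr M.cmp_linear M.leibniz_deg M.cmp_assoc_deg
          sgn_pow_add sgn_pow_diff add_ac)
  next
    case (7 X)
    then show ?case by (simp add: idn_eq dif_eq Mr M.dif_idn M.cmp_idn_left M.cmp_idn_right)
  next
    case (4 X Y f i g)
    then show ?case by (simp add: Mor_eq dif_eq Mr M.dif_add M.cmp_linear sgn_pow_add)
  qed (simp_all add: Mor_eq cmp_eq idn_eq O Mr M.cmp_assoc M.cmp_linear M.cmp_idn_left M.cmp_idn_right dM)
qed

section \<open>Graded matrices and twisted complexes\<close>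

text \<open>
  \<open>PreTr C\<close> arises from this category by twisting the differential by the elements \<open>snd X\<close>.
\<close>

definition graded_mat :: "('o, 'm::ab_group_add) dgcat \<Rightarrow> (('o, 'm) tw, int \<Rightarrow> int \<Rightarrow> 'm) dgcat" where
  "graded_mat C = \<lparr>Ob = {X. (\<forall>i. fst X i \<in> Ob C) \<and> finite (tw_supp C X)}, Mor = pretr_Mor C,
     dif = (\<lambda>X Y l f i j. dif C (fst X i) (fst Y j) (l + i - j) (f i j)), cmp = pretr_cmp C,
     idn = (\<lambda>X i j. if i = j then idn C (fst X i) else 0)\<rparr>"

lemma graded_mat_simps:
  "X \<in> Ob (graded_mat C) \<longleftrightarrow> (\<forall>i. fst X i \<in> Ob C) \<and> finite (tw_supp C X)"
  "Mor (graded_mat C) = pretr_Mor C"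
  "dif (graded_mat C) X Y l f = (\<lambda>i j. dif C (fst X i) (fst Y j) (l + i - j) (f i j))"
  "cmp (graded_mat C) = pretr_cmp C"
  "idn (graded_mat C) X = (\<lambda>i j. if i = j then idn C (fst X i) else 0)"
  by (simp_all add: graded_mat_def)

lemma PreTr_simps:
  "Ob (PreTr C) = pretr_Ob C" "Mor (PreTr C) = pretr_Mor C" "dif (PreTr C) = pretr_dif C"
  "cmp (PreTr C) = pretr_cmp C" "idn (PreTr C) = (\<lambda>X i j. if i = j then idn C (fst X i) else 0)"
  by (simp_all add: PreTr_def)

lemma tw_supp_cong: "fst X = fst Y \<Longrightarrow> tw_supp C X = tw_supp C Y"
  by (simp add: tw_supp_def)

text \<open>Morphism groups and composition depend on the terms \<open>fst X\<close> and not on the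
  matrix \<open>snd X\<close>, so a change of twist leaves them as they are.\<close>

lemma pretr_Mor_cong: "fst X = fst X' \<Longrightarrow> fst Y = fst Y' \<Longrightarrow> pretr_Mor C X Y = pretr_Mor C X' Y'"
  by (simp add: pretr_Mor_def fun_eq_iff)

lemma pretr_cmp_cong:
  "fst X = fst X' \<Longrightarrow> fst Y = fst Y' \<Longrightarrow> fst Z = fst Z' \<Longrightarrow> pretr_cmp C X Y Z = pretr_cmp C X' Y' Z'"
  by (simp add: pretr_cmp_def fun_eq_iff tw_supp_cong[of Y Y'])

context dg_category
begin

abbreviation "M \<equiv> graded_mat C"

abbreviation "D \<equiv> PreTr C"

text \<open>Compositions sum over nonzero middle terms, so the index \<open>p\<close> of interest
  may be missing from the sum. Its summand then vanishes by the last assumption, and later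
  computations need no case distinction.\<close>

lemma zero_ob_sum_single:
  assumes "finite (tw_supp C Y)" "\<And>m. m \<noteq> p \<Longrightarrow> t m = 0" "zero_ob C (fst Y p) \<Longrightarrow> t p = 0"
  shows "(\<Sum>m\<in>tw_supp C Y. t m) = t p"
proof (cases "p \<in> tw_supp C Y")
  case True
  then have "(\<Sum>m\<in>tw_supp C Y. t m) = (\<Sum>m\<in>{p}. t m)"
    by (intro sum.mono_neutral_right) (use assms in auto)
  then show ?thesis by simp
next
  case False
  then have "zero_ob C (fst Y p)" by (simp add: tw_supp_def)
  then have "t p = 0" by (rule assms(3))
  then show ?thesis using assms(2) by (metis sum.neutral)
qed

text \<open>Shift maps, diagonal matrices and maps of singles have at most one relevant nonzero
  entry in a row or column; for them matrix multiplication becomes one product with one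
  sign.\<close>

lemma pretr_cmp_single:
  assumes "X \<in> Ob M" "Y \<in> Ob M" "Z \<in> Ob M"
    and f: "f \<in> pretr_Mor C Y Z k" and g: "g \<in> pretr_Mor C X Y l"
    and "\<And>m. m \<noteq> p \<Longrightarrow> f m j = 0 \<or> g i m = 0"
  shows "pretr_cmp C X Y Z k l f g i j = sgn_pow ((p - i) * k)
     (cmp C (fst X i) (fst Y p) (fst Z j) (k + p - j) (l + i - p) (f p j) (g i p))"
proof -
  have O: "fst X i \<in> Ob C" "fst Y i \<in> Ob C" "fst Z i \<in> Ob C" for i
    using assms(1-3) by (simp_all add: graded_mat_simps)
  have f': "f m j \<in> Mor C (fst Y m) (fst Z j) (k + m - j)" for m j
    using f by (simp add: pretr_Mor_def)
  have g': "g i m \<in> Mor C (fst X i) (fst Y m) (l + i - m)" for i m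
    using g by (simp add: pretr_Mor_def)
  show ?thesis
    unfolding pretr_cmp_def
  proof (rule zero_ob_sum_single)
    show "finite (tw_supp C Y)" using assms(2) by (simp add: graded_mat_simps)
    fix m assume "m \<noteq> p"
    then have "f m j = 0 \<or> g i m = 0" by (rule assms(6))
    then show "sgn_pow ((m - i) * k)
        (cmp C (fst X i) (fst Y m) (fst Z j) (k + m - j) (l + i - m) (f m j) (g i m)) = 0"
      using O f'[of m j] g'[of i m] by (auto simp: cmp_zero_left cmp_zero_right)
  next
    assume "zero_ob C (fst Y p)"
    then have "g i p = 0" using zero_ob_Mor_to[OF _ _ g'] O by blast
    then show "sgn_pow ((p - i) * k)
        (cmp C (fst X i) (fst Y p) (fst Z j) (k + p - j) (l + i - p) (f p j) (g i p)) = 0"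
      using O f'[of p j] by (simp add: cmp_zero_right)
  qed
qed

text \<open>The signs are the point. In a triple product with middle indices \<open>m\<close> and
  \<open>n\<close>, both bracketings carry the exponent
  \<open>(n - a) * i + (m - a) * j\<close>.\<close>

lemma dg_category_graded_mat: "dg_category M"
proof -
  have Mr: "f \<in> pretr_Mor C X Y l \<longleftrightarrow> (\<forall>i j. f i j \<in> Mor C (fst X i) (fst Y j) (l + i - j))" for f X Y l
    by (simp add: pretr_Mor_def)
  have M: "pretr_cmp C X Y Z k l f g \<in> pretr_Mor C X Z (k + l)"
    if "\<forall>i. fst X i \<in> Ob C" "\<forall>i. fst Y i \<in> Ob C" "\<forall>i. fst Z i \<in> Ob C"
      "f \<in> pretr_Mor C Y Z k" "g \<in> pretr_Mor C X Y l" for X Y Z k l f g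
    using that by (simp add: Mr pretr_cmp_def) (intro allI sum_Mor sgn_Mor cmp_Mor_deg; simp)
  show ?thesis
  proof (unfold_locales, goal_cases)
    case (8 X Y Z f i g j)
    then show ?case by (simp add: graded_mat_simps M)
  next
    case (11 W X Y Z f i g j h l)
    then have O: "fst W a \<in> Ob C" "fst X a \<in> Ob C" "fst Y a \<in> Ob C" "fst Z a \<in> Ob C"
      and m: "f a b \<in> Mor C (fst Y a) (fst Z b) (i + a - b)" "g a b \<in> Mor C (fst X a) (fst Y b) (j + a - b)"
      "h a b \<in> Mor C (fst W a) (fst X b) (l + a - b)" for a b
      by (simp_all add: graded_mat_simps Mr)
    let ?s = "\<lambda>a n m. (n - a) * i + (m - a) * j"
    let ?c = "\<lambda>a b n m. cmp C (fst W a) (fst Y n) (fst Z b) (i + n - b) (j + l + a - n) (f n b)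
        (cmp C (fst W a) (fst X m) (fst Y n) (j + m - n) (l + a - m) (g m n) (h a m))"
    have "pretr_cmp C W X Z (i + j) l (pretr_cmp C X Y Z i j f g) h a b =
        pretr_cmp C W Y Z i (j + l) f (pretr_cmp C W X Y j l g h) a b" for a b
    proof -
      have 1: "cmp C (fst W a) (fst X m) (fst Z b) (i + j + m - b) (l + a - m)
            (\<Sum>n\<in>tw_supp C Y. sgn_pow ((n - m) * i)
              (cmp C (fst X m) (fst Y n) (fst Z b) (i + n - b) (j + m - n) (f n b) (g m n))) (h a m) =
          (\<Sum>n\<in>tw_supp C Y. sgn_pow ((n - m) * i) (?c a b n m))" for m
      proof -
        have "cmp C (fst W a) (fst X m) (fst Z b) (i + j + m - b) (l + a - m)
            (cmp C (fst X m) (fst Y n) (fst Z b) (i + n - b) (j + m - n) (f n b) (g m n)) (h a m) = ?c a b n m" for n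
          by (rule cmp_assoc_deg) (auto intro: O m)
        then show ?thesis
          by (subst cmp_sum_left)
            (auto intro!: O m sgn_Mor cmp_Mor_deg sum.cong simp: cmp_sgn_left O m cmp_Mor_deg)
      qed
      have 2: "cmp C (fst W a) (fst Y n) (fst Z b) (i + n - b) (j + l + a - n) (f n b)
            (\<Sum>m\<in>tw_supp C X. sgn_pow ((m - a) * j)
              (cmp C (fst W a) (fst X m) (fst Y n) (j + m - n) (l + a - m) (g m n) (h a m))) =
          (\<Sum>m\<in>tw_supp C X. sgn_pow ((m - a) * j) (?c a b n m))" for n
        by (subst cmp_sum_right)
          (auto intro!: O m sgn_Mor cmp_Mor_deg sum.cong simp: cmp_sgn_right O m cmp_Mor_deg)
      have "pretr_cmp C W X Z (i + j) l (pretr_cmp C X Y Z i j f g) h a b =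
          (\<Sum>m\<in>tw_supp C X. \<Sum>n\<in>tw_supp C Y. sgn_pow (?s a n m) (?c a b n m))"
        by (subst pretr_cmp_def, subst pretr_cmp_def, subst 1) (simp add: sgn_pow_sum algebra_simps)
      also have "\<dots> = (\<Sum>n\<in>tw_supp C Y. \<Sum>m\<in>tw_supp C X. sgn_pow (?s a n m) (?c a b n m))"
        by (rule sum.swap)
      also have "\<dots> = pretr_cmp C W Y Z i (j + l) f (pretr_cmp C W X Y j l g h) a b"
        by (subst pretr_cmp_def, subst pretr_cmp_def, subst 2) (simp add: sgn_pow_sum)
      finally show ?thesis .
    qed
    then show ?case by (simp add: graded_mat_simps fun_eq_iff)
  next
    case (12 X Y f i)
    show ?case
    proof (intro ext)
      fix a b
      have "pretr_cmp C X Y Y 0 i (\<lambda>i j. if i = j then idn C (fst Y i) else 0) f a b = f a b"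
        using 12 by (subst pretr_cmp_single[where p = b]) (auto simp: graded_mat_simps Mr idn_Mor zero_Mor cmp_idn_left)
      then show "cmp M X Y Y 0 i (idn M Y) f a b = f a b"
        by (simp add: graded_mat_simps)
    qed
  next
    case (13 X Y f i)
    show ?case
    proof (intro ext)
      fix a b
      have "pretr_cmp C X X Y i 0 f (\<lambda>i j. if i = j then idn C (fst X i) else 0) a b = f a b"
        using 13 by (subst pretr_cmp_single[where p = a]) (auto simp: graded_mat_simps Mr idn_Mor zero_Mor cmp_idn_right)
      then show "cmp M X X Y i 0 f (idn M X) a b = f a b"
        by (simp add: graded_mat_simps)
    qed
  next
    case (14 X Y Z f i g j)
    then have O: "fst X a \<in> Ob C" "fst Y a \<in> Ob C" "fst Z a \<in> Ob C"
      and m: "f a b \<in> Mor C (fst Y a) (fst Z b) (i + a - b)" "g a b \<in> Mor C (fst X a) (fst Y b) (j + a - b)" for a b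
      by (simp_all add: graded_mat_simps Mr)
    \<comment> \<open>The entrywise Leibniz rule contributes the degree \<open>j + a - m\<close> of
      \<open>g a m\<close>. Together with the composition sign for degree \<open>i\<close> this is
      the total sign \<open>(-1)^j\<close> times the composition sign for degree
      \<open>i + 1\<close>.\<close>
    have s: "sgn_pow ((m - a) * i + (j + a - m)) x = sgn_pow (j + (m - a) * (i + 1)) x" for m a and x ::'m
      by (rule sgn_pow_cong) (simp add: algebra_simps)
    have ix: "j + a - m + 1 = j + 1 + a - m" "i + m - b + 1 = i + 1 + m - b" "i + j + 1 + a - b = i + j + a - b + 1"
      for a m b by simp_all
    have "dif C (fst X a) (fst Z b) (i + j + a - b) (pretr_cmp C X Y Z i j f g a b) =
        pretr_cmp C X Y Z i (j + 1) f (\<lambda>a b. dif C (fst X a) (fst Y b) (j + a - b) (g a b)) a b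
        + sgn_pow j (pretr_cmp C X Y Z (i + 1) j (\<lambda>a b. dif C (fst Y a) (fst Z b) (i + a - b) (f a b)) g a b)" for a b
      unfolding pretr_cmp_def sgn_pow_sum sum.distrib[symmetric]
      by (subst dif_sum)
        (auto intro!: sum.cong sgn_Mor cmp_Mor_deg O m simp: dif_sgn O m cmp_Mor_deg leibniz_deg sgn_pow_add s ix)
    then show ?case by (simp add: graded_mat_simps fun_eq_iff sgn_pow_apply)
  next
    case (9 X Y Z f i f' g j)
    then show ?case
      by (auto simp: graded_mat_simps fun_eq_iff pretr_cmp_def sum.distrib[symmetric] sgn_pow_add[symmetric] Mr
          intro!: sum.cong arg_cong[of _ _ "sgn_pow _"] cmp_add_left)
  next
    case (10 X Y Z f i g j g')
    then show ?case
      by (auto simp: graded_mat_simps fun_eq_iff pretr_cmp_def sum.distrib[symmetric] sgn_pow_add[symmetric] Mr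
          intro!: sum.cong arg_cong[of _ _ "sgn_pow _"] cmp_add_right)
  next
    case (3 X Y f i)
    then show ?case by (auto simp: graded_mat_simps Mr intro!: dif_Mor_deg)
  next
    case (5 X Y f i)
    then show ?case by (simp add: graded_mat_simps Mr fun_eq_iff dif_dif_deg)
  next
    case (7 X)
    then show ?case by (auto simp: graded_mat_simps fun_eq_iff dif_idn dif_zero)
  qed (auto simp: graded_mat_simps Mr fun_eq_iff zero_Mor diff_Mor dif_add idn_Mor)
qed

text \<open>The exponent \<open>i - l + 1\<close> in the definition of \<open>pretr_Ob\<close> is
  opposite in parity to the exponent \<open>l - i\<close> of the product of two matrices of degree
  1, so the condition turns into \<open>dq = q q\<close>.\<close>

lemma PreTr_Ob_iff:
  "X \<in> Ob D \<longleftrightarrow> X \<in> Ob M \<and> snd X \<in> Mor M X X 1 \<and>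
     dif M X X 1 (snd X) = cmp M X X X 1 1 (snd X) (snd X)"
proof -
  obtain P q where X: "X = (P, q)" by fastforce
  have [simp]: "i - j + 1 = 1 + i - j" "1 + i - j + 1 = 2 + i - j" for i j :: int by simp_all
  have "(x + (\<Sum>l\<in>A. sgn_pow (i - l + 1) (t l)) = 0) = (x = (\<Sum>l\<in>A. sgn_pow (l - i) (t l)))"
    for x ::'m and A i t
  proof -
    have "(\<Sum>l\<in>A. sgn_pow (i - l + 1) (t l)) = - (\<Sum>l\<in>A. sgn_pow (l - i) (t l))"
      unfolding sum_negf[symmetric] by (intro sum.cong) (auto simp: sgn_pow_def)
    then show ?thesis by simp
  qed
  then show ?thesis
    by (auto simp: X PreTr_simps pretr_Ob_def graded_mat_simps pretr_Mor_def pretr_cmp_def fun_eq_iff)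
qed

text \<open>The sign with exponent \<open>l + i - m\<close> splits into \<open>(-1)^l\<close> and
  the composition sign of the degree 1 matrix \<open>snd Y\<close>. This is the differential
  required by \<open>dg_category_twist\<close>.\<close>

lemma PreTr_dif_eq:
  "dif D X Y l f = dif M X Y l f
     + sgn_pow l (cmp M X Y Y 1 l (snd Y) f) - cmp M X X Y l 1 f (snd X)"
proof -
  have [simp]: "i - j + 1 = 1 + i - j" for i j :: int by simp
  have s: "sgn_pow (l + i - m) x = sgn_pow (l + (m - i)) x" for x ::'m and i m
    by (rule sgn_pow_cong) simp
  show ?thesis
    by (simp add: fun_eq_iff PreTr_simps graded_mat_simps pretr_dif_def pretr_cmp_def sgn_pow_sum sgn_pow_apply s)
qed

lemma PreTr_graded_mat:
  "Mor D = Mor M" "cmp D = cmp M" "idn D = idn M"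
  by (simp_all add: PreTr_simps graded_mat_simps fun_eq_iff)

lemma dg_category_PreTr: "dg_category D"
  by (rule dg_category_twist[OF dg_category_graded_mat, where q = snd])
    (auto simp: PreTr_Ob_iff PreTr_graded_mat PreTr_dif_eq)

end

section \<open>Homotopy categories\<close>

definition h_inverse :: "('o, 'm::ab_group_add) dgcat \<Rightarrow> 'o \<Rightarrow> 'o \<Rightarrow> 'm \<Rightarrow> 'm \<Rightarrow> bool" where
  "h_inverse C X Y f g \<longleftrightarrow> f \<in> closed_mor C X Y \<and> g \<in> closed_mor C Y X \<and>
     hclass C X X (cmp C X Y X 0 0 g f) = hclass C X X (idn C X) \<and>
     hclass C Y Y (cmp C Y X Y 0 0 f g) = hclass C Y Y (idn C Y)"

lemma h_inverse_sym: "h_inverse C X Y f g \<Longrightarrow> h_inverse C Y X g f"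
  by (simp add: h_inverse_def)

lemma H0_simps:
  "lOb (H0 D) = Ob D" "lMor (H0 D) X Y = hclass D X Y ` closed_mor D X Y"
  "lidn (H0 D) X = hclass D X X (idn D X)" "lzero (H0 D) X Y = hclass D X Y 0"
  by (simp_all add: H0_def)

context dg_category
begin

lemma closed_mor_Mor: "f \<in> closed_mor C X Y \<Longrightarrow> f \<in> Mor C X Y 0"
  by (simp add: closed_mor_def)

lemma closed_mor_dif: "f \<in> closed_mor C X Y \<Longrightarrow> dif C X Y 0 f = 0"
  by (simp add: closed_mor_def)

lemma closed_idn: "X \<in> Ob C \<Longrightarrow> idn C X \<in> closed_mor C X X"
  by (simp add: closed_mor_def idn_Mor dif_idn)

lemma closed_zero: "X \<in> Ob C \<Longrightarrow> Y \<in> Ob C \<Longrightarrow> 0 \<in> closed_mor C X Y"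
  by (simp add: closed_mor_def zero_Mor dif_zero)

lemma closed_add: "X \<in> Ob C \<Longrightarrow> Y \<in> Ob C \<Longrightarrow> f \<in> closed_mor C X Y \<Longrightarrow> g \<in> closed_mor C X Y \<Longrightarrow>
    f + g \<in> closed_mor C X Y"
  by (simp add: closed_mor_def add_Mor dif_add)

lemma closed_diff: "X \<in> Ob C \<Longrightarrow> Y \<in> Ob C \<Longrightarrow> f \<in> closed_mor C X Y \<Longrightarrow> g \<in> closed_mor C X Y \<Longrightarrow>
    f - g \<in> closed_mor C X Y"
  by (simp add: closed_mor_def diff_Mor dif_diff)

lemma closed_cmp: "\<lbrakk>X \<in> Ob C; Y \<in> Ob C; Z \<in> Ob C; f \<in> closed_mor C Y Z; g \<in> closed_mor C X Y\<rbrakk>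
    \<Longrightarrow> cmp C X Y Z 0 0 f g \<in> closed_mor C X Z"
  by (simp add: closed_mor_def cmp_Mor_deg leibniz_deg cmp_zero_left cmp_zero_right)

lemma mem_hclass: "X \<in> Ob C \<Longrightarrow> Y \<in> Ob C \<Longrightarrow> f \<in> hclass C X Y f"
  unfolding hclass_def using zero_Mor[of X Y "-1"] dif_zero[of X Y "-1"] by force

lemma hclass_eq_iff:
  assumes "X \<in> Ob C" "Y \<in> Ob C"
  shows "hclass C X Y f = hclass C X Y g \<longleftrightarrow> (\<exists>h\<in>Mor C X Y (-1). f = g + dif C X Y (-1) h)"
proof
  assume "hclass C X Y f = hclass C X Y g"
  then have "f \<in> hclass C X Y g" using mem_hclass[OF assms, of f] by simp
  then show "\<exists>h\<in>Mor C X Y (-1). f = g + dif C X Y (-1) h" by (auto simp: hclass_def)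
next
  assume "\<exists>h\<in>Mor C X Y (-1). f = g + dif C X Y (-1) h"
  then obtain h where h: "h \<in> Mor C X Y (-1)" "f = g + dif C X Y (-1) h" by blast
  have "f + dif C X Y (-1) k = g + dif C X Y (-1) (h + k)"
    and "g + dif C X Y (-1) k = f + dif C X Y (-1) (k - h)" if "k \<in> Mor C X Y (-1)" for k
    using that h assms by (simp_all add: dif_add dif_diff)
  then show "hclass C X Y f = hclass C X Y g"
    using add_Mor[OF assms h(1)] diff_Mor[OF assms _ h(1)] by (fastforce simp: hclass_def)
qed

lemma hclass_mem_eq: "X \<in> Ob C \<Longrightarrow> Y \<in> Ob C \<Longrightarrow> f' \<in> hclass C X Y f \<Longrightarrow> hclass C X Y f' = hclass C X Y f"
  by (subst hclass_eq_iff) (auto simp: hclass_def)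

lemma hclass_cmp_cong:
  assumes "X \<in> Ob C" "Y \<in> Ob C" "Z \<in> Ob C" "f \<in> closed_mor C Y Z" "g \<in> closed_mor C X Y"
    and f': "hclass C Y Z f' = hclass C Y Z f" and g': "hclass C X Y g' = hclass C X Y g"
  shows "hclass C X Z (cmp C X Y Z 0 0 f' g') = hclass C X Z (cmp C X Y Z 0 0 f g)"
proof -
  obtain h k where h: "h \<in> Mor C Y Z (-1)" "f' = f + dif C Y Z (-1) h"
    and k: "k \<in> Mor C X Y (-1)" "g' = g + dif C X Y (-1) k"
    using f' g' assms(1-3) by (auto simp: hclass_eq_iff)
  note c = assms(1-3) closed_mor_Mor[OF assms(4)] closed_mor_Mor[OF assms(5)]
    closed_mor_dif[OF assms(4)] closed_mor_dif[OF assms(5)] h(1) k(1)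
  \<comment> \<open>As \<open>f\<close> and \<open>g'\<close> are closed, the homotopy
    \<open>f k + h g'\<close> has differential \<open>f dk + dh g'\<close>, which is
    \<open>f' g' - f g\<close>.\<close>
  have "cmp C X Y Z 0 0 f' g' = cmp C X Y Z 0 0 f g
      + dif C X Z (-1) (cmp C X Y Z 0 (-1) f k + cmp C X Y Z (-1) 0 h g')"
    unfolding h(2) k(2) using c
    by (simp add: cmp_Mor_deg dif_Mor_deg add_Mor dif_add cmp_add_left cmp_add_right leibniz_deg dif_dif_deg
        cmp_zero_left cmp_zero_right zero_Mor add_ac)
  moreover have "cmp C X Y Z 0 (-1) f k + cmp C X Y Z (-1) 0 h g' \<in> Mor C X Z (-1)"
    unfolding k(2) using c by (simp add: add_Mor cmp_Mor_deg dif_Mor_deg)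
  ultimately show ?thesis using assms(1,3) by (auto simp: hclass_eq_iff)
qed

text \<open>The union over all pairs of representatives collapses, since every pair yields the same
  class.\<close>

lemma H0_cmp:
  assumes "X \<in> Ob C" "Y \<in> Ob C" "Z \<in> Ob C" "f \<in> closed_mor C Y Z" "g \<in> closed_mor C X Y"
  shows "lcmp (H0 C) X Y Z (hclass C Y Z f) (hclass C X Y g) = hclass C X Z (cmp C X Y Z 0 0 f g)"
proof -
  have "(\<Union>f'\<in>hclass C Y Z f. \<Union>g'\<in>hclass C X Y g. hclass C X Z (cmp C X Y Z 0 0 f' g')) =
      (\<Union>f'\<in>hclass C Y Z f. \<Union>g'\<in>hclass C X Y g. hclass C X Z (cmp C X Y Z 0 0 f g))"
    using assms by (intro SUP_cong refl hclass_cmp_cong hclass_mem_eq)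
  also have "\<dots> = hclass C X Z (cmp C X Y Z 0 0 f g)"
    using mem_hclass[of Y Z f] mem_hclass[of X Y g] assms by blast
  finally show ?thesis by (simp add: H0_def)
qed

lemma H0_add:
  assumes O: "X \<in> Ob C" "Y \<in> Ob C"
  shows "ladd (H0 C) X Y (hclass C X Y f) (hclass C X Y g) = hclass C X Y (f + g)"
proof -
  have "{a + b | a b. a \<in> hclass C X Y f \<and> b \<in> hclass C X Y g} = hclass C X Y (f + g)"
  proof (intro equalityI subsetI)
    fix x assume "x \<in> {a + b | a b. a \<in> hclass C X Y f \<and> b \<in> hclass C X Y g}"
    then obtain h k where hk: "h \<in> Mor C X Y (-1)" "k \<in> Mor C X Y (-1)"
      and "x = (f + dif C X Y (-1) h) + (g + dif C X Y (-1) k)"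
      by (auto simp: hclass_def)
    then have "x = f + g + dif C X Y (-1) (h + k)" using O by (simp add: dif_add)
    then show "x \<in> hclass C X Y (f + g)"
      using add_Mor[OF O hk] by (auto simp: hclass_def)
  next
    fix x assume "x \<in> hclass C X Y (f + g)"
    then obtain h where h: "h \<in> Mor C X Y (-1)" "x = f + g + dif C X Y (-1) h"
      by (auto simp: hclass_def)
    then have "f + dif C X Y (-1) h \<in> hclass C X Y f" "x = (f + dif C X Y (-1) h) + g"
      by (auto simp: hclass_def)
    then show "x \<in> {a + b | a b. a \<in> hclass C X Y f \<and> b \<in> hclass C X Y g}"
      using mem_hclass[OF O, of g] by blast
  qed
  then show ?thesis by (simp add: H0_def)
qed

section \<open>Isomorphisms of the homotopy category as homotopy equivalences\<close>

lemma l_iso_H0: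
  assumes "X \<in> Ob C" "Y \<in> Ob C"
  shows "l_iso (H0 C) X Y \<phi> \<longleftrightarrow> (\<exists>f g. \<phi> = hclass C X Y f \<and> h_inverse C X Y f g)"
proof
  assume "l_iso (H0 C) X Y \<phi>"
  then obtain f g where "\<phi> = hclass C X Y f" "f \<in> closed_mor C X Y" "g \<in> closed_mor C Y X"
    "lcmp (H0 C) X Y X (hclass C Y X g) (hclass C X Y f) = hclass C X X (idn C X)"
    "lcmp (H0 C) Y X Y (hclass C X Y f) (hclass C Y X g) = hclass C Y Y (idn C Y)"
    unfolding l_iso_def H0_simps by blast
  then show "\<exists>f g. \<phi> = hclass C X Y f \<and> h_inverse C X Y f g"
    using assms by (auto simp: H0_cmp h_inverse_def)
next
  assume "\<exists>f g. \<phi> = hclass C X Y f \<and> h_inverse C X Y f g"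
  then obtain f g where "\<phi> = hclass C X Y f" "h_inverse C X Y f g" by blast
  moreover from this have "hclass C Y X g \<in> lMor (H0 C) Y X" by (simp add: H0_simps h_inverse_def)
  ultimately show "l_iso (H0 C) X Y \<phi>"
    unfolding l_iso_def using assms by (intro conjI bexI) (auto simp: H0_simps h_inverse_def H0_cmp)
qed

lemma l_isomorphic_H0:
  assumes "X \<in> Ob C" "Y \<in> Ob C"
  shows "l_isomorphic (H0 C) X Y \<longleftrightarrow> (\<exists>f g. h_inverse C X Y f g)"
  using assms by (auto simp: l_isomorphic_def l_iso_H0)

lemma hclass_cmp_left_cong:
  assumes "X \<in> Ob C" "Y \<in> Ob C" "Z \<in> Ob C" "f \<in> closed_mor C Y Z" "g \<in> closed_mor C X Y" "g' \<in> closed_mor C X Y"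
    "hclass C X Y g = hclass C X Y g'"
  shows "hclass C X Z (cmp C X Y Z 0 0 f g) = hclass C X Z (cmp C X Y Z 0 0 f g')"
  using hclass_cmp_cong[of X Y Z f g' f g] assms by simp

lemma hclass_cmp_right_cong:
  assumes "X \<in> Ob C" "Y \<in> Ob C" "Z \<in> Ob C" "f \<in> closed_mor C Y Z" "f' \<in> closed_mor C Y Z" "g \<in> closed_mor C X Y"
    "hclass C Y Z f = hclass C Y Z f'"
  shows "hclass C X Z (cmp C X Y Z 0 0 f g) = hclass C X Z (cmp C X Y Z 0 0 f' g)"
  using hclass_cmp_cong[of X Y Z f' g f g] assms by simp

lemma cmp_assoc_0: "\<lbrakk>W \<in> Ob C; X \<in> Ob C; Y \<in> Ob C; Z \<in> Ob C; f \<in> closed_mor C Y Z; g \<in> closed_mor C X Y;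
        h \<in> closed_mor C W X\<rbrakk>
      \<Longrightarrow> cmp C W X Z 0 0 (cmp C X Y Z 0 0 f g) h = cmp C W Y Z 0 0 f (cmp C W X Y 0 0 g h)"
  by (simp add: cmp_assoc_deg closed_mor_Mor)

lemma cmp_idn_left_0: "\<lbrakk>X \<in> Ob C; Y \<in> Ob C; f \<in> closed_mor C X Y\<rbrakk> \<Longrightarrow> cmp C X Y Y 0 0 (idn C Y) f = f"
  by (simp add: cmp_idn_left closed_mor_Mor)

lemma cmp_idn_right_0: "\<lbrakk>X \<in> Ob C; Y \<in> Ob C; f \<in> closed_mor C X Y\<rbrakk> \<Longrightarrow> cmp C X X Y 0 0 f (idn C X) = f"
  by (simp add: cmp_idn_right closed_mor_Mor)

lemma h_inverse_comp:
  assumes "X \<in> Ob C" "Y \<in> Ob C" "Z \<in> Ob C" "h_inverse C X Y f f'" "h_inverse C Y Z g g'"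
  shows "h_inverse C X Z (cmp C X Y Z 0 0 g f) (cmp C Z Y X 0 0 f' g')"
proof -
  have key: "hclass C X X (cmp C X Z X 0 0 (cmp C Z Y X 0 0 f' g') (cmp C X Y Z 0 0 g f)) = hclass C X X (idn C X)"
    if O: "X \<in> Ob C" "Y \<in> Ob C" "Z \<in> Ob C" and f: "h_inverse C X Y f f'" and g: "h_inverse C Y Z g g'"
    for X Y Z f f' g g'
  proof -
    note c = f[unfolded h_inverse_def] g[unfolded h_inverse_def]
    have "cmp C X Z X 0 0 (cmp C Z Y X 0 0 f' g') (cmp C X Y Z 0 0 g f) =
        cmp C X Y X 0 0 f' (cmp C X Y Y 0 0 (cmp C Y Z Y 0 0 g' g) f)"
      using c O by (simp add: cmp_assoc_0 closed_cmp)
    moreover have "hclass C X Y (cmp C X Y Y 0 0 (cmp C Y Z Y 0 0 g' g) f) = hclass C X Y (cmp C X Y Y 0 0 (idn C Y) f)"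
      using c O by (intro hclass_cmp_right_cong) (simp_all add: closed_cmp closed_idn)
    then have "hclass C X X (cmp C X Y X 0 0 f' (cmp C X Y Y 0 0 (cmp C Y Z Y 0 0 g' g) f)) =
        hclass C X X (cmp C X Y X 0 0 f' f)"
      using c O by (intro hclass_cmp_left_cong) (simp_all add: closed_cmp cmp_idn_left_0)
    ultimately show ?thesis using c by simp
  qed
  show ?thesis
    using key[OF assms] key[OF assms(3,2,1) h_inverse_sym[OF assms(5)] h_inverse_sym[OF assms(4)]] assms
    by (simp add: h_inverse_def closed_cmp)
qed

lemma h_inverse_idn: "X \<in> Ob C \<Longrightarrow> h_inverse C X X (idn C X) (idn C X)"
  by (simp add: h_inverse_def closed_idn cmp_idn_left_0)

lemma l_isomorphic_refl: "X \<in> Ob C \<Longrightarrow> l_isomorphic (H0 C) X X"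
  by (auto simp: l_isomorphic_H0 intro: h_inverse_idn)

lemma l_isomorphic_sym: "X \<in> Ob C \<Longrightarrow> Y \<in> Ob C \<Longrightarrow> l_isomorphic (H0 C) X Y \<Longrightarrow> l_isomorphic (H0 C) Y X"
  by (auto simp: l_isomorphic_H0 intro: h_inverse_sym)

lemma l_isomorphic_trans: "X \<in> Ob C \<Longrightarrow> Y \<in> Ob C \<Longrightarrow> Z \<in> Ob C \<Longrightarrow> l_isomorphic (H0 C) X Y \<Longrightarrow>
    l_isomorphic (H0 C) Y Z \<Longrightarrow> l_isomorphic (H0 C) X Z"
  unfolding l_isomorphic_H0 by (blast intro: h_inverse_comp)

text \<open>Evaluating \<open>g f g'\<close> in two ways shows that a left and a right homotopy
  inverse have the same class. Invertibility can thus be proved with different inverses on the two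
  sides.\<close>

lemma h_inverse_two_sided:
  assumes O: "X \<in> Ob C" "Y \<in> Ob C"
    and c: "f \<in> closed_mor C X Y" "g \<in> closed_mor C Y X" "g' \<in> closed_mor C Y X"
    and l: "hclass C X X (cmp C X Y X 0 0 g f) = hclass C X X (idn C X)"
    and r: "hclass C Y Y (cmp C Y X Y 0 0 f g') = hclass C Y Y (idn C Y)"
  shows "h_inverse C X Y f g"
proof -
  have "hclass C Y X g = hclass C Y X (cmp C Y Y X 0 0 g (cmp C Y X Y 0 0 f g'))"
    using hclass_cmp_left_cong[OF O(2,2,1) c(2) _ _ r] O c by (simp add: closed_cmp closed_idn cmp_idn_right_0)
  also have "\<dots> = hclass C Y X (cmp C Y X X 0 0 (cmp C X Y X 0 0 g f) g')"
    using O c by (simp add: cmp_assoc_0)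
  also have "\<dots> = hclass C Y X g'"
    using hclass_cmp_right_cong[OF O(2,1,1) _ _ c(3) l] O c by (simp add: closed_cmp closed_idn cmp_idn_left_0)
  finally have "hclass C Y Y (cmp C Y X Y 0 0 f g) = hclass C Y Y (idn C Y)"
    using hclass_cmp_left_cong[of Y X Y f g g'] O c r by simp
  then show ?thesis using c l by (simp add: h_inverse_def)
qed

text \<open>Every morphism to or from \<open>Z\<close> factors through the identity of
  \<open>Z\<close>, so a null-homotopic identity forces all these classes to be zero.\<close>

lemma l_zero_ob_H0:
  "l_zero_ob (H0 C) Z \<longleftrightarrow> Z \<in> Ob C \<and> hclass C Z Z (idn C Z) = hclass C Z Z 0"
proof
  assume "l_zero_ob (H0 C) Z"
  then have "Z \<in> Ob C" "lMor (H0 C) Z Z = {lzero (H0 C) Z Z}" by (simp_all add: l_zero_ob_def H0_simps)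
  then show "Z \<in> Ob C \<and> hclass C Z Z (idn C Z) = hclass C Z Z 0"
    using closed_idn[of Z] by (auto simp: H0_simps)
next
  assume "Z \<in> Ob C \<and> hclass C Z Z (idn C Z) = hclass C Z Z 0"
  then have Z: "Z \<in> Ob C" "hclass C Z Z (idn C Z) = hclass C Z Z 0" by simp_all
  have "hclass C X Z f = hclass C X Z 0" if "X \<in> Ob C" "f \<in> closed_mor C X Z" for X f
    using hclass_cmp_right_cong[OF that(1) Z(1,1) _ _ that(2) Z(2)] that Z
    by (simp add: cmp_idn_left_0 closed_idn closed_zero cmp_zero_left closed_mor_Mor)
  moreover have "hclass C Z X f = hclass C Z X 0" if "X \<in> Ob C" "f \<in> closed_mor C Z X" for X f
    using hclass_cmp_left_cong[OF Z(1,1) that(1) that(2) _ _ Z(2)] that Z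
    by (simp add: cmp_idn_right_0 closed_idn closed_zero cmp_zero_right closed_mor_Mor)
  ultimately have "lMor (H0 C) X Z = {lzero (H0 C) X Z}" "lMor (H0 C) Z X = {lzero (H0 C) Z X}"
    if "X \<in> Ob C" for X
    unfolding H0_simps using closed_zero[OF that Z(1)] closed_zero[OF Z(1) that] that by blast+
  then show "l_zero_ob (H0 C) Z"
    using Z(1) by (simp add: l_zero_ob_def) (simp add: H0_simps)
qed

lemma l_zero_ob_iso:
  assumes "l_zero_ob (H0 C) Z" "l_zero_ob (H0 C) Z'"
  shows "l_isomorphic (H0 C) Z Z'"
proof -
  have "h_inverse C Z Z' 0 0"
    using assms by (simp add: l_zero_ob_H0 h_inverse_def closed_zero cmp_zero_left zero_Mor)
  then show ?thesis using assms by (auto simp: l_zero_ob_H0 l_isomorphic_H0)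
qed

end

section \<open>Extensions\<close>

text \<open>
  The abstract form of a cone: \<open>Z\<close> is the direct sum of \<open>A\<close> and \<open>Y\<close> with the differential changed by
  a closed \<open>\<phi>\<close> of degree 1 from \<open>A\<close> to \<open>Y\<close>.  The conditions are equations between morphisms, hence
  preserved by every differential graded functor.
\<close>

definition dg_ext :: "('o, 'm::ab_group_add) dgcat \<Rightarrow> 'o \<Rightarrow> 'o \<Rightarrow> 'o \<Rightarrow> 'm \<Rightarrow>
    'm \<Rightarrow> 'm \<Rightarrow> 'm \<Rightarrow> 'm \<Rightarrow> bool" where
  "dg_ext C A Y Z \<phi> \<iota>1 \<iota>2 \<pi>1 \<pi>2 \<longleftrightarrow> A \<in> Ob C \<and> Y \<in> Ob C \<and> Z \<in> Ob C \<and> \<phi> \<in> Mor C A Y 1 \<and>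
     \<iota>1 \<in> Mor C A Z 0 \<and> \<iota>2 \<in> Mor C Y Z 0 \<and> \<pi>1 \<in> Mor C Z A 0 \<and> \<pi>2 \<in> Mor C Z Y 0 \<and>
     cmp C A Z A 0 0 \<pi>1 \<iota>1 = idn C A \<and> cmp C Y Z Y 0 0 \<pi>2 \<iota>2 = idn C Y \<and>
     cmp C Y Z A 0 0 \<pi>1 \<iota>2 = 0 \<and> cmp C A Z Y 0 0 \<pi>2 \<iota>1 = 0 \<and>
     cmp C Z A Z 0 0 \<iota>1 \<pi>1 + cmp C Z Y Z 0 0 \<iota>2 \<pi>2 = idn C Z \<and>
     dif C A Z 0 \<iota>1 = cmp C A Y Z 0 1 \<iota>2 \<phi> \<and> dif C Y Z 0 \<iota>2 = 0 \<and> dif C Z A 0 \<pi>1 = 0"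

text \<open>The triangular block matrix from \<open>A \<oplus> Y\<close> to
  \<open>A' \<oplus> Y'\<close> with diagonal \<open>a\<close>, \<open>b\<close> and corner
  \<open>h\<close> from \<open>A\<close> to \<open>Y'\<close>. The missing entry from
  \<open>Y\<close> to \<open>A'\<close> makes it compatible with the sub and quotient
  objects.\<close>

definition ext_mat :: "('o, 'm::ab_group_add) dgcat \<Rightarrow> 'o \<Rightarrow> 'o \<Rightarrow> 'o \<Rightarrow> 'o \<Rightarrow> 'o \<Rightarrow> 'o \<Rightarrow>
    'm \<Rightarrow> 'm \<Rightarrow> 'm \<Rightarrow> 'm \<Rightarrow> 'm \<Rightarrow> 'm \<Rightarrow> 'm \<Rightarrow> 'm" where
  "ext_mat C A Y Z A' Y' Z' \<iota>1' \<iota>2' \<pi>1 \<pi>2 a b h =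
     cmp C Z A' Z' 0 0 \<iota>1' (cmp C Z A A' 0 0 a \<pi>1) +
     cmp C Z Y' Z' 0 0 \<iota>2' (cmp C Z A Y' 0 0 h \<pi>1 + cmp C Z Y Y' 0 0 b \<pi>2)"

context dg_category
begin

text \<open>Composites are normalised with brackets to the right, where \<open>p q\<close> is no
  longer a subterm; this is cancellation in that normal form.\<close>

lemma cmp_cancel:
  assumes "W \<in> Ob C" "X \<in> Ob C" "Y \<in> Ob C" "p \<in> Mor C Y X i" "q \<in> Mor C X Y j" "h \<in> Mor C W X l"
    "cmp C X Y X i j p q = idn C X" "i + j = 0" "m = j + l"
  shows "cmp C W Y X i m p (cmp C W X Y j l q h) = h"
  using cmp_assoc_deg[OF assms(1,2,3,2,4-6), of "i + j" m] assms cmp_idn_left[of W X h l] by simp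

lemma cmp_cancel_zero:
  assumes "W \<in> Ob C" "X \<in> Ob C" "Y \<in> Ob C" "Z \<in> Ob C" "p \<in> Mor C Y Z i" "q \<in> Mor C X Y j" "h \<in> Mor C W X l"
    "cmp C X Y Z i j p q = 0" "m = j + l"
  shows "cmp C W Y Z i m p (cmp C W X Y j l q h) = 0"
  using cmp_assoc_deg[OF assms(1-7), of "i + j" m] assms cmp_zero_left[of W X Z h l "i + j"] by simp

text \<open>Differentiating \<open>d \<iota>1 = \<iota>2 \<phi>\<close> gives
  \<open>\<iota>2 d\<phi> = 0\<close>, and \<open>\<pi>2\<close> is a left inverse of
  \<open>\<iota>2\<close>.\<close>

lemma dg_ext_dif_phi:
  assumes "dg_ext C A Y Z \<phi> \<iota>1 \<iota>2 \<pi>1 \<pi>2"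
  shows "dif C A Y 1 \<phi> = 0"
proof -
  note E = assms[unfolded dg_ext_def]
  have "0 = dif C A Z 1 (dif C A Z 0 \<iota>1)" using E dif_dif_deg[of A Z \<iota>1 0 1] by simp
  also have "\<dots> = cmp C A Y Z 0 2 \<iota>2 (dif C A Y 1 \<phi>)"
    using E by (simp add: leibniz_deg cmp_linear)
  finally have "cmp C A Z Y 0 2 \<pi>2 (cmp C A Y Z 0 2 \<iota>2 (dif C A Y 1 \<phi>)) = 0"
    using E cmp_zero_right[of A Z Y \<pi>2 0 2] by simp
  moreover have "cmp C A Z Y 0 2 \<pi>2 (cmp C A Y Z 0 2 \<iota>2 (dif C A Y 1 \<phi>)) = dif C A Y 1 \<phi>"
    by (rule cmp_cancel) (use E in \<open>simp_all add: dif_Mor_deg\<close>)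
  ultimately show ?thesis by simp
qed

text \<open>Differentiating \<open>\<pi>2 \<iota>1 = 0\<close> and
  \<open>\<pi>2 \<iota>2 = 1\<close> determines \<open>d\<pi>2\<close> on both summands, and the
  decomposition of the identity of \<open>Z\<close> assembles the two values.\<close>

lemma dg_ext_dif_pi2:
  assumes "dg_ext C A Y Z \<phi> \<iota>1 \<iota>2 \<pi>1 \<pi>2"
  shows "dif C Z Y 0 \<pi>2 = - cmp C Z A Y 1 0 \<phi> \<pi>1"
proof -
  note E = assms[unfolded dg_ext_def]
  let ?d = "dif C Z Y 0 \<pi>2"
  have d: "?d \<in> Mor C Z Y 1" using E by (simp add: dif_Mor_deg)
  have "0 = dif C A Y 0 (cmp C A Z Y 0 0 \<pi>2 \<iota>1)" using E by (simp add: dif_zero)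
  also have "\<dots> = cmp C A Z Y 0 1 \<pi>2 (cmp C A Y Z 0 1 \<iota>2 \<phi>) + cmp C A Z Y 1 0 ?d \<iota>1"
    using E by (subst leibniz_deg) auto
  also have "cmp C A Z Y 0 1 \<pi>2 (cmp C A Y Z 0 1 \<iota>2 \<phi>) = \<phi>"
    by (rule cmp_cancel) (use E in auto)
  finally have 1: "cmp C A Z Y 1 0 ?d \<iota>1 = - \<phi>" by (simp add: eq_neg_iff_add_eq_0 add.commute)
  have "0 = dif C Y Y 0 (cmp C Y Z Y 0 0 \<pi>2 \<iota>2)" using E by (simp add: dif_idn)
  also have "\<dots> = cmp C Y Z Y 0 1 \<pi>2 0 + cmp C Y Z Y 1 0 ?d \<iota>2"
    using E by (subst leibniz_deg) auto
  finally have 2: "cmp C Y Z Y 1 0 ?d \<iota>2 = 0" using E by (simp add: cmp_zero_right)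
  have I: "idn C Z = cmp C Z A Z 0 0 \<iota>1 \<pi>1 + cmp C Z Y Z 0 0 \<iota>2 \<pi>2" using E by simp
  have "?d = cmp C Z Z Y 1 0 ?d (idn C Z)"
    using E d by (simp add: cmp_idn_right)
  also have "\<dots> = cmp C Z Z Y 1 0 ?d (cmp C Z A Z 0 0 \<iota>1 \<pi>1) + cmp C Z Z Y 1 0 ?d (cmp C Z Y Z 0 0 \<iota>2 \<pi>2)"
    unfolding I using E d by (intro cmp_add_right) (simp_all add: cmp_Mor_deg)
  also have "\<dots> = cmp C Z A Y 1 0 (cmp C A Z Y 1 0 ?d \<iota>1) \<pi>1 + cmp C Z Y Y 1 0 (cmp C Y Z Y 1 0 ?d \<iota>2) \<pi>2"
    using E d by (simp add: cmp_assoc_deg)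
  also have "\<dots> = - cmp C Z A Y 1 0 \<phi> \<pi>1"
    unfolding 1 2 using E by (simp add: cmp_linear)
  finally show ?thesis .
qed

lemma ext_mat_Mor:
  assumes "dg_ext C A Y Z \<phi> \<iota>1 \<iota>2 \<pi>1 \<pi>2" "dg_ext C A' Y' Z' \<phi>' \<iota>1' \<iota>2' \<pi>1' \<pi>2'"
    "a \<in> Mor C A A' 0" "b \<in> Mor C Y Y' 0" "h \<in> Mor C A Y' 0"
  shows "ext_mat C A Y Z A' Y' Z' \<iota>1' \<iota>2' \<pi>1 \<pi>2 a b h \<in> Mor C Z Z' 0"
  using assms by (simp add: ext_mat_def dg_ext_def Mor_rules)

text \<open>The defects \<open>d \<iota>1' = \<iota>2' \<phi>'\<close> and
  \<open>d \<pi>2 = - \<phi> \<pi>1\<close> contribute \<open>\<phi>' a\<close> and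
  \<open>- b \<phi>\<close> to the corner of the differential. The assumption on \<open>dh\<close>,
  commutativity of the square up to the homotopy \<open>h\<close>, cancels them.\<close>

lemma ext_mat_closed:
  assumes E: "dg_ext C A Y Z \<phi> \<iota>1 \<iota>2 \<pi>1 \<pi>2" and E': "dg_ext C A' Y' Z' \<phi>' \<iota>1' \<iota>2' \<pi>1' \<pi>2'"
    and a: "a \<in> closed_mor C A A'" and b: "b \<in> closed_mor C Y Y'" and h: "h \<in> Mor C A Y' 0"
    and dh: "dif C A Y' 0 h = cmp C A Y Y' 0 1 b \<phi> - cmp C A A' Y' 1 0 \<phi>' a"
  shows "ext_mat C A Y Z A' Y' Z' \<iota>1' \<iota>2' \<pi>1 \<pi>2 a b h \<in> closed_mor C Z Z'"
proof -
  note U = E[unfolded dg_ext_def] E'[unfolded dg_ext_def] dg_ext_dif_pi2[OF E]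
    closed_mor_Mor[OF a] closed_mor_Mor[OF b] closed_mor_dif[OF a] closed_mor_dif[OF b] h
  have "dif C Z Z' 0 (ext_mat C A Y Z A' Y' Z' \<iota>1' \<iota>2' \<pi>1 \<pi>2 a b h) = 0"
    unfolding ext_mat_def using U
    by (simp add: dif_linear Mor_rules leibniz_deg cmp_linear cmp_assoc_deg dh)
  then show ?thesis
    using ext_mat_Mor[OF E E' closed_mor_Mor[OF a] closed_mor_Mor[OF b] h] by (simp add: closed_mor_def)
qed

lemma ext_mat_incl:
  assumes "dg_ext C A Y Z \<phi> \<iota>1 \<iota>2 \<pi>1 \<pi>2" "dg_ext C A' Y' Z' \<phi>' \<iota>1' \<iota>2' \<pi>1' \<pi>2'"
    "a \<in> Mor C A A' 0" "b \<in> Mor C Y Y' 0" "h \<in> Mor C A Y' 0"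
  shows "cmp C Y Z Z' 0 0 (ext_mat C A Y Z A' Y' Z' \<iota>1' \<iota>2' \<pi>1 \<pi>2 a b h) \<iota>2 = cmp C Y Y' Z' 0 0 \<iota>2' b"
  using assms
  by (simp add: ext_mat_def dg_ext_def Mor_rules cmp_linear cmp_assoc_deg cmp_idn_right)

lemma ext_mat_proj:
  assumes "dg_ext C A Y Z \<phi> \<iota>1 \<iota>2 \<pi>1 \<pi>2" "dg_ext C A' Y' Z' \<phi>' \<iota>1' \<iota>2' \<pi>1' \<pi>2'"
    "a \<in> Mor C A A' 0" "b \<in> Mor C Y Y' 0" "h \<in> Mor C A Y' 0"
  shows "cmp C Z Z' A' 0 0 \<pi>1' (ext_mat C A Y Z A' Y' Z' \<iota>1' \<iota>2' \<pi>1 \<pi>2 a b h) = cmp C Z A A' 0 0 a \<pi>1"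
  using assms
  by (simp add: ext_mat_def dg_ext_def Mor_rules cmp_add_right cmp_cancel[where X = A'] cmp_cancel_zero[where X = Y'])

lemma ext_mat_cmp:
  assumes E: "dg_ext C A Y Z \<phi> \<iota>1 \<iota>2 \<pi>1 \<pi>2" and E': "dg_ext C A' Y' Z' \<phi>' \<iota>1' \<iota>2' \<pi>1' \<pi>2'"
    and m: "a \<in> Mor C A A' 0" "b \<in> Mor C Y Y' 0" "h \<in> Mor C A Y' 0"
    and m': "a' \<in> Mor C A' A 0" "b' \<in> Mor C Y' Y 0" "h' \<in> Mor C A' Y 0"
  shows "cmp C Z Z' Z 0 0 (ext_mat C A' Y' Z' A Y Z \<iota>1 \<iota>2 \<pi>1' \<pi>2' a' b' h')
      (ext_mat C A Y Z A' Y' Z' \<iota>1' \<iota>2' \<pi>1 \<pi>2 a b h) =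
    ext_mat C A Y Z A Y Z \<iota>1 \<iota>2 \<pi>1 \<pi>2 (cmp C A A' A 0 0 a' a) (cmp C Y Y' Y 0 0 b' b)
      (cmp C A A' Y 0 0 h' a + cmp C A Y' Y 0 0 b' h)"
proof -
  note U = E[unfolded dg_ext_def] E'[unfolded dg_ext_def] m m'
  let ?k = "ext_mat C A Y Z A' Y' Z' \<iota>1' \<iota>2' \<pi>1 \<pi>2 a b h"
  have k: "?k \<in> Mor C Z Z' 0" by (rule ext_mat_Mor[OF E E' m])
  have 1: "cmp C Z Z' A' 0 0 \<pi>1' ?k = cmp C Z A A' 0 0 a \<pi>1" by (rule ext_mat_proj[OF E E' m])
  have 2: "cmp C Z Z' Y' 0 0 \<pi>2' ?k = cmp C Z A Y' 0 0 h \<pi>1 + cmp C Z Y Y' 0 0 b \<pi>2"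
    unfolding ext_mat_def using U
    by (simp add: Mor_rules cmp_add_right cmp_cancel[where X = Y'] cmp_cancel_zero[where X = A'])
  show ?thesis
    unfolding ext_mat_def[of C A' Y' Z' A Y Z] ext_mat_def[of C A Y Z A Y Z] using U k
    by (simp add: Mor_rules cmp_linear cmp_assoc_deg 1 2 add_ac)
qed

lemma ext_mat_idn:
  assumes "dg_ext C A Y Z \<phi> \<iota>1 \<iota>2 \<pi>1 \<pi>2"
  shows "ext_mat C A Y Z A Y Z \<iota>1 \<iota>2 \<pi>1 \<pi>2 (idn C A) (idn C Y) 0 = idn C Z"
  using assms by (simp add: ext_mat_def dg_ext_def cmp_idn_left cmp_zero_left)

text \<open>
  Up to homotopy an endomorphism that is homotopic to the identity on the diagonal is \<open>1 + N\<close> with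
  \<open>N\<^sup>2 = 0\<close>, so \<open>1 - N\<close> is an inverse.
\<close>

lemma ext_mat_unipotent:
  assumes E: "dg_ext C A Y Z \<phi> \<iota>1 \<iota>2 \<pi>1 \<pi>2"
    and a: "a \<in> closed_mor C A A" and b: "b \<in> closed_mor C Y Y" and h: "h \<in> Mor C A Y 0"
    and a1: "hclass C A A a = hclass C A A (idn C A)" and b1: "hclass C Y Y b = hclass C Y Y (idn C Y)"
    and dh: "dif C A Y 0 h = cmp C A Y Y 0 1 b \<phi> - cmp C A A Y 1 0 \<phi> a"
  shows "\<exists>g. h_inverse C Z Z (ext_mat C A Y Z A Y Z \<iota>1 \<iota>2 \<pi>1 \<pi>2 a b h) g"
proof -
  let ?k = "ext_mat C A Y Z A Y Z \<iota>1 \<iota>2 \<pi>1 \<pi>2 a b h"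
  note U = E[unfolded dg_ext_def] dg_ext_dif_pi2[OF E] dg_ext_dif_phi[OF E] h
  have O: "A \<in> Ob C" "Y \<in> Ob C" "Z \<in> Ob C" using U by simp_all
  obtain s where s: "s \<in> Mor C A A (-1)" "a = idn C A + dif C A A (-1) s"
    using a1 O by (auto simp: hclass_eq_iff)
  obtain t where t: "t \<in> Mor C Y Y (-1)" "b = idn C Y + dif C Y Y (-1) t"
    using b1 O by (auto simp: hclass_eq_iff)
  \<comment> \<open>With \<open>a = 1 + ds\<close> and \<open>b = 1 + dt\<close> one has
    \<open>dh = dt \<phi> - \<phi> ds\<close>; the two corrections make the corner closed. They are
    the negative of the corner of \<open>dH\<close> for the homotopy \<open>H\<close> with diagonal
    \<open>s\<close>, \<open>t\<close> below.\<close>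
  define c where "c = h + cmp C A A Y 1 (-1) \<phi> s + cmp C A Y Y (-1) 1 t \<phi>"
  have cM: "c \<in> Mor C A Y 0" unfolding c_def using U s t by (simp add: Mor_rules)
  have dc: "dif C A Y 0 c = 0"
    unfolding c_def using U s(1) t(1)
    by (simp add: dif_linear Mor_rules leibniz_deg cmp_linear dh s(2) t(2) cmp_idn_left cmp_idn_right
        sgn_pow_def)
  define N where "N = cmp C Z Y Z 0 0 \<iota>2 (cmp C Z A Y 0 0 c \<pi>1)"
  have NM: "N \<in> Mor C Z Z 0" unfolding N_def using U cM by (simp add: Mor_rules)
  have N: "N \<in> closed_mor C Z Z"
    using U cM dc NM unfolding closed_mor_def by (simp add: N_def Mor_rules leibniz_deg cmp_linear)
  have NN: "cmp C Z Z Z 0 0 N N = 0"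
    unfolding N_def using U cM
    by (simp add: Mor_rules cmp_linear cmp_assoc_deg cmp_cancel_zero[where X = Y and Z = A])
  define H where "H = cmp C Z A Z 0 (-1) \<iota>1 (cmp C Z A A (-1) 0 s \<pi>1) + cmp C Z Y Z 0 (-1) \<iota>2 (cmp C Z Y Y (-1) 0 t \<pi>2)"
  have HM: "H \<in> Mor C Z Z (-1)" unfolding H_def using U s t by (simp add: Mor_rules)
  have I: "idn C Z = cmp C Z A Z 0 0 \<iota>1 \<pi>1 + cmp C Z Y Z 0 0 \<iota>2 \<pi>2" using U by simp
  have "?k = idn C Z + N + dif C Z Z (-1) H"
    unfolding I ext_mat_def N_def c_def H_def s(2) t(2) using U s(1) t(1)
    by (simp add: dif_linear Mor_rules leibniz_deg cmp_linear cmp_assoc_deg cmp_idn_left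
        sgn_pow_def algebra_simps)
  then have k: "hclass C Z Z ?k = hclass C Z Z (idn C Z + N)"
    using HM O by (auto simp: hclass_eq_iff)
  have kc: "?k \<in> closed_mor C Z Z" by (rule ext_mat_closed[OF E E a b h dh])
  have c1: "idn C Z + N \<in> closed_mor C Z Z" "idn C Z - N \<in> closed_mor C Z Z"
    using N O by (simp_all add: closed_idn closed_add closed_diff)
  have "cmp C Z Z Z 0 0 (idn C Z - N) (idn C Z + N) = idn C Z"
    and "cmp C Z Z Z 0 0 (idn C Z + N) (idn C Z - N) = idn C Z"
    using O NM NN by (simp_all add: cmp_linear Mor_rules cmp_idn_left cmp_idn_right)
  then have "h_inverse C Z Z ?k (idn C Z - N)"
    using hclass_cmp_left_cong[OF O(3,3,3) c1(2) kc c1(1) k] hclass_cmp_right_cong[OF O(3,3,3) kc c1(1) c1(2) k]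
      kc c1 by (simp add: h_inverse_def)
  then show ?thesis by blast
qed

text \<open>The matrix \<open>k'\<close> formed from \<open>a'\<close>, \<open>b'\<close>,
  \<open>h'\<close> need not invert \<open>k\<close>. But \<open>k' k\<close> and
  \<open>k k'\<close> are homotopic to identities on the diagonal, hence homotopy invertible, which
  yields a left and a right inverse of \<open>k\<close>.\<close>

lemma ext_mat_h_inverse:
  assumes E: "dg_ext C A Y Z \<phi> \<iota>1 \<iota>2 \<pi>1 \<pi>2" and E': "dg_ext C A' Y' Z' \<phi>' \<iota>1' \<iota>2' \<pi>1' \<pi>2'"
    and a: "h_inverse C A A' a a'" and b: "h_inverse C Y Y' b b'"
    and h: "h \<in> Mor C A Y' 0" "dif C A Y' 0 h = cmp C A Y Y' 0 1 b \<phi> - cmp C A A' Y' 1 0 \<phi>' a"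
    and h': "h' \<in> Mor C A' Y 0" "dif C A' Y 0 h' = cmp C A' Y' Y 0 1 b' \<phi>' - cmp C A' A Y 1 0 \<phi> a'"
  shows "\<exists>g. h_inverse C Z Z' (ext_mat C A Y Z A' Y' Z' \<iota>1' \<iota>2' \<pi>1 \<pi>2 a b h) g"
proof -
  let ?k = "ext_mat C A Y Z A' Y' Z' \<iota>1' \<iota>2' \<pi>1 \<pi>2 a b h"
  let ?k' = "ext_mat C A' Y' Z' A Y Z \<iota>1 \<iota>2 \<pi>1' \<pi>2' a' b' h'"
  have key: "\<exists>g. h_inverse C Z Z (cmp C Z Z' Z 0 0 (ext_mat C A' Y' Z' A Y Z \<iota>1 \<iota>2 \<pi>1' \<pi>2' a' b' h')
        (ext_mat C A Y Z A' Y' Z' \<iota>1' \<iota>2' \<pi>1 \<pi>2 a b h)) g"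
    if E: "dg_ext C A Y Z \<phi> \<iota>1 \<iota>2 \<pi>1 \<pi>2" and E': "dg_ext C A' Y' Z' \<phi>' \<iota>1' \<iota>2' \<pi>1' \<pi>2'"
      and a: "h_inverse C A A' a a'" and b: "h_inverse C Y Y' b b'"
      and h: "h \<in> Mor C A Y' 0" "dif C A Y' 0 h = cmp C A Y Y' 0 1 b \<phi> - cmp C A A' Y' 1 0 \<phi>' a"
      and h': "h' \<in> Mor C A' Y 0" "dif C A' Y 0 h' = cmp C A' Y' Y 0 1 b' \<phi>' - cmp C A' A Y 1 0 \<phi> a'"
    for A Y Z \<phi> \<iota>1 \<iota>2 \<pi>1 \<pi>2 A' Y' Z' \<phi>' \<iota>1' \<iota>2' \<pi>1' \<pi>2' a a' b b' h h'
  proof -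
    note ab = a[unfolded h_inverse_def] b[unfolded h_inverse_def]
    have c: "a \<in> closed_mor C A A'" "a' \<in> closed_mor C A' A" "b \<in> closed_mor C Y Y'" "b' \<in> closed_mor C Y' Y"
      using ab by auto
    note m = c[THEN closed_mor_Mor] and d = c[THEN closed_mor_dif]
    note U = E[unfolded dg_ext_def] E'[unfolded dg_ext_def] m d h(1) h'(1)
    show ?thesis
      unfolding ext_mat_cmp[OF E E' m(1,3) h(1) m(2,4) h'(1)]
    proof (rule ext_mat_unipotent[OF E])
      show "cmp C A A' A 0 0 a' a \<in> closed_mor C A A" "cmp C Y Y' Y 0 0 b' b \<in> closed_mor C Y Y"
        "cmp C A A' Y 0 0 h' a + cmp C A Y' Y 0 0 b' h \<in> Mor C A Y 0"
        using U c by (simp_all add: closed_cmp Mor_rules)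
      show "dif C A Y 0 (cmp C A A' Y 0 0 h' a + cmp C A Y' Y 0 0 b' h) =
          cmp C A Y Y 0 1 (cmp C Y Y' Y 0 0 b' b) \<phi> - cmp C A A Y 1 0 \<phi> (cmp C A A' A 0 0 a' a)"
        using U by (simp add: Mor_rules dif_linear leibniz_deg h h' cmp_linear cmp_assoc_deg)
    qed (use ab in auto)
  qed
  note ab = a[unfolded h_inverse_def] b[unfolded h_inverse_def]
  have O: "Z \<in> Ob C" "Z' \<in> Ob C" using E E' by (simp_all add: dg_ext_def)
  have kc: "?k \<in> closed_mor C Z Z'" using ab by (intro ext_mat_closed[OF E E'] h) auto
  have kc': "?k' \<in> closed_mor C Z' Z" using ab by (intro ext_mat_closed[OF E' E] h') auto
  obtain g1 where g1: "h_inverse C Z Z (cmp C Z Z' Z 0 0 ?k' ?k) g1"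
    using key[OF E E' a b h h'] by blast
  obtain g2 where g2: "h_inverse C Z' Z' (cmp C Z' Z Z' 0 0 ?k ?k') g2"
    using key[OF E' E h_inverse_sym[OF a] h_inverse_sym[OF b] h' h] by blast
  have c1: "g1 \<in> closed_mor C Z Z" and c2: "g2 \<in> closed_mor C Z' Z'" using g1 g2 by (auto simp: h_inverse_def)
  have "h_inverse C Z Z' ?k (cmp C Z' Z Z 0 0 g1 ?k')"
    by (rule h_inverse_two_sided[where g' = "cmp C Z' Z' Z 0 0 ?k' g2"])
      (use g1 g2 c1 c2 kc kc' O in \<open>simp_all add: closed_cmp cmp_assoc_0 h_inverse_def\<close>)
  then show ?thesis by blast
qed

end

section \<open>Shifts, twists and cones of twisted complexes\<close>

text \<open>Arbitrary integers occur because a term in position \<open>n\<close> of a twisted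
  complex enters the convolution shifted by \<open>- n\<close>, and because shifts have to be
  undone.\<close>

definition tw_shift_by :: "int \<Rightarrow> ('o, 'm) tw \<Rightarrow> ('o, 'm) tw" where
  "tw_shift_by n X = ((\<lambda>i. fst X (i + n)), (\<lambda>i j. snd X (i + n) (j + n)))"

abbreviation sh :: "('o, 'm) tw \<Rightarrow> ('o, 'm) tw" where
  "sh \<equiv> tw_shift_by 1"

text \<open>The identity of the terms of \<open>X\<close>, regarded as a map of degree
  \<open>- n\<close> to the shift. The sign with exponent \<open>i * n\<close> makes it closed
  although the matrix of the shift carries no sign.\<close>

definition shift_out :: "('o, 'm::ab_group_add) dgcat \<Rightarrow> int \<Rightarrow> ('o, 'm) tw \<Rightarrow> int \<Rightarrow> int \<Rightarrow> 'm" where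
  "shift_out C n X = (\<lambda>i j. if j = i - n then sgn_pow (i * n) (idn C (fst X i)) else 0)"

definition shift_in :: "('o, 'm::ab_group_add) dgcat \<Rightarrow> int \<Rightarrow> ('o, 'm) tw \<Rightarrow> int \<Rightarrow> int \<Rightarrow> 'm" where
  "shift_in C n X = (\<lambda>i j. if j = i + n then sgn_pow (i * n) (idn C (fst X (i + n))) else 0)"

lemma tw_shift_eq: "tw_shift X = sh X"
  by (simp add: tw_shift_def tw_shift_by_def)

lemma tw_shift_by_add: "tw_shift_by m (tw_shift_by n X) = tw_shift_by (m + n) X"
  by (simp add: tw_shift_by_def add_ac)

lemma tw_shift_by_0: "tw_shift_by 0 X = X"
  by (simp add: tw_shift_by_def)

context dg_category
begin

text \<open>Differentiating \<open>g f = 1\<close> with \<open>df = 0\<close> gives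
  \<open>dg f = 0\<close>; composing with \<open>g\<close> on the right leaves
  \<open>dg = 0\<close>.\<close>

lemma closed_inverse:
  assumes O: "X \<in> Ob C" "Y \<in> Ob C" and m: "f \<in> Mor C X Y d" "g \<in> Mor C Y X e" "d + e = 0"
    and c: "cmp C X Y X e d g f = idn C X" "cmp C Y X Y d e f g = idn C Y" and df: "dif C X Y d f = 0"
  shows "dif C Y X e g = 0"
proof -
  have "0 = dif C X X 0 (cmp C X Y X e d g f)" using O by (simp add: c dif_idn)
  also have "\<dots> = sgn_pow d (cmp C X Y X (e + 1) d (dif C Y X e g) f)"
    using O m df by (simp add: leibniz_deg cmp_zero_right add.commute)
  finally have "cmp C X Y X (e + 1) d (dif C Y X e g) f = 0" by (simp add: sgn_pow_def split: if_splits)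
  then have "0 = cmp C Y X X 1 e (cmp C X Y X (e + 1) d (dif C Y X e g) f) g"
    using O m by (simp add: cmp_zero_left)
  also have "\<dots> = cmp C Y Y X (e + 1) 0 (dif C Y X e g) (cmp C Y X Y d e f g)"
    using O m by (intro cmp_assoc_deg) (simp_all add: dif_Mor)
  also have "\<dots> = dif C Y X e g" using O m by (simp add: c cmp_idn_right dif_Mor)
  finally show ?thesis by simp
qed

section \<open>Closed isomorphisms between a twisted complex and its shifts\<close>

lemma PreTr_Ob_graded_mat: "X \<in> Ob D \<Longrightarrow> X \<in> Ob M"
  by (simp add: PreTr_Ob_iff)

lemma pretr_entry: "f \<in> pretr_Mor C X Y l \<Longrightarrow> n = l + i - j \<Longrightarrow> f i j \<in> Mor C (fst X i) (fst Y j) n"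
  by (simp add: pretr_Mor_def)

lemma PreTr_snd_entry: "X \<in> Ob D \<Longrightarrow> n = 1 + i - j \<Longrightarrow> snd X i j \<in> Mor C (fst X i) (fst X j) n"
  by (auto simp: PreTr_Ob_iff graded_mat_simps intro: pretr_entry)

lemma PreTr_fst: "X \<in> Ob D \<Longrightarrow> fst X i \<in> Ob C"
  by (simp add: PreTr_Ob_iff graded_mat_simps)

lemma PreTr_finite: "X \<in> Ob D \<Longrightarrow> finite (tw_supp C X)"
  by (simp add: PreTr_Ob_iff graded_mat_simps)

lemma PreTr_cmp_single:
  assumes "X \<in> Ob D" "Y \<in> Ob D" "Z \<in> Ob D"
    and "f \<in> pretr_Mor C Y Z k" "g \<in> pretr_Mor C X Y l" "\<And>m. m \<noteq> p \<Longrightarrow> f m j = 0 \<or> g i m = 0"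
  shows "pretr_cmp C X Y Z k l f g i j = sgn_pow ((p - i) * k)
     (cmp C (fst X i) (fst Y p) (fst Z j) (k + p - j) (l + i - p) (f p j) (g i p))"
  using assms by (intro pretr_cmp_single) (auto intro: PreTr_Ob_graded_mat)

text \<open>Degrees and signs depend on differences of indices only, so the Maurer-Cartan equation
  of the shift is that of \<open>X\<close> read at translated indices.\<close>

lemma tw_shift_by_Ob:
  assumes X: "X \<in> Ob D"
  shows "tw_shift_by n X \<in> Ob D"
proof -
  have supp: "tw_supp C (tw_shift_by n X) = (\<lambda>i. i - n) ` tw_supp C X"
    by (force simp: tw_supp_def tw_shift_by_def image_iff)
  have f: "fst (tw_shift_by n X) i = fst X (i + n)" and q: "snd (tw_shift_by n X) i j = snd X (i + n) (j + n)" for i j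
    by (simp_all add: tw_shift_by_def)
  have "dif C (fst X i) (fst X j) (1 + i - j) (snd X i j) = pretr_cmp C X X X 1 1 (snd X) (snd X) i j" for i j
    using X by (simp add: PreTr_Ob_iff graded_mat_simps fun_eq_iff)
  moreover have "1 + (i + n) - (j + n) = 1 + i - j" for i j by simp
  ultimately have mc: "dif C (fst X (i + n)) (fst X (j + n)) (1 + i - j) (snd X (i + n) (j + n)) =
      pretr_cmp C X X X 1 1 (snd X) (snd X) (i + n) (j + n)" for i j
    by metis
  have cm: "pretr_cmp C (tw_shift_by n X) (tw_shift_by n X) (tw_shift_by n X) 1 1 (snd (tw_shift_by n X)) (snd (tw_shift_by n X)) i j
      = pretr_cmp C X X X 1 1 (snd X) (snd X) (i + n) (j + n)" for i j
    unfolding pretr_cmp_def supp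
    by (rule sum.reindex_bij_witness[of _ "\<lambda>m. m - n" "\<lambda>m. m + n"]) (auto simp: f q algebra_simps)
  have "finite (tw_supp C (tw_shift_by n X))" unfolding supp using X by (simp add: PreTr_finite)
  then show ?thesis
    using X unfolding PreTr_Ob_iff[of "tw_shift_by n X"] graded_mat_simps
    by (auto simp: fun_eq_iff cm mc f q PreTr_fst pretr_Mor_def intro!: PreTr_snd_entry)
qed

lemma shift_out_Mor: "X \<in> Ob D \<Longrightarrow> m = - n \<Longrightarrow> shift_out C n X \<in> Mor D X (tw_shift_by n X) m"
  by (auto simp: PreTr_simps pretr_Mor_def shift_out_def tw_shift_by_def PreTr_fst sgn_Mor idn_Mor zero_Mor)

lemma shift_in_Mor: "X \<in> Ob D \<Longrightarrow> shift_in C n X \<in> Mor D (tw_shift_by n X) X n"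
  by (auto simp: PreTr_simps pretr_Mor_def shift_in_def tw_shift_by_def PreTr_fst sgn_Mor idn_Mor zero_Mor)

lemma shift_in_out:
  assumes X: "X \<in> Ob D" and "m = - n"
  shows "cmp D X (tw_shift_by n X) X n m (shift_in C n X) (shift_out C n X) = idn D X"
proof (intro ext)
  fix i j
  note P = X tw_shift_by_Ob[OF X, of n] shift_in_Mor[OF X, of n, unfolded PreTr_simps]
    shift_out_Mor[OF X \<open>m = - n\<close>, unfolded PreTr_simps]
  \<comment> \<open>The exponents of the two shift maps and of the composition, collected for the
    middle index \<open>i - n\<close>.\<close>
  have e: "even (i * n - n * n + (i * n + (i - n - i) * n))" by (simp add: algebra_simps)
  show "cmp D X (tw_shift_by n X) X n m (shift_in C n X) (shift_out C n X) i j = idn D X i j"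
    unfolding PreTr_simps
    by (subst PreTr_cmp_single[where p = "i - n"])
      (use P e in \<open>auto simp: shift_out_def shift_in_def tw_shift_by_def \<open>m = - n\<close> PreTr_fst
        cmp_sgn_left cmp_sgn_right idn_Mor zero_Mor sgn_Mor cmp_idn_left cmp_zero_left algebra_simps intro!: sgn_pow_eq_self\<close>)
qed

lemma shift_out_in:
  assumes X: "X \<in> Ob D" and "m = - n"
  shows "cmp D (tw_shift_by n X) X (tw_shift_by n X) m n (shift_out C n X) (shift_in C n X) =
    idn D (tw_shift_by n X)"
proof (intro ext)
  fix i j
  note P = X tw_shift_by_Ob[OF X, of n] shift_in_Mor[OF X, of n, unfolded PreTr_simps]
    shift_out_Mor[OF X \<open>m = - n\<close>, unfolded PreTr_simps]
  show "cmp D (tw_shift_by n X) X (tw_shift_by n X) m n (shift_out C n X) (shift_in C n X) i j =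
    idn D (tw_shift_by n X) i j"
    unfolding PreTr_simps
    by (subst PreTr_cmp_single[where p = "i + n"])
      (use P in \<open>auto simp: shift_out_def shift_in_def tw_shift_by_def \<open>m = - n\<close> PreTr_fst
        cmp_sgn_left cmp_sgn_right idn_Mor zero_Mor sgn_Mor cmp_idn_left cmp_zero_left algebra_simps intro!: sgn_pow_eq_self\<close>)
qed

lemma dif_shift_out:
  assumes X: "X \<in> Ob D" and m: "m = - n"
  shows "dif D X (tw_shift_by n X) m (shift_out C n X) = 0"
proof (intro ext)
  fix i j
  let ?Y = "tw_shift_by n X"
  note P = X tw_shift_by_Ob[OF X, of n] shift_out_Mor[OF X m, unfolded PreTr_simps]
  have q: "snd X \<in> pretr_Mor C X X 1" "snd ?Y \<in> pretr_Mor C ?Y ?Y 1"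
    using P(1,2) by (simp_all add: PreTr_Ob_iff graded_mat_simps)
  have 0: "dif C (fst X i) (fst ?Y j) (m + i - j) (shift_out C n X i j) = 0"
    using X by (auto simp: shift_out_def tw_shift_by_def m PreTr_fst dif_sgn idn_Mor dif_idn dif_zero)
  have 1: "pretr_cmp C X ?Y ?Y 1 m (snd ?Y) (shift_out C n X) i j = sgn_pow (- n + i * n) (snd X i (j + n))"
    by (subst PreTr_cmp_single[where p = "i - n"])
      (use P q in \<open>auto simp: shift_out_def tw_shift_by_def m PreTr_fst PreTr_snd_entry cmp_sgn_right idn_Mor cmp_idn_right\<close>)
  \<comment> \<open>For the middle index \<open>j + n\<close> the composition sign and the sign of
    the shift map combine to exponent \<open>i * n\<close>, which matches the term with the matrix
    of the shift.\<close>
  have e: "even ((j + n - i) * m + (j + n) * n - i * n)"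
    by (simp add: m algebra_simps)
  have 2: "pretr_cmp C X X ?Y m 1 (shift_out C n X) (snd X) i j = sgn_pow (i * n) (snd X i (j + n))"
    by (subst PreTr_cmp_single[where p = "j + n"])
      (use P q e in \<open>auto simp: shift_out_def tw_shift_by_def m PreTr_fst PreTr_snd_entry cmp_sgn_left idn_Mor cmp_idn_left
        intro!: sgn_pow_cong\<close>)
  show "dif D X ?Y m (shift_out C n X) i j = 0 i j"
    unfolding PreTr_dif_eq graded_mat_simps by (simp add: sgn_pow_apply 0 1 2) (simp add: m sgn_pow_def)
qed

lemma dif_shift_in:
  assumes "X \<in> Ob D"
  shows "dif D (tw_shift_by n X) X n (shift_in C n X) = 0"
proof -
  interpret D: dg_category "PreTr C" by (rule dg_category_PreTr)
  show ?thesis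
    by (rule D.closed_inverse[where d = "- n" and f = "shift_out C n X"])
      (use assms in \<open>auto simp: tw_shift_by_Ob shift_out_Mor shift_in_Mor shift_in_out shift_out_in dif_shift_out\<close>)
qed

text \<open>These are the off-diagonal entries of the matrix in \<open>tw_cone\<close>: the sign
  \<open>(-1)^i\<close> of a cone is that of the degree 1 shift map.\<close>

lemma shift_in_right:
  assumes "X \<in> Ob D" "Y \<in> Ob D" "f \<in> Mor D X Y 0"
  shows "cmp D (sh X) X Y 0 1 f (shift_in C 1 X) = (\<lambda>i j. sgn_pow i (f (i + 1) j))"
proof (intro ext)
  fix i j
  note P = assms(1,2) tw_shift_by_Ob[OF assms(1), of 1] shift_in_Mor[OF assms(1), of 1, unfolded PreTr_simps]
    assms(3)[unfolded PreTr_simps]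
  show "cmp D (sh X) X Y 0 1 f (shift_in C 1 X) i j = sgn_pow i (f (i + 1) j)"
    unfolding PreTr_simps
    by (subst PreTr_cmp_single[where p = "i + 1"])
      (use P in \<open>auto simp: shift_in_def tw_shift_by_def PreTr_fst pretr_entry cmp_sgn_right idn_Mor cmp_idn_right\<close>)
qed

text \<open>Translating indices of a degree 0 matrix is conjugation with the shift maps. The shift
  of morphisms is thereby expressed through composition, which dg functors preserve.\<close>

lemma tw_shift_mor_eq:
  assumes "X \<in> Ob D" "Y \<in> Ob D" "f \<in> Mor D X Y 0"
  shows "tw_shift_mor f = cmp D (sh X) Y (sh Y) (-1) 1 (shift_out C 1 Y)
    (cmp D (sh X) X Y 0 1 f (shift_in C 1 X))"
proof (intro ext)
  fix i j
  interpret D: dg_category "PreTr C" by (rule dg_category_PreTr)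
  note P = assms(1,2) tw_shift_by_Ob[OF assms(1), of 1] tw_shift_by_Ob[OF assms(2), of 1]
    shift_out_Mor[OF assms(2), of "-1" 1, unfolded PreTr_simps] assms(3)[unfolded PreTr_simps]
  have "cmp D (sh X) X Y 0 1 f (shift_in C 1 X) \<in> Mor D (sh X) Y 1"
    by (rule D.cmp_Mor_deg) (use assms in \<open>auto simp: tw_shift_by_Ob shift_in_Mor\<close>)
  then have M: "(\<lambda>i j. sgn_pow i (f (i + 1) j)) \<in> pretr_Mor C (sh X) Y 1"
    unfolding shift_in_right[OF assms] unfolding PreTr_simps .
  show "tw_shift_mor f i j = cmp D (sh X) Y (sh Y) (-1) 1 (shift_out C 1 Y)
    (cmp D (sh X) X Y 0 1 f (shift_in C 1 X)) i j"
    unfolding shift_in_right[OF assms] unfolding PreTr_simps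
    by (subst PreTr_cmp_single[where p = "j + 1"])
      (use P M in \<open>auto simp: shift_out_def tw_shift_by_def tw_shift_mor_def PreTr_fst pretr_entry cmp_sgn_left cmp_sgn_right
        idn_Mor sgn_Mor cmp_idn_left sgn_pow_eq_self\<close>)
qed

section \<open>Zero objects and change of twist\<close>

lemma zero_ob_PreTr:
  assumes "zero_ob C z"
  shows "zero_ob D ((\<lambda>i. z), 0)"
  using assms
  by (auto simp: zero_ob_def PreTr_Ob_iff graded_mat_simps tw_supp_def pretr_Mor_def zero_Mor dif_zero pretr_cmp_def
      PreTr_simps(5) fun_eq_iff)

text \<open>The differential of \<open>PreTr C\<close> already contains the graded commutator with
  \<open>snd X\<close>, so the condition on \<open>x\<close> is the Maurer-Cartan equation for
  \<open>snd X + x\<close>. The identity matrix is an isomorphism onto the new object, and its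
  differential is the change of twist.\<close>

lemma PreTr_twist:
  assumes X: "X \<in> Ob D" and x: "x \<in> Mor D X X 1"
    and mc: "dif D X X 1 x = cmp D X X X 1 1 x x"
  defines "Y \<equiv> (fst X, snd X + x)" and "e \<equiv> idn D X"
  shows "Y \<in> Ob D" "e \<in> Mor D X Y 0" "e \<in> Mor D Y X 0"
    "cmp D X Y X 0 0 e e = idn D X" "cmp D Y X Y 0 0 e e = idn D Y"
    "dif D X Y 0 e = cmp D X X Y 0 1 e x"
    "dif D Y X 0 e = - cmp D Y X X 1 0 x e"
proof -
  interpret M: dg_category "graded_mat C" by (rule dg_category_graded_mat)
  have fY: "fst Y = fst X" "snd Y = snd X + x" by (simp_all add: Y_def)
  note co = pretr_Mor_cong[OF fY(1) refl] pretr_Mor_cong[OF refl fY(1)] pretr_cmp_cong[OF fY(1) refl refl]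
    pretr_cmp_cong[OF refl fY(1) refl] pretr_cmp_cong[OF refl refl fY(1)]
  have co': "Mor M Y = Mor M X" "Mor M Z Y = Mor M Z X"
    "cmp M Y = cmp M X" "cmp M Z Y = cmp M Z X"
    "cmp M Z W Y = cmp M Z W X" "idn M Y = idn M X"
    "dif M Y = dif M X" "dif M Z Y = dif M Z X" for Z W
    by (simp_all add: graded_mat_simps fun_eq_iff co fY(1) graded_mat_def)
  have q: "X \<in> Ob M" "snd X \<in> Mor M X X 1" "x \<in> Mor M X X 1"
    "dif M X X 1 (snd X) = cmp M X X X 1 1 (snd X) (snd X)"
    using X x by (simp_all add: PreTr_Ob_iff PreTr_graded_mat)
  have dx: "dif M X X 1 x = cmp M X X X 1 1 x x + cmp M X X X 1 1 (snd X) x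
      + cmp M X X X 1 1 x (snd X)"
    using mc by (simp add: PreTr_dif_eq PreTr_graded_mat algebra_simps)
  have YM: "Y \<in> Ob M" using q(1) by (simp add: graded_mat_simps fY(1) tw_supp_cong[OF fY(1)])
  show Y: "Y \<in> Ob D"
    unfolding PreTr_Ob_iff using q YM by (simp add: co' fY(2) M.Mor_rules M.dif_linear M.cmp_linear dx add_ac)
  note q' = q M.idn_Mor[OF q(1)] M.cmp_idn_left M.cmp_idn_right M.dif_idn
  show "e \<in> Mor D X Y 0" "e \<in> Mor D Y X 0"
    "cmp D X Y X 0 0 e e = idn D X" "cmp D Y X Y 0 0 e e = idn D Y"
    using q' by (simp_all add: e_def PreTr_graded_mat co')
  show "dif D X Y 0 e = cmp D X X Y 0 1 e x"
    "dif D Y X 0 e = - cmp D Y X X 1 0 x e"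
    using q' by (simp_all add: e_def PreTr_graded_mat PreTr_dif_eq co' fY(2) M.Mor_rules)
qed


section \<open>Cones as twisted direct sums of graded matrices\<close>

lemma diag_mor_Mor:
  assumes "X \<in> Ob M" "Y \<in> Ob M" "\<And>i. u i \<in> Mor C (fst X i) (fst Y i) 0"
  shows "diag_mor u \<in> pretr_Mor C X Y 0"
  using assms by (auto simp: pretr_Mor_def diag_mor_def graded_mat_simps zero_Mor)

lemma diag_mor_cmp_left:
  assumes "X \<in> Ob M" "Y \<in> Ob M" "Z \<in> Ob M"
    "\<And>i. u i \<in> Mor C (fst Y i) (fst Z i) 0" "g \<in> pretr_Mor C X Y l"
  shows "pretr_cmp C X Y Z 0 l (diag_mor u) g =
    (\<lambda>i j. cmp C (fst X i) (fst Y j) (fst Z j) 0 (l + i - j) (u j) (g i j))"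
proof (intro ext)
  fix i j
  have "diag_mor u \<in> pretr_Mor C Y Z 0" using assms by (simp add: diag_mor_Mor)
  then show "pretr_cmp C X Y Z 0 l (diag_mor u) g i j = cmp C (fst X i) (fst Y j) (fst Z j) 0 (l + i - j) (u j) (g i j)"
    by (subst pretr_cmp_single[where p = j]) (use assms in \<open>auto simp: diag_mor_def\<close>)
qed

lemma diag_mor_cmp_right:
  assumes "X \<in> Ob M" "Y \<in> Ob M" "Z \<in> Ob M"
    "f \<in> pretr_Mor C Y Z k" "\<And>i. u i \<in> Mor C (fst X i) (fst Y i) 0"
  shows "pretr_cmp C X Y Z k 0 f (diag_mor u) =
    (\<lambda>i j. cmp C (fst X i) (fst Y i) (fst Z j) (k + i - j) 0 (f i j) (u i))"
proof (intro ext)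
  fix i j
  have "diag_mor u \<in> pretr_Mor C X Y 0" using assms by (simp add: diag_mor_Mor)
  then show "pretr_cmp C X Y Z k 0 f (diag_mor u) i j = cmp C (fst X i) (fst Y i) (fst Z j) (k + i - j) 0 (f i j) (u i)"
    by (subst pretr_cmp_single[where p = i]) (use assms in \<open>auto simp: diag_mor_def\<close>)
qed

lemma diag_mor_biproduct:
  assumes "X \<in> Ob M" "Y \<in> Ob M" "Z \<in> Ob M"
    and B: "\<And>i. dg_biproduct C (fst X i) (fst Y i) (fst Z i) (\<iota>1 i) (\<iota>2 i) (\<pi>1 i) (\<pi>2 i)"
  shows "dg_biproduct M X Y Z (diag_mor \<iota>1) (diag_mor \<iota>2) (diag_mor \<pi>1) (diag_mor \<pi>2)"
proof -
  note b = B[unfolded dg_biproduct_def closed_mor_def]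
  have O: "fst X i \<in> Ob C" "fst Y i \<in> Ob C" "fst Z i \<in> Ob C" for i
    using assms(1-3) by (simp_all add: graded_mat_simps)
  have M: "diag_mor \<iota>1 \<in> pretr_Mor C X Z 0" "diag_mor \<iota>2 \<in> pretr_Mor C Y Z 0"
    "diag_mor \<pi>1 \<in> pretr_Mor C Z X 0" "diag_mor \<pi>2 \<in> pretr_Mor C Z Y 0"
    using b assms(1-3) by (simp_all add: diag_mor_Mor)
  have b': "\<iota>1 i \<in> Mor C (fst X i) (fst Z i) 0" "\<iota>2 i \<in> Mor C (fst Y i) (fst Z i) 0"
    "\<pi>1 i \<in> Mor C (fst Z i) (fst X i) 0" "\<pi>2 i \<in> Mor C (fst Z i) (fst Y i) 0"
    "dif C (fst X i) (fst Z i) 0 (\<iota>1 i) = 0" "dif C (fst Y i) (fst Z i) 0 (\<iota>2 i) = 0"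
    "dif C (fst Z i) (fst X i) 0 (\<pi>1 i) = 0" "dif C (fst Z i) (fst Y i) 0 (\<pi>2 i) = 0" for i
    using b by simp_all
  show ?thesis
    unfolding dg_biproduct_def closed_mor_def graded_mat_simps(2-)
    using assms(1-3) M b b' O
    by (simp add: diag_mor_cmp_left) (auto simp: fun_eq_iff diag_mor_def dif_zero cmp_zero_right)
qed

text \<open>Here \<open>q\<close> is triangular with diagonal \<open>q1\<close>, \<open>q2\<close>
  and corner \<open>\<phi>\<close>. The diagonal of \<open>dq = q q\<close> consists of the
  equations of the summands; its corner is \<open>d\<phi> = q2 \<phi> + \<phi> q1\<close>,
  closedness of \<open>\<phi>\<close> for the twisted differential.\<close>

lemma biproduct_twist_mc:
  assumes B: "dg_biproduct C X Y Z \<iota>1 \<iota>2 \<pi>1 \<pi>2" and O: "X \<in> Ob C" "Y \<in> Ob C"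
    and m: "q1 \<in> Mor C X X 1" "q2 \<in> Mor C Y Y 1" "\<phi> \<in> Mor C X Y 1"
    and d: "dif C X X 1 q1 = cmp C X X X 1 1 q1 q1" "dif C Y Y 1 q2 = cmp C Y Y Y 1 1 q2 q2"
      "dif C X Y 1 \<phi> = cmp C X Y Y 1 1 q2 \<phi> + cmp C X X Y 1 1 \<phi> q1"
  defines "q \<equiv> cmp C Z X Z 0 1 \<iota>1 (cmp C Z X X 1 0 q1 \<pi>1) + cmp C Z Y Z 0 1 \<iota>2 (cmp C Z X Y 1 0 \<phi> \<pi>1)
    + cmp C Z Y Z 0 1 \<iota>2 (cmp C Z Y Y 1 0 q2 \<pi>2)"
  shows "q \<in> Mor C Z Z 1" "dif C Z Z 1 q = cmp C Z Z Z 1 1 q q"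
    "cmp C X Z Z 1 0 q \<iota>1 = cmp C X X Z 0 1 \<iota>1 q1 + cmp C X Y Z 0 1 \<iota>2 \<phi>"
    "cmp C Y Z Z 1 0 q \<iota>2 = cmp C Y Y Z 0 1 \<iota>2 q2"
    "cmp C Z Z X 0 1 \<pi>1 q = cmp C Z X X 1 0 q1 \<pi>1"
proof -
  note b = B[unfolded dg_biproduct_def closed_mor_def] O m
  show "q \<in> Mor C Z Z 1" unfolding q_def using b by (simp add: Mor_rules)
  show "cmp C X Z Z 1 0 q \<iota>1 = cmp C X X Z 0 1 \<iota>1 q1 + cmp C X Y Z 0 1 \<iota>2 \<phi>"
    "cmp C Y Z Z 1 0 q \<iota>2 = cmp C Y Y Z 0 1 \<iota>2 q2"
    unfolding q_def using b by (simp_all add: Mor_rules cmp_linear cmp_assoc_deg cmp_idn_right)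
  show 1: "cmp C Z Z X 0 1 \<pi>1 q = cmp C Z X X 1 0 q1 \<pi>1"
    unfolding q_def using b
    by (simp add: Mor_rules cmp_add_right cmp_cancel[where X = X] cmp_cancel_zero[where X = Y])
  have 2: "cmp C Z Z Y 0 1 \<pi>2 q = cmp C Z X Y 1 0 \<phi> \<pi>1 + cmp C Z Y Y 1 0 q2 \<pi>2"
    unfolding q_def using b
    by (simp add: Mor_rules cmp_add_right cmp_cancel[where X = Y] cmp_cancel_zero[where X = X])
  have "cmp C Z Z Z 1 1 q q = cmp C Z X Z 0 2 \<iota>1 (cmp C Z X X 1 1 q1 (cmp C Z Z X 0 1 \<pi>1 q))
     + cmp C Z Y Z 0 2 \<iota>2 (cmp C Z X Y 1 1 \<phi> (cmp C Z Z X 0 1 \<pi>1 q))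
     + cmp C Z Y Z 0 2 \<iota>2 (cmp C Z Y Y 1 1 q2 (cmp C Z Z Y 0 1 \<pi>2 q))"
    using b \<open>q \<in> Mor C Z Z 1\<close>
    by (subst q_def) (simp add: Mor_rules cmp_add_left cmp_assoc_deg)
  also have "\<dots> = dif C Z Z 1 q"
    unfolding 1 2 unfolding q_def using b
    by (simp add: Mor_rules dif_linear leibniz_deg d cmp_linear cmp_assoc_deg add_ac)
  finally show "dif C Z Z 1 q = cmp C Z Z Z 1 1 q q" by simp
qed

text \<open>Diagonal matrices of degree 0 multiply without signs, so the entrywise formula for the
  twist of a cone is a sum of products of graded matrices.\<close>

lemma cone_matrix_eq:
  fixes X Y Z :: "('o, 'm) tw"
  defines "X1 \<equiv> sh X"
  assumes O: "X1 \<in> Ob M" "Y \<in> Ob M" "Z \<in> Ob M"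
    and B: "\<And>i. dg_biproduct C (fst X (i + 1)) (fst Y i) (fst Z i) (\<iota>1 i) (\<iota>2 i) (\<pi>1 i) (\<pi>2 i)"
    and q: "snd X1 \<in> pretr_Mor C X1 X1 1" "snd Y \<in> pretr_Mor C Y Y 1"
    and \<phi>: "(\<lambda>i j. sgn_pow i (f (i + 1) j)) \<in> pretr_Mor C X1 Y 1"
  shows "(\<lambda>i j. sandwich C (fst Z i) (fst X (i + 1)) (fst X (j + 1)) (fst Z j) (i - j + 1)
          (\<iota>1 j) (snd X (i + 1) (j + 1)) (\<pi>1 i)
        + sandwich C (fst Z i) (fst X (i + 1)) (fst Y j) (fst Z j) (i - j + 1)
          (\<iota>2 j) (sgn_pow i (f (i + 1) j)) (\<pi>1 i)
        + sandwich C (fst Z i) (fst Y i) (fst Y j) (fst Z j) (i - j + 1)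
          (\<iota>2 j) (snd Y i j) (\<pi>2 i)) =
    pretr_cmp C Z X1 Z 0 1 (diag_mor \<iota>1) (pretr_cmp C Z X1 X1 1 0 (snd X1) (diag_mor \<pi>1))
    + pretr_cmp C Z Y Z 0 1 (diag_mor \<iota>2) (pretr_cmp C Z X1 Y 1 0 (\<lambda>i j. sgn_pow i (f (i + 1) j)) (diag_mor \<pi>1))
    + pretr_cmp C Z Y Z 0 1 (diag_mor \<iota>2) (pretr_cmp C Z Y Y 1 0 (snd Y) (diag_mor \<pi>2))"
proof -
  interpret M: dg_category "graded_mat C" by (rule dg_category_graded_mat)
  have f1: "fst X1 = (\<lambda>i. fst X (i + 1))" "snd X1 = (\<lambda>i j. snd X (i + 1) (j + 1))"
    by (simp_all add: X1_def tw_shift_by_def)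
  note b = B[unfolded dg_biproduct_def closed_mor_def]
  have b': "\<iota>1 i \<in> Mor C (fst X1 i) (fst Z i) 0" "\<iota>2 i \<in> Mor C (fst Y i) (fst Z i) 0"
    "\<pi>1 i \<in> Mor C (fst Z i) (fst X1 i) 0" "\<pi>2 i \<in> Mor C (fst Z i) (fst Y i) 0" for i
    using b by (simp_all add: f1)
  note MM = M.cmp_Mor_deg[unfolded graded_mat_simps(2,4)]
  have ix: "i - j + 1 = 1 + i - j" for i j :: int by simp
  have p: "pretr_cmp C Z X1 X1 1 0 (snd X1) (diag_mor \<pi>1) \<in> pretr_Mor C Z X1 1"
    "pretr_cmp C Z X1 Y 1 0 (\<lambda>i j. sgn_pow i (f (i + 1) j)) (diag_mor \<pi>1) \<in> pretr_Mor C Z Y 1"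
    "pretr_cmp C Z Y Y 1 0 (snd Y) (diag_mor \<pi>2) \<in> pretr_Mor C Z Y 1"
    using O q \<phi> b' by (auto intro!: MM diag_mor_Mor)
  show ?thesis
    unfolding diag_mor_cmp_left[OF O(3,1,3) b'(1) p(1)] diag_mor_cmp_left[OF O(3,2,3) b'(2) p(2)]
      diag_mor_cmp_left[OF O(3,2,3) b'(2) p(3)]
    unfolding diag_mor_cmp_right[OF O(3,1,1) q(1) b'(3)]
      diag_mor_cmp_right[OF O(3,1,2) \<phi> b'(3)] diag_mor_cmp_right[OF O(3,2,2) q(2) b'(4)]
    by (simp add: fun_eq_iff sandwich_def ix f1)
qed

text \<open>\<open>\<phi>\<close> is closed as the composite of the closed maps
  \<open>shift_in\<close> and \<open>f\<close>. Spelled out in graded matrices, closedness is the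
  corner equation needed for the twist of the cone.\<close>

lemma cone_setup:
  assumes X: "X \<in> Ob D" and Y: "Y \<in> Ob D" and f: "f \<in> closed_mor D X Y"
  defines "X1 \<equiv> sh X"
  defines "\<phi> \<equiv> (\<lambda>i j. sgn_pow i (f (i + 1) j))"
  shows "cmp D X1 X Y 0 1 f (shift_in C 1 X) = \<phi>" "\<phi> \<in> Mor D X1 Y 1" "dif D X1 Y 1 \<phi> = 0"
    "dif M X1 Y 1 \<phi> = cmp M X1 Y Y 1 1 (snd Y) \<phi> + cmp M X1 X1 Y 1 1 \<phi> (snd X1)"
proof -
  interpret D: dg_category "PreTr C" by (rule dg_category_PreTr)
  have f': "f \<in> Mor D X Y 0" "dif D X Y 0 f = 0" using f by (simp_all add: closed_mor_def)
  show 1: "cmp D X1 X Y 0 1 f (shift_in C 1 X) = \<phi>"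
    unfolding X1_def \<phi>_def by (rule shift_in_right[OF X Y f'(1)])
  have X1: "X1 \<in> Ob D" unfolding X1_def by (rule tw_shift_by_Ob[OF X])
  have s: "shift_in C 1 X \<in> Mor D X1 X 1" "dif D X1 X 1 (shift_in C 1 X) = 0"
    unfolding X1_def by (simp_all add: shift_in_Mor dif_shift_in X)
  show "\<phi> \<in> Mor D X1 Y 1"
    unfolding 1[symmetric] using X Y X1 f' s by (simp add: D.cmp_Mor_deg)
  show 2: "dif D X1 Y 1 \<phi> = 0"
    unfolding 1[symmetric] using X Y X1 f' s by (simp add: D.leibniz_deg D.cmp_linear)
  show "dif M X1 Y 1 \<phi> = cmp M X1 Y Y 1 1 (snd Y) \<phi> + cmp M X1 X1 Y 1 1 \<phi> (snd X1)"
    using 2 by (simp add: PreTr_dif_eq algebra_simps)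
qed

text \<open>All structure maps are closed as graded matrices. The twists change the differential of
  \<open>diag_mor \<iota>1\<close> by the commutator with them, and the triangular form of
  \<open>snd Z\<close> leaves the corner \<open>\<iota>2 \<phi>\<close>; for \<open>\<iota>2\<close>
  and \<open>\<pi>1\<close> nothing is left.\<close>

lemma tw_cone_dg_ext:
  assumes T: "tw_cone C X Y f Z \<iota>1 \<iota>2 \<pi>1 \<pi>2"
  shows "dg_ext D (sh X) Y Z (cmp D (sh X) X Y 0 1 f (shift_in C 1 X))
    (diag_mor \<iota>1) (diag_mor \<iota>2) (diag_mor \<pi>1) (diag_mor \<pi>2)"
proof -
  define X1 where "X1 = sh X"
  define \<phi> where "\<phi> = (\<lambda>i j. sgn_pow i (f (i + 1) j))"
  have X: "X \<in> Ob D" and Y: "Y \<in> Ob D" and Z: "Z \<in> Ob D"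
    and f: "f \<in> closed_mor D X Y"
    and B: "dg_biproduct C (fst X (i + 1)) (fst Y i) (fst Z i) (\<iota>1 i) (\<iota>2 i) (\<pi>1 i) (\<pi>2 i)" for i
    using T by (simp_all add: tw_cone_def)
  interpret M: dg_category "graded_mat C" by (rule dg_category_graded_mat)
  have X1: "X1 \<in> Ob D" unfolding X1_def by (rule tw_shift_by_Ob[OF X])
  note P = X1[unfolded PreTr_Ob_iff] Y[unfolded PreTr_Ob_iff] Z[unfolded PreTr_Ob_iff]
  note S = cone_setup[OF X Y f, folded X1_def \<phi>_def]
  have \<phi>: "\<phi> \<in> Mor M X1 Y 1" using S(2) by (simp add: PreTr_graded_mat)
  have B': "dg_biproduct M X1 Y Z (diag_mor \<iota>1) (diag_mor \<iota>2) (diag_mor \<pi>1) (diag_mor \<pi>2)"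
    by (rule diag_mor_biproduct) (use P B in \<open>auto simp: X1_def tw_shift_by_def\<close>)
  have q: "snd Z = cmp M Z X1 Z 0 1 (diag_mor \<iota>1) (cmp M Z X1 X1 1 0 (snd X1) (diag_mor \<pi>1))
    + cmp M Z Y Z 0 1 (diag_mor \<iota>2) (cmp M Z X1 Y 1 0 \<phi> (diag_mor \<pi>1))
    + cmp M Z Y Z 0 1 (diag_mor \<iota>2) (cmp M Z Y Y 1 0 (snd Y) (diag_mor \<pi>2))"
    unfolding graded_mat_simps \<phi>_def X1_def
    by (subst cone_matrix_eq[symmetric]) (use P B \<phi> T in \<open>auto simp: X1_def \<phi>_def graded_mat_simps(2) tw_cone_def fun_eq_iff\<close>)
  note Q = M.biproduct_twist_mc[OF B' _ _ _ _ \<phi> _ _ S(4), folded q]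
  note b = B'[unfolded dg_biproduct_def closed_mor_def]
  show ?thesis
    unfolding X1_def[symmetric] S(1) dg_ext_def
    using X1 Y Z S(2) b P \<phi> by (simp add: PreTr_graded_mat PreTr_dif_eq Q)
qed

lemma tw_cone_exists:
  assumes "dg_additive C" and X: "X \<in> Ob D" and Y: "Y \<in> Ob D" and f: "f \<in> closed_mor D X Y"
  shows "\<exists>Z \<iota>1 \<iota>2 \<pi>1 \<pi>2. tw_cone C X Y f Z \<iota>1 \<iota>2 \<pi>1 \<pi>2"
proof -
  define X1 where "X1 = sh X"
  define \<phi> where "\<phi> = (\<lambda>i j. sgn_pow i (f (i + 1) j))"
  interpret M: dg_category "graded_mat C" by (rule dg_category_graded_mat)
  have "\<forall>i. \<exists>S \<iota>1 \<iota>2 \<pi>1 \<pi>2. dg_biproduct C (fst X (i + 1)) (fst Y i) S \<iota>1 \<iota>2 \<pi>1 \<pi>2"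
    using assms(1) X Y by (simp add: dg_additive_def PreTr_fst)
  then obtain S \<iota>1 \<iota>2 \<pi>1 \<pi>2
    where B: "\<And>i. dg_biproduct C (fst X (i + 1)) (fst Y i) (S i) (\<iota>1 i) (\<iota>2 i) (\<pi>1 i) (\<pi>2 i)"
    by metis
  note b = B[unfolded dg_biproduct_def closed_mor_def]
  have X1: "X1 \<in> Ob D" unfolding X1_def by (rule tw_shift_by_Ob[OF X])
  note P = X1[unfolded PreTr_Ob_iff] Y[unfolded PreTr_Ob_iff]
  \<comment> \<open>The identity of a direct sum is the sum of two composites through the summands,
    so it vanishes with them. This keeps the support of the termwise sum finite.\<close>
  have "zero_ob C (S i)" if z: "zero_ob C (fst X1 i)" "zero_ob C (fst Y i)" for i
  proof -
    have "\<iota>1 i = 0" "\<iota>2 i = 0"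
      using b[of i] zero_ob_Mor_from[OF _ z(1)[unfolded X1_def tw_shift_by_def fst_conv]] zero_ob_Mor_from[OF _ z(2)]
      by blast+
    then have "idn C (S i) = cmp C (S i) (fst X (i + 1)) (S i) 0 0 0 (\<pi>1 i) + cmp C (S i) (fst Y i) (S i) 0 0 0 (\<pi>2 i)"
      using b[of i] by simp
    also have "\<dots> = 0" using b[of i] X Y by (simp add: cmp_zero_left PreTr_fst)
    finally show ?thesis using b[of i] by (simp add: zero_ob_def)
  qed
  then have "tw_supp C (S, q) \<subseteq> tw_supp C X1 \<union> tw_supp C Y" for q
    by (auto simp: tw_supp_def)
  then have fin: "finite (tw_supp C (S, q))" for q
    using PreTr_finite[OF X1] PreTr_finite[OF Y] by (meson finite_UnI finite_subset)
  note S = cone_setup[OF X Y f, folded X1_def \<phi>_def]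
  have \<phi>: "\<phi> \<in> Mor M X1 Y 1" using S(2) by (simp add: PreTr_graded_mat)
  define q where "q = (\<lambda>i j. sandwich C (S i) (fst X (i + 1)) (fst X (j + 1)) (S j) (i - j + 1)
          (\<iota>1 j) (snd X (i + 1) (j + 1)) (\<pi>1 i)
        + sandwich C (S i) (fst X (i + 1)) (fst Y j) (S j) (i - j + 1)
          (\<iota>2 j) (sgn_pow i (f (i + 1) j)) (\<pi>1 i)
        + sandwich C (S i) (fst Y i) (fst Y j) (S j) (i - j + 1)
          (\<iota>2 j) (snd Y i j) (\<pi>2 i))"
  define Z where "Z = (S, q)"
  have fZ: "fst Z = S" "snd Z = q" by (simp_all add: Z_def)
  have ZM: "Z \<in> Ob M" using fin b by (simp add: Z_def graded_mat_simps)
  have B': "dg_biproduct M X1 Y Z (diag_mor \<iota>1) (diag_mor \<iota>2) (diag_mor \<pi>1) (diag_mor \<pi>2)"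
    by (rule diag_mor_biproduct) (use P B ZM in \<open>auto simp: X1_def tw_shift_by_def fZ\<close>)
  have q: "snd Z = cmp M Z X1 Z 0 1 (diag_mor \<iota>1) (cmp M Z X1 X1 1 0 (snd X1) (diag_mor \<pi>1))
    + cmp M Z Y Z 0 1 (diag_mor \<iota>2) (cmp M Z X1 Y 1 0 \<phi> (diag_mor \<pi>1))
    + cmp M Z Y Z 0 1 (diag_mor \<iota>2) (cmp M Z Y Y 1 0 (snd Y) (diag_mor \<pi>2))"
    unfolding graded_mat_simps \<phi>_def X1_def
    by (subst cone_matrix_eq[symmetric]) (use P B \<phi> ZM in \<open>auto simp: X1_def \<phi>_def graded_mat_simps(2) fZ q_def\<close>)
  note Q = M.biproduct_twist_mc[OF B' _ _ _ _ \<phi> _ _ S(4), folded q]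
  have "Z \<in> Ob D"
    unfolding PreTr_Ob_iff using ZM P Q by blast
  then have "tw_cone C X Y f Z \<iota>1 \<iota>2 \<pi>1 \<pi>2"
    using X Y f B by (simp add: tw_cone_def fZ q_def)
  then show ?thesis by blast
qed

end

section \<open>Convolution of twisted complexes\<close>

lemma tw_single_mor_00 [simp]: "tw_single_mor f 0 0 = f"
  by (simp add: tw_single_mor_def)

lemma fst_tw_single_0 [simp]: "fst (tw_single C X) 0 = X"
  by (simp add: tw_single_def)

lemma snd_tw_single [simp]: "snd (tw_single C X) = 0"
  by (simp add: tw_single_def zero_fun_def)

text \<open>\<open>Z\<close> plays the role of \<open>Y \<oplus> P[-n]\<close>, described without a
  shift operation by letting the inclusion and projection of \<open>P\<close> have degrees
  \<open>n\<close> and \<open>- n\<close>.\<close>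

definition has_shifted_sums :: "('o, 'm::ab_group_add) dgcat \<Rightarrow> bool" where
  "has_shifted_sums C \<longleftrightarrow> (\<forall>P\<in>Ob C. \<forall>Y\<in>Ob C. \<forall>n. \<exists>Z i j r p. Z \<in> Ob C \<and>
     i \<in> Mor C Y Z 0 \<and> j \<in> Mor C P Z n \<and> r \<in> Mor C Z Y 0 \<and> p \<in> Mor C Z P (- n) \<and>
     dif C Y Z 0 i = 0 \<and> dif C P Z n j = 0 \<and> dif C Z Y 0 r = 0 \<and> dif C Z P (- n) p = 0 \<and>
     cmp C Y Z Y 0 0 r i = idn C Y \<and> cmp C P Z P (- n) n p j = idn C P \<and>
     cmp C Y Z P (- n) 0 p i = 0 \<and> cmp C P Z Y 0 n r j = 0 \<and>
     cmp C Z Y Z 0 0 i r + cmp C Z P Z n (- n) j p = idn C Z)"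

text \<open>\<open>T\<close> plays the role of \<open>S\<close> with differential changed by a
  Maurer-Cartan element \<open>x\<close>; the isomorphism \<open>e\<close> is not closed, its defect
  being \<open>x\<close>.\<close>

definition has_twists :: "('o, 'm::ab_group_add) dgcat \<Rightarrow> bool" where
  "has_twists C \<longleftrightarrow> (\<forall>S\<in>Ob C. \<forall>x\<in>Mor C S S 1. dif C S S 1 x = cmp C S S S 1 1 x x \<longrightarrow>
     (\<exists>T e e'. T \<in> Ob C \<and> e \<in> Mor C S T 0 \<and> e' \<in> Mor C T S 0 \<and>
       cmp C S T S 0 0 e' e = idn C S \<and> cmp C T S T 0 0 e e' = idn C T \<and>
       dif C S T 0 e = cmp C S S T 0 1 e x \<and> dif C T S 0 e' = - cmp C T S S 1 0 x e'))"

context dg_category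
begin

section \<open>The embedding by complexes with a single term\<close>

lemma zero_ob_tw_single:
  assumes "zero_ob C z" "i \<noteq> 0"
  shows "zero_ob C (fst (tw_single C X) i)"
  using assms someI[of "zero_ob C" z] by (simp add: tw_single_def)

lemma PreTr_Ob_zero_twist:
  "X \<in> Ob M \<Longrightarrow> (fst X, 0) \<in> Ob D"
  by (auto simp: PreTr_Ob_iff graded_mat_simps tw_supp_def pretr_Mor_def zero_Mor dif_zero pretr_cmp_def
      fun_eq_iff cmp_zero_left)

lemma tw_single_Ob:
  assumes z: "zero_ob C z" and "X \<in> Ob C"
  shows "tw_single C X \<in> Ob D"
proof -
  have *: "zero_ob C (fst (tw_single C X) i)" if "i \<noteq> 0" for i using zero_ob_tw_single[OF z that] .
  then have "tw_supp C (tw_single C X) \<subseteq> {0}" by (auto simp: tw_supp_def)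
  then have "finite (tw_supp C (tw_single C X))" by (rule finite_subset) simp
  moreover have "fst (tw_single C X) i \<in> Ob C" for i
    using *[of i] assms(2) by (cases "i = 0") (auto simp: zero_ob_def)
  ultimately have "tw_single C X \<in> Ob M" by (simp add: graded_mat_simps)
  from PreTr_Ob_zero_twist[OF this] show ?thesis by (metis prod.collapse snd_tw_single)
qed

text \<open>Every entry other than the one at \<open>(0, 0)\<close> has a zero object as source or
  target.\<close>

lemma tw_single_entry:
  assumes z: "zero_ob C z" and X: "X \<in> Ob C" and Y: "Y \<in> Ob C"
    and f: "f \<in> Mor D (tw_single C X) (tw_single C Y) l"
  shows "f = tw_single_mor (f 0 0)"
proof (intro ext)
  fix i j
  have f': "f i j \<in> Mor C (fst (tw_single C X) i) (fst (tw_single C Y) j) (l + i - j)"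
    using f by (simp add: PreTr_simps pretr_Mor_def)
  have O: "fst (tw_single C X) i \<in> Ob C" "fst (tw_single C Y) j \<in> Ob C"
    using tw_single_Ob[OF z X] tw_single_Ob[OF z Y] by (simp_all add: PreTr_fst)
  have "f i j = 0" if "i \<noteq> 0 \<or> j \<noteq> 0"
    using that zero_ob_Mor_from[OF O(2) zero_ob_tw_single[OF z, of i X] f']
      zero_ob_Mor_to[OF O(1) zero_ob_tw_single[OF z, of j Y] f'] by blast
  then show "f i j = tw_single_mor (f 0 0) i j" by (auto simp: tw_single_mor_def)
qed

lemma tw_single_mor_Mor:
  assumes z: "zero_ob C z" and X: "X \<in> Ob C" and Y: "Y \<in> Ob C" and f: "f \<in> Mor C X Y l"
  shows "tw_single_mor f \<in> Mor D (tw_single C X) (tw_single C Y) l"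
  using f PreTr_fst[OF tw_single_Ob[OF z X]] PreTr_fst[OF tw_single_Ob[OF z Y]]
  by (auto simp: PreTr_simps pretr_Mor_def tw_single_mor_def zero_Mor)

lemma tw_single_entry_Mor:
  assumes "f \<in> Mor D (tw_single C X) (tw_single C Y) l"
  shows "f 0 0 \<in> Mor C X Y l"
proof -
  have "f 0 0 \<in> Mor C (fst (tw_single C X) 0) (fst (tw_single C Y) 0) (l + 0 - 0)"
    using assms unfolding PreTr_simps pretr_Mor_def by blast
  then show ?thesis by simp
qed

text \<open>At index 0 the composition sign is trivial. With \<open>tw_single_dif\<close> and
  \<open>tw_single_idn\<close> this gives a dg embedding of \<open>C\<close> into
  \<open>PreTr C\<close>, in which equations of \<open>C\<close> can be checked.\<close>

lemma tw_single_cmp: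
  assumes z: "zero_ob C z" and O: "X \<in> Ob C" "Y \<in> Ob C" "Z \<in> Ob C" and f: "f \<in> Mor C Y Z k" and g: "g \<in> Mor C X Y l"
  shows "cmp D (tw_single C X) (tw_single C Y) (tw_single C Z) k l (tw_single_mor f) (tw_single_mor g) =
    tw_single_mor (cmp C X Y Z k l f g)"
proof -
  interpret D: dg_category "PreTr C" by (rule dg_category_PreTr)
  note P = O[THEN tw_single_Ob[OF z]] and m = tw_single_mor_Mor[OF z O(2,3) f] tw_single_mor_Mor[OF z O(1,2) g]
  have "cmp D (tw_single C X) (tw_single C Y) (tw_single C Z) k l (tw_single_mor f) (tw_single_mor g)
      \<in> Mor D (tw_single C X) (tw_single C Z) (k + l)"
    using P m by (simp add: D.cmp_Mor_deg)
  note tw_single_entry[OF z O(1,3) this]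
  moreover have "cmp D (tw_single C X) (tw_single C Y) (tw_single C Z) k l (tw_single_mor f) (tw_single_mor g) 0 0
      = cmp C X Y Z k l f g"
    unfolding PreTr_simps
    by (subst PreTr_cmp_single[where p = 0]) (use P m in \<open>auto simp: PreTr_simps tw_single_mor_def\<close>)
  ultimately show ?thesis by simp
qed

lemma tw_single_dif:
  assumes z: "zero_ob C z" and O: "X \<in> Ob C" "Y \<in> Ob C" and f: "f \<in> Mor C X Y l"
  shows "dif D (tw_single C X) (tw_single C Y) l (tw_single_mor f) = tw_single_mor (dif C X Y l f)"
proof -
  interpret D: dg_category "PreTr C" by (rule dg_category_PreTr)
  interpret M: dg_category "graded_mat C" by (rule dg_category_graded_mat)
  note P = O[THEN tw_single_Ob[OF z]] and m = tw_single_mor_Mor[OF z O f]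
  have P': "tw_single C X \<in> Ob M" "tw_single C Y \<in> Ob M"
    using P by (simp_all add: PreTr_Ob_graded_mat)
  have "dif D (tw_single C X) (tw_single C Y) l (tw_single_mor f)
      \<in> Mor D (tw_single C X) (tw_single C Y) (l + 1)"
    using P m by (simp add: D.dif_Mor)
  note tw_single_entry[OF z O this]
  moreover have "dif D (tw_single C X) (tw_single C Y) l (tw_single_mor f) = 
      dif M (tw_single C X) (tw_single C Y) l (tw_single_mor f)"
    using P' m by (simp add: PreTr_dif_eq PreTr_graded_mat M.cmp_zero_left M.cmp_zero_right)
  ultimately show ?thesis by (simp add: graded_mat_simps)
qed

lemma tw_single_idn:
  assumes z: "zero_ob C z" and X: "X \<in> Ob C"
  shows "idn D (tw_single C X) = tw_single_mor (idn C X)"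
proof -
  interpret D: dg_category "PreTr C" by (rule dg_category_PreTr)
  show ?thesis
    using tw_single_entry[OF z X X D.idn_Mor[OF tw_single_Ob[OF z X]]] by (simp add: PreTr_simps(5))
qed

text \<open>The inclusion of \<open>P a\<close> has degree \<open>a\<close>, as has the entry from
  index \<open>a\<close> to index 0 in a matrix of degree 0. The sum is built by adding one summand
  at a time, starting from a zero object.\<close>

lemma finite_direct_sum:
  assumes z: "zero_ob C z"
    and one: "has_shifted_sums C"
    and "finite A" and P: "\<And>a. P a \<in> Ob C"
  shows "\<exists>S \<iota> \<pi>. S \<in> Ob C \<and> (\<forall>a\<in>A. \<iota> a \<in> Mor C (P a) S a \<and> \<pi> a \<in> Mor C S (P a) (- a) \<and>
      dif C (P a) S a (\<iota> a) = 0 \<and> dif C S (P a) (- a) (\<pi> a) = 0) \<and>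
      (\<forall>a\<in>A. cmp C (P a) S (P a) (- a) a (\<pi> a) (\<iota> a) = idn C (P a)) \<and>
      (\<forall>a\<in>A. \<forall>b\<in>A. a \<noteq> b \<longrightarrow> cmp C (P a) S (P b) (- b) a (\<pi> b) (\<iota> a) = 0) \<and>
      (\<Sum>a\<in>A. cmp C S (P a) S a (- a) (\<iota> a) (\<pi> a)) = idn C S"
  using \<open>finite A\<close>
proof induction
  case empty
  show ?case using z by (auto simp: zero_ob_def)
next
  case (insert c A)
  then obtain S \<iota> \<pi> where S: "S \<in> Ob C"
    and m: "\<And>a. a \<in> A \<Longrightarrow> \<iota> a \<in> Mor C (P a) S a" "\<And>a. a \<in> A \<Longrightarrow> \<pi> a \<in> Mor C S (P a) (- a)"
    and d: "\<And>a. a \<in> A \<Longrightarrow> dif C (P a) S a (\<iota> a) = 0" "\<And>a. a \<in> A \<Longrightarrow> dif C S (P a) (- a) (\<pi> a) = 0"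
    and c1: "\<And>a. a \<in> A \<Longrightarrow> cmp C (P a) S (P a) (- a) a (\<pi> a) (\<iota> a) = idn C (P a)"
    and c2: "\<And>a b. a \<in> A \<Longrightarrow> b \<in> A \<Longrightarrow> a \<noteq> b \<Longrightarrow> cmp C (P a) S (P b) (- b) a (\<pi> b) (\<iota> a) = 0"
    and c3: "(\<Sum>a\<in>A. cmp C S (P a) S a (- a) (\<iota> a) (\<pi> a)) = idn C S"
    by blast
  obtain Z i j r p where Z: "Z \<in> Ob C" "i \<in> Mor C S Z 0" "j \<in> Mor C (P c) Z c"
      "r \<in> Mor C Z S 0" "p \<in> Mor C Z (P c) (- c)" "dif C S Z 0 i = 0" "dif C (P c) Z c j = 0" "dif C Z S 0 r = 0"
      "dif C Z (P c) (- c) p = 0" "cmp C S Z S 0 0 r i = idn C S" "cmp C (P c) Z (P c) (- c) c p j = idn C (P c)"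
      "cmp C S Z (P c) (- c) 0 p i = 0" "cmp C (P c) Z S 0 c r j = 0"
      "cmp C Z S Z 0 0 i r + cmp C Z (P c) Z c (- c) j p = idn C Z"
    using one[unfolded has_shifted_sums_def, rule_format, OF P S, of c c] by blast
  define \<iota>' where "\<iota>' a = (if a = c then j else cmp C (P a) S Z 0 a i (\<iota> a))" for a
  define \<pi>' where "\<pi>' a = (if a = c then p else cmp C Z S (P a) (- a) 0 (\<pi> a) r)" for a
  have ne: "a \<noteq> c" if "a \<in> A" for a using that insert.hyps by blast
  \<comment> \<open>The old structure maps are composed with \<open>i\<close> and \<open>r\<close>,
    which cancel by \<open>r i = 1\<close>, so relations among old summands persist.\<close>
  have cross: "cmp C (P a) Z (P b) (- b) a (\<pi>' b) (\<iota>' a) = cmp C (P a) S (P b) (- b) a (\<pi> b) (\<iota> a)"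
    if "a \<in> A" "b \<in> A" for a b
  proof -
    have "cmp C (P a) Z (P b) (- b) a (\<pi>' b) (\<iota>' a) =
      cmp C (P a) S (P b) (- b) a (\<pi> b) (cmp C (P a) Z S 0 a r (cmp C (P a) S Z 0 a i (\<iota> a)))"
      using that m P S Z by (simp add: \<iota>'_def \<pi>'_def ne Mor_rules cmp_assoc_deg)
    also have "cmp C (P a) Z S 0 a r (cmp C (P a) S Z 0 a i (\<iota> a)) = \<iota> a"
      by (rule cmp_cancel) (use that m P S Z in auto)
    finally show ?thesis .
  qed
  have c4: "cmp C (P a) Z (P c) (- c) a p (\<iota>' a) = 0" if "a \<in> A" for a
  proof -
    have "cmp C (P a) Z (P c) (- c) a p (cmp C (P a) S Z 0 a i (\<iota> a)) = 0"
      by (rule cmp_cancel_zero) (use that m P S Z in auto)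
    then show ?thesis using that by (simp add: \<iota>'_def ne)
  qed
  have c5: "cmp C (P c) Z (P b) (- b) c (\<pi>' b) j = 0" if "b \<in> A" for b
    using that m P S Z by (simp add: \<pi>'_def ne cmp_assoc_deg cmp_linear)
  have summand: "cmp C Z (P a) Z a (- a) (\<iota>' a) (\<pi>' a) = cmp C Z S Z 0 0 i (cmp C Z S S 0 0 (cmp C S (P a) S a (- a) (\<iota> a) (\<pi> a)) r)"
    if "a \<in> A" for a
    using that m P S Z by (simp add: \<iota>'_def \<pi>'_def ne Mor_rules cmp_assoc_deg)
  have "(\<Sum>a\<in>A. cmp C Z (P a) Z a (- a) (\<iota>' a) (\<pi>' a)) =
      cmp C Z S Z 0 0 i (cmp C Z S S 0 0 (\<Sum>a\<in>A. cmp C S (P a) S a (- a) (\<iota> a) (\<pi> a)) r)"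
  proof -
    have "cmp C Z S Z 0 0 i (cmp C Z S S 0 0 (\<Sum>a\<in>A. cmp C S (P a) S a (- a) (\<iota> a) (\<pi> a)) r) =
        cmp C Z S Z 0 0 i (\<Sum>a\<in>A. cmp C Z S S 0 0 (cmp C S (P a) S a (- a) (\<iota> a) (\<pi> a)) r)"
      by (subst cmp_sum_left) (use m P S Z in \<open>auto simp: Mor_rules\<close>)
    also have "\<dots> = (\<Sum>a\<in>A. cmp C Z S Z 0 0 i (cmp C Z S S 0 0 (cmp C S (P a) S a (- a) (\<iota> a) (\<pi> a)) r))"
      by (rule cmp_sum_right) (use m P S Z in \<open>auto simp: Mor_rules\<close>)
    finally show ?thesis by (simp add: summand)
  qed
  also have "\<dots> = cmp C Z S Z 0 0 i r" using S Z by (simp add: c3 cmp_idn_left)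
  finally have total: "(\<Sum>a\<in>insert c A. cmp C Z (P a) Z a (- a) (\<iota>' a) (\<pi>' a)) = idn C Z"
    using insert.hyps Z by (simp add: \<iota>'_def \<pi>'_def add.commute)
  have d': "dif C (P a) Z a (\<iota>' a) = 0" "dif C Z (P a) (- a) (\<pi>' a) = 0" if "a \<in> A" for a
    using that m d P S Z by (simp_all add: \<iota>'_def \<pi>'_def ne leibniz_deg cmp_linear)
  show ?case
  proof (rule exI[of _ Z], rule exI[of _ \<iota>'], rule exI[of _ \<pi>'], intro conjI ballI impI)
    fix a assume a: "a \<in> insert c A"
    show "\<iota>' a \<in> Mor C (P a) Z a" "\<pi>' a \<in> Mor C Z (P a) (- a)"
      using a m P S Z by (auto simp: \<iota>'_def \<pi>'_def Mor_rules)
    show "dif C (P a) Z a (\<iota>' a) = 0" "dif C Z (P a) (- a) (\<pi>' a) = 0"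
      using a d'[of a] Z by (cases "a = c"; simp add: \<iota>'_def \<pi>'_def)+
    show "cmp C (P a) Z (P a) (- a) a (\<pi>' a) (\<iota>' a) = idn C (P a)"
      using a cross[of a a] c1 Z by (cases "a = c") (auto simp: \<iota>'_def \<pi>'_def)
    fix b assume b: "b \<in> insert c A" and ab: "a \<noteq> b"
    show "cmp C (P a) Z (P b) (- b) a (\<pi>' b) (\<iota>' a) = 0"
    proof (cases "a = c")
      case True
      then show ?thesis using b ab c5[of b] by (simp add: \<iota>'_def)
    next
      case a': False
      show ?thesis
      proof (cases "b = c")
        case True
        then show ?thesis using a a' c4[of a] by (simp add: \<pi>'_def)
      next
        case False
        then show ?thesis using a a' b ab cross[of a b] c2[of a b] by simp
      qed
    qed
  qed (use total Z in auto)
qed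

text \<open>The isomorphism \<open>u = g I e\<close> forgets the twist of \<open>X\<close>, sums the
  terms, and twists the sum. Neither \<open>e\<close> nor \<open>g\<close> is closed:
  \<open>de = - q e\<close> and \<open>dg = g h\<close>. The relation \<open>h I = I q\<close> makes
  the defects cancel; dually \<open>Q h = q Q\<close> serves the inverse.\<close>

lemma convolution_exists:
  assumes z: "zero_ob C z"
    and one: "has_shifted_sums C"
    and twist: "has_twists C"
    and X: "X \<in> Ob D"
  shows "\<exists>Z u u'. Z \<in> Ob C \<and> u \<in> closed_mor D X (tw_single C Z) \<and> u' \<in> closed_mor D (tw_single C Z) X \<and>
     cmp D X (tw_single C Z) X 0 0 u' u = idn D X \<and>
     cmp D (tw_single C Z) X (tw_single C Z) 0 0 u u' = idn D (tw_single C Z)"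
proof -
  interpret D: dg_category "PreTr C" by (rule dg_category_PreTr)
  interpret M: dg_category "graded_mat C" by (rule dg_category_graded_mat)
  let ?D = "PreTr C"
  let ?A = "tw_supp C X"
  define X0 where "X0 = (fst X, 0 :: int \<Rightarrow> int \<Rightarrow> 'm)"
  have X0: "X0 \<in> Ob ?D" using PreTr_Ob_zero_twist[OF PreTr_Ob_graded_mat[OF X]] by (simp add: X0_def)
  have f0: "fst X0 = fst X" "snd X0 = 0" by (simp_all add: X0_def)
  have P: "fst X a \<in> Ob C" for a using X by (rule PreTr_fst)
  obtain S \<iota> \<pi> where S: "S \<in> Ob C"
    and m: "\<And>a. a \<in> ?A \<Longrightarrow> \<iota> a \<in> Mor C (fst X a) S a" "\<And>a. a \<in> ?A \<Longrightarrow> \<pi> a \<in> Mor C S (fst X a) (- a)"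
    and d: "\<And>a. a \<in> ?A \<Longrightarrow> dif C (fst X a) S a (\<iota> a) = 0" "\<And>a. a \<in> ?A \<Longrightarrow> dif C S (fst X a) (- a) (\<pi> a) = 0"
    and c1: "\<And>a. a \<in> ?A \<Longrightarrow> cmp C (fst X a) S (fst X a) (- a) a (\<pi> a) (\<iota> a) = idn C (fst X a)"
    and c2: "\<And>a b. a \<in> ?A \<Longrightarrow> b \<in> ?A \<Longrightarrow> a \<noteq> b \<Longrightarrow> cmp C (fst X a) S (fst X b) (- b) a (\<pi> b) (\<iota> a) = 0"
    and c3: "(\<Sum>a\<in>?A. cmp C S (fst X a) S a (- a) (\<iota> a) (\<pi> a)) = idn C S"
    using finite_direct_sum[where P = "fst X", OF z one PreTr_finite[OF X] P] by blast
  let ?s = "tw_single C"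
  have sS: "?s S \<in> Ob ?D" by (rule tw_single_Ob[OF z S])
  have sO: "fst (?s S) i \<in> Ob C" for i by (rule PreTr_fst[OF sS])
  define I where "I = (\<lambda>a j. if j = (0::int) \<and> a \<in> ?A then \<iota> a else 0)"
  define Q where "Q = (\<lambda>i a. if i = (0::int) \<and> a \<in> ?A then \<pi> a else 0)"
  have IM: "I \<in> Mor ?D X0 (?s S) 0" and QM: "Q \<in> Mor ?D (?s S) X0 0"
    using m P S sO by (auto simp: PreTr_simps pretr_Mor_def I_def Q_def f0 zero_Mor)
  have Id: "dif ?D X0 (?s S) 0 I = 0" and Qd: "dif ?D (?s S) X0 0 Q = 0"
    using IM QM X0 sS d P S sO
    by (auto simp: PreTr_dif_eq f0 PreTr_graded_mat M.cmp_zero_left M.cmp_zero_right PreTr_Ob_graded_mat)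
      (auto simp: graded_mat_simps fun_eq_iff I_def Q_def f0 dif_zero)
  have QI: "cmp ?D X0 (?s S) X0 0 0 Q I = idn ?D X0"
  proof (intro ext)
    fix a b
    have "cmp ?D X0 (?s S) X0 0 0 Q I a b = cmp C (fst X a) S (fst X b) (- b) a (Q 0 b) (I a 0)"
      unfolding PreTr_simps
      by (subst PreTr_cmp_single[where p = 0]) (use X0 sS IM QM in \<open>auto simp: I_def PreTr_simps f0\<close>)
    also have "\<dots> = idn ?D X0 a b"
    proof (cases "a \<in> ?A \<and> b \<in> ?A")
      case True
      then show ?thesis using c1 c2 by (auto simp: I_def Q_def PreTr_simps f0)
    next
      \<comment> \<open>Outside the support the term is a zero object, so its identity entry
        vanishes as well.\<close>
      case False
      have "cmp C (fst X a) S (fst X b) (- b) a (Q 0 b) (I a 0) = 0"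
        using False m[of a] m[of b] P S by (auto simp: I_def Q_def cmp_zero_left cmp_zero_right zero_Mor)
      moreover have "a = b \<Longrightarrow> idn C (fst X a) = 0" using False by (auto simp: tw_supp_def zero_ob_def)
      ultimately show ?thesis by (auto simp: PreTr_simps f0)
    qed
    finally show "cmp ?D X0 (?s S) X0 0 0 Q I a b = idn ?D X0 a b" .
  qed
  have IQ: "cmp ?D (?s S) X0 (?s S) 0 0 I Q = idn ?D (?s S)"
  proof -
    have "cmp ?D (?s S) X0 (?s S) 0 0 I Q \<in> Mor ?D (?s S) (?s S) 0"
      using X0 sS IM QM by (simp add: D.cmp_Mor_deg)
    note tw_single_entry[OF z S S this]
    moreover have "cmp ?D (?s S) X0 (?s S) 0 0 I Q 0 0 = (\<Sum>a\<in>?A. cmp C S (fst X a) S a (- a) (\<iota> a) (\<pi> a))"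
      unfolding PreTr_simps pretr_cmp_def tw_supp_cong[of X0 X, OF f0(1)]
      by (rule sum.cong) (auto simp: I_def Q_def f0)
    ultimately show ?thesis by (simp add: c3 tw_single_idn[OF z S])
  qed
  let ?q = "snd X"
  have qM: "?q \<in> Mor ?D X0 X0 1"
    using X by (simp add: PreTr_Ob_iff PreTr_graded_mat graded_mat_simps pretr_Mor_def f0)
  \<comment> \<open>Relative to the zero twist of \<open>X0\<close>, the condition of
    \<open>PreTr_twist\<close> for \<open>q\<close> is the Maurer-Cartan equation of
    \<open>X\<close>.\<close>
  have q0: "dif ?D X0 X0 1 ?q = cmp ?D X0 X0 X0 1 1 ?q ?q"
  proof -
    have "dif ?D X0 X0 1 ?q = dif M X0 X0 1 ?q"
      using qM X0 by (simp add: PreTr_dif_eq f0 PreTr_graded_mat M.cmp_zero_left M.cmp_zero_right PreTr_Ob_graded_mat)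
    also have "\<dots> = dif M X X 1 ?q" by (simp add: graded_mat_simps f0)
    also have "\<dots> = cmp ?D X0 X0 X0 1 1 ?q ?q"
      using X pretr_cmp_cong[OF f0(1) f0(1) f0(1)] by (simp add: PreTr_Ob_iff PreTr_graded_mat graded_mat_simps(4))
    finally show ?thesis .
  qed
  have X_eq: "(fst X0, snd X0 + ?q) = X" by (simp add: f0 prod_eq_iff)
  define e where "e = idn ?D X0"
  note tX = PreTr_twist[OF X0 qM q0, folded e_def, unfolded X_eq]
  have ee: "cmp ?D X0 X X0 0 0 e e = idn ?D X0" using tX(4) by (simp add: e_def)
  \<comment> \<open>The twist of \<open>X\<close> transported to the sum. As an endomorphism of a
    single it amounts to one element \<open>x\<close> of degree 1 in \<open>C\<close>.\<close>
  define h where "h = cmp ?D (?s S) X0 (?s S) 0 1 I (cmp ?D (?s S) X0 X0 1 0 ?q Q)"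
  have hM: "h \<in> Mor ?D (?s S) (?s S) 1" unfolding h_def using X0 sS IM QM qM by (simp add: D.cmp_Mor_deg)
  define x where "x = h 0 0"
  have hx: "h = tw_single_mor x" unfolding x_def by (rule tw_single_entry[OF z S S hM])
  have xM: "x \<in> Mor C S S 1" unfolding x_def by (rule tw_single_entry_Mor[OF hM])
  have hI: "cmp ?D X0 (?s S) (?s S) 1 0 h I = cmp ?D X0 X0 (?s S) 0 1 I ?q"
    unfolding h_def using X0 sS IM QM qM by (simp add: D.cmp_Mor_deg D.cmp_assoc_deg QI D.cmp_idn_right)
  have Qh: "cmp ?D (?s S) (?s S) X0 0 1 Q h = cmp ?D (?s S) X0 X0 1 0 ?q Q"
    unfolding h_def by (rule D.cmp_cancel) (use X0 sS IM QM qM QI in \<open>simp_all add: D.cmp_Mor_deg\<close>)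
  \<comment> \<open>Since \<open>I\<close> and \<open>Q\<close> are closed,
    \<open>dh = I q q Q\<close>, and \<open>q Q = Q h\<close> turns this into
    \<open>I q Q h = h h\<close>.\<close>
  have "dif ?D (?s S) (?s S) 1 h = cmp ?D (?s S) X0 (?s S) 0 2 I (cmp ?D (?s S) X0 X0 2 0 (cmp ?D X0 X0 X0 1 1 ?q ?q) Q)"
    unfolding h_def using X0 sS IM QM qM Id Qd q0 by (simp add: D.Mor_rules D.leibniz_deg D.cmp_linear)
  also have "\<dots> = cmp ?D (?s S) X0 (?s S) 0 2 I (cmp ?D (?s S) X0 X0 1 1 ?q (cmp ?D (?s S) (?s S) X0 0 1 Q h))"
    unfolding Qh using X0 sS IM QM qM by (simp add: D.cmp_Mor_deg D.cmp_assoc_deg)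
  also have "\<dots> = cmp ?D (?s S) (?s S) (?s S) 1 1 h h"
    using X0 sS IM QM qM hM by (subst (2) h_def) (simp add: D.cmp_Mor_deg D.cmp_assoc_deg)
  finally have "tw_single_mor (dif C S S 1 x) = tw_single_mor (cmp C S S S 1 1 x x)"
    unfolding hx tw_single_dif[OF z S S xM] tw_single_cmp[OF z S S S xM xM] .
  from this[THEN fun_cong, THEN fun_cong, of 0 0] have "dif C S S 1 x = cmp C S S S 1 1 x x" by simp
  from twist[unfolded has_twists_def, rule_format, OF S xM this] obtain T t t' where T: "T \<in> Ob C" and t: "t \<in> Mor C S T 0" "t' \<in> Mor C T S 0"
    and tt: "cmp C S T S 0 0 t' t = idn C S" "cmp C T S T 0 0 t t' = idn C T"
    and td: "dif C S T 0 t = cmp C S S T 0 1 t x" "dif C T S 0 t' = - cmp C T S S 1 0 x t'"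
    by blast
  have sT: "?s T \<in> Ob ?D" by (rule tw_single_Ob[OF z T])
  define g where "g = tw_single_mor t"
  define g' where "g' = tw_single_mor t'"
  have sm: "tw_single_mor (- f) = - tw_single_mor f" for f :: 'm
    by (simp add: tw_single_mor_def fun_eq_iff)
  have gM: "g \<in> Mor ?D (?s S) (?s T) 0" "g' \<in> Mor ?D (?s T) (?s S) 0"
    unfolding g_def g'_def using t S T by (simp_all add: tw_single_mor_Mor[OF z])
  have gg: "cmp ?D (?s S) (?s T) (?s S) 0 0 g' g = idn ?D (?s S)" "cmp ?D (?s T) (?s S) (?s T) 0 0 g g' = idn ?D (?s T)"
    unfolding g_def g'_def using t S T tt by (simp_all add: tw_single_cmp[OF z] tw_single_idn[OF z])
  have gd: "dif ?D (?s S) (?s T) 0 g = cmp ?D (?s S) (?s S) (?s T) 0 1 g h"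
    "dif ?D (?s T) (?s S) 0 g' = - cmp ?D (?s T) (?s S) (?s S) 1 0 h g'"
    unfolding g_def g'_def hx using t S T td xM by (simp_all add: tw_single_cmp[OF z] tw_single_dif[OF z] sm)
  define u where "u = cmp ?D X (?s S) (?s T) 0 0 g (cmp ?D X X0 (?s S) 0 0 I e)"
  define u' where "u' = cmp ?D (?s T) X0 X 0 0 e (cmp ?D (?s T) (?s S) X0 0 0 Q g')"
  note all = X X0 sS sT IM QM qM hM tX(2,3) gM
  have uM: "u \<in> Mor ?D X (?s T) 0" "u' \<in> Mor ?D (?s T) X 0"
    unfolding u_def u'_def using all by (simp_all add: D.cmp_Mor_deg)
  have "dif ?D X (?s T) 0 u = 0"
  proof -
    have "dif ?D X (?s T) 0 u = cmp ?D X (?s S) (?s T) 0 1 g (- cmp ?D X X0 (?s S) 0 1 I (cmp ?D X X0 X0 1 0 ?q e))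
      + cmp ?D X (?s S) (?s T) 0 1 g (cmp ?D X X0 (?s S) 1 0 (cmp ?D X0 (?s S) (?s S) 1 0 h I) e)"
      unfolding u_def using all tX(7) Id gd
      by (simp add: D.Mor_rules D.leibniz_deg D.cmp_linear D.cmp_assoc_deg)
    then show ?thesis
      unfolding hI using all by (simp add: D.Mor_rules D.cmp_linear D.cmp_assoc_deg)
  qed
  moreover have "dif ?D (?s T) X 0 u' = 0"
  proof -
    have "dif ?D (?s T) X 0 u' = cmp ?D (?s T) X0 X 0 1 e (- cmp ?D (?s T) (?s S) X0 1 0 (cmp ?D (?s S) (?s S) X0 0 1 Q h) g')
      + cmp ?D (?s T) X0 X 0 1 e (cmp ?D (?s T) X0 X0 1 0 ?q (cmp ?D (?s T) (?s S) X0 0 0 Q g'))"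
      unfolding u'_def using all tX(6) Qd gd
      by (simp add: D.Mor_rules D.leibniz_deg D.cmp_linear D.cmp_assoc_deg)
    then show ?thesis
      unfolding Qh using all by (simp add: D.Mor_rules D.cmp_linear D.cmp_assoc_deg)
  qed
  moreover have "cmp ?D X (?s T) X 0 0 u' u = idn ?D X"
    unfolding u_def u'_def using all QI gg tX(5)
    by (simp add: D.cmp_Mor_deg D.cmp_assoc_deg D.cmp_cancel[where X = "?s S" and Y = "?s T"]
        D.cmp_cancel[where X = X0 and Y = "?s S"])
  moreover have "cmp ?D (?s T) X (?s T) 0 0 u u' = idn ?D (?s T)"
    unfolding u_def u'_def using all IQ gg ee
    by (simp add: D.cmp_Mor_deg D.cmp_assoc_deg D.cmp_cancel[where X = X0 and Y = X]
        D.cmp_cancel[where X = "?s S" and Y = X0])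
  ultimately show ?thesis
    using T uM by (auto simp: closed_mor_def)
qed

end

section \<open>Closed isomorphisms of arbitrary degree\<close>

definition graded_iso :: "('o, 'm::ab_group_add) dgcat \<Rightarrow> 'o \<Rightarrow> 'o \<Rightarrow> int \<Rightarrow> 'm \<Rightarrow> 'm \<Rightarrow> bool" where
  "graded_iso C X Y d s t \<longleftrightarrow> X \<in> Ob C \<and> Y \<in> Ob C \<and> s \<in> Mor C X Y d \<and> t \<in> Mor C Y X (- d) \<and>
     dif C X Y d s = 0 \<and> dif C Y X (- d) t = 0 \<and>
     cmp C X Y X (- d) d t s = idn C X \<and> cmp C Y X Y d (- d) s t = idn C Y"

text \<open>The conjugate \<open>s f t\<close>, where \<open>s\<close> belongs to the targets and
  \<open>t\<close> is the inverse for the sources. No sign is built in, so differentials are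
  respected only up to \<open>(-1)^d\<close>.\<close>

definition graded_conj :: "('o, 'm::ab_group_add) dgcat \<Rightarrow> 'o \<Rightarrow> 'o \<Rightarrow> 'o \<Rightarrow> 'o \<Rightarrow> int \<Rightarrow> 'm \<Rightarrow> 'm \<Rightarrow> int \<Rightarrow> 'm \<Rightarrow> 'm" where
  "graded_conj C X X' Y Y' d s t l f = cmp C X' Y Y' d (l - d) s (cmp C X' X Y l (- d) f t)"

lemma graded_iso_sym: "graded_iso C X Y d s t \<Longrightarrow> graded_iso C Y X (- d) t s"
  by (simp add: graded_iso_def)

context dg_category
begin

lemma graded_iso_comp:
  assumes f: "graded_iso C X Y d s t" and g: "graded_iso C Y Z e s' t'"
  shows "graded_iso C X Z (e + d) (cmp C X Y Z e d s' s) (cmp C Z Y X (- d) (- e) t t')"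
proof -
  note U = f[unfolded graded_iso_def] g[unfolded graded_iso_def]
  have "cmp C X Z X (- e - d) (e + d) (cmp C Z Y X (- d) (- e) t t') (cmp C X Y Z e d s' s) = idn C X"
    using U by (simp add: Mor_rules cmp_assoc_deg cmp_cancel[where X = Y and Y = Z])
  moreover have "cmp C Z X Z (e + d) (- e - d) (cmp C X Y Z e d s' s) (cmp C Z Y X (- d) (- e) t t') = idn C Z"
    using U by (simp add: Mor_rules cmp_assoc_deg cmp_cancel[where X = Y and Y = X])
  ultimately show ?thesis
    unfolding graded_iso_def using U by (simp add: Mor_rules leibniz_deg cmp_linear)
qed

lemma graded_iso_h_inverse: "graded_iso C X Y 0 s t \<Longrightarrow> h_inverse C X Y s t"
  by (simp add: graded_iso_def h_inverse_def closed_mor_def)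

lemma graded_conj_Mor:
  assumes "graded_iso C X X' d s t" "graded_iso C Y Y' d s' t'" "f \<in> Mor C X Y l"
  shows "graded_conj C X X' Y Y' d s' t l f \<in> Mor C X' Y' l"
  using assms by (simp add: graded_conj_def graded_iso_def cmp_Mor_deg)

text \<open>In the Leibniz rule used here a sign appears when the left factor is differentiated past
  \<open>t\<close>, which has degree \<open>- d\<close>; the outer factor \<open>s\<close> causes
  none.\<close>

lemma graded_conj_dif:
  assumes "graded_iso C X X' d s t" "graded_iso C Y Y' d s' t'" "f \<in> Mor C X Y l" "n = l + 1"
  shows "dif C X' Y' l (graded_conj C X X' Y Y' d s' t l f) = sgn_pow d (graded_conj C X X' Y Y' d s' t n (dif C X Y l f))"
proof -
  note U = assms(1,2)[unfolded graded_iso_def] assms(3)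
  have ix: "l - d + 1 = l + 1 - d" by simp
  have "sgn_pow (- d) a = sgn_pow d a" for a :: 'm by (simp add: sgn_pow_def)
  then show ?thesis
    unfolding graded_conj_def \<open>n = l + 1\<close> using U by (simp add: Mor_rules leibniz_deg cmp_linear ix)
qed

lemma graded_conj_cmp:
  assumes "graded_iso C X X' d s t" "graded_iso C Y Y' d s' t'" "graded_iso C Z Z' d s'' t''"
    "f \<in> Mor C Y Z k" "g \<in> Mor C X Y l" "n = k + l"
  shows "cmp C X' Y' Z' k l (graded_conj C Y Y' Z Z' d s'' t' k f) (graded_conj C X X' Y Y' d s' t l g) =
    graded_conj C X X' Z Z' d s'' t n (cmp C X Y Z k l f g)"
proof -
  note U = assms(1-3)[unfolded graded_iso_def] assms(4,5)
  have ix: "k - d + l = k + l - d" by simp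
  show ?thesis
    unfolding graded_conj_def \<open>n = k + l\<close> using U
    by (simp add: Mor_rules cmp_assoc_deg cmp_cancel[where X = Y and Y = Y'] ix)
qed

lemma graded_conj_idn:
  assumes "graded_iso C X X' d s t"
  shows "graded_conj C X X' X X' d s t 0 (idn C X) = idn C X'"
  using assms by (simp add: graded_conj_def graded_iso_def cmp_idn_left)

lemma graded_conj_add:
  assumes "graded_iso C X X' d s t" "graded_iso C Y Y' d s' t'" "f \<in> Mor C X Y l" "g \<in> Mor C X Y l"
  shows "graded_conj C X X' Y Y' d s' t l (f + g) = graded_conj C X X' Y Y' d s' t l f + graded_conj C X X' Y Y' d s' t l g"
  using assms by (simp add: graded_conj_def graded_iso_def cmp_linear cmp_Mor_deg)

lemma graded_conj_sgn:
  assumes "graded_iso C X X' d s t" "graded_iso C Y Y' d s' t'" "f \<in> Mor C X Y l"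
  shows "graded_conj C X X' Y Y' d s' t l (sgn_pow n f) = sgn_pow n (graded_conj C X X' Y Y' d s' t l f)"
  using assms by (simp add: graded_conj_def graded_iso_def cmp_linear cmp_Mor_deg)

lemma graded_conj_inverse:
  assumes "graded_iso C X X' d s t" "graded_iso C Y Y' d s' t'" "f \<in> Mor C X' Y' l"
  shows "graded_conj C X X' Y Y' d s' t l (graded_conj C X' X Y' Y (- d) t' s l f) = f"
proof -
  note U = assms(1,2)[unfolded graded_iso_def] assms(3)
  show ?thesis
    unfolding graded_conj_def using U
    by (simp add: Mor_rules cmp_assoc_deg cmp_cancel[where X = Y' and Y = Y] cmp_idn_right)
qed

end

section \<open>The convolution functor\<close>

lemma zero_ob_full: "S \<subseteq> Ob C \<Longrightarrow> zero_ob (dg_full C S) Z \<longleftrightarrow> Z \<in> S \<and> zero_ob C Z"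
  by (auto simp: zero_ob_def)

text \<open>Being zero is a property of the identity and is not affected by the ambient category.
  Hence the sums defining \<open>PreTr\<close> run over the same indices in a full
  subcategory.\<close>

lemma tw_supp_full: "S \<subseteq> Ob C \<Longrightarrow> \<forall>i. fst X i \<in> S \<Longrightarrow> tw_supp (dg_full C S) X = tw_supp C X"
  by (simp add: tw_supp_def zero_ob_full)

lemma PreTr_full_Ob:
  assumes "S \<subseteq> Ob C"
  shows "X \<in> Ob (PreTr (dg_full C S)) \<longleftrightarrow> X \<in> Ob (PreTr C) \<and> (\<forall>i. fst X i \<in> S)"
proof (cases "\<forall>i. fst X i \<in> S")
  case True
  then show ?thesis
    using assms tw_supp_full[OF assms True] by (cases X) (auto simp: PreTr_simps pretr_Ob_def)
next
  case False
  then show ?thesis by (cases X) (auto simp: PreTr_simps pretr_Ob_def)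
qed

lemma PreTr_full_Mor: "Mor (PreTr (dg_full C S)) = Mor (PreTr C)"
  by (simp add: PreTr_simps pretr_Mor_def fun_eq_iff)

lemma PreTr_full_idn: "idn (PreTr (dg_full C S)) = idn (PreTr C)"
  by (simp add: PreTr_simps fun_eq_iff)

lemma PreTr_full_dif:
  assumes "S \<subseteq> Ob C" "\<forall>i. fst X i \<in> S" "\<forall>i. fst Y i \<in> S"
  shows "dif (PreTr (dg_full C S)) X Y = dif (PreTr C) X Y"
  using assms by (simp add: PreTr_simps pretr_dif_def fun_eq_iff tw_supp_full)

lemma PreTr_full_cmp:
  assumes "S \<subseteq> Ob C" "\<forall>i. fst Y i \<in> S"
  shows "cmp (PreTr (dg_full C S)) X Y Z = cmp (PreTr C) X Y Z"
  using assms by (simp add: PreTr_simps pretr_cmp_def fun_eq_iff tw_supp_full)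

lemma dg_functor_full:
  assumes S: "S \<subseteq> Ob C" and F: "dg_functor (PreTr C) D F Fm"
  shows "dg_functor (PreTr (dg_full C S)) D F Fm"
  using F unfolding dg_functor_def
  by (auto simp: PreTr_full_Ob[OF S] PreTr_full_Mor PreTr_full_idn PreTr_full_dif[OF S] PreTr_full_cmp[OF S])

text \<open>Unlike \<open>tw_single\<close>, this allows any zero objects away from index 0, so it
  also covers singles padded by the choice made for a full subcategory.\<close>

definition concentrated :: "('o, 'm::ab_group_add) dgcat \<Rightarrow> ('o, 'm) tw \<Rightarrow> bool" where
  "concentrated C X \<longleftrightarrow> (\<forall>i. i \<noteq> 0 \<longrightarrow> zero_ob C (fst X i)) \<and> snd X = 0"

context dg_category
begin

lemma PreTr_has_twists: "has_twists D"
  unfolding has_twists_def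
proof (intro ballI impI)
  fix S x assume *: "S \<in> Ob D" "x \<in> Mor D S S 1"
    "dif D S S 1 x = cmp D S S S 1 1 x x"
  show "\<exists>T e e'. T \<in> Ob D \<and> e \<in> Mor D S T 0 \<and> e' \<in> Mor D T S 0 \<and>
       cmp D S T S 0 0 e' e = idn D S \<and> cmp D T S T 0 0 e e' = idn D T \<and>
       dif D S T 0 e = cmp D S S T 0 1 e x \<and> dif D T S 0 e' = - cmp D T S S 1 0 x e'"
    using PreTr_twist[OF *] by blast
qed

text \<open>The cone of a zero morphism is a direct sum, and it shifts its source once. Starting
  from \<open>P\<close> shifted by \<open>- n - 1\<close> the first summand is \<open>P\<close>
  shifted by \<open>- n\<close>, identified with \<open>P\<close> by shift maps of degree
  \<open>n\<close> and \<open>- n\<close>.\<close>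

lemma PreTr_has_shifted_sums:
  assumes add: "dg_additive C"
  shows "has_shifted_sums D"
  unfolding has_shifted_sums_def
proof (intro ballI allI)
  fix P Y n assume P: "P \<in> Ob D" and Y: "Y \<in> Ob D"
  interpret D: dg_category "PreTr C" by (rule dg_category_PreTr)
  let ?D = "PreTr C"
  define X where "X = tw_shift_by (- n - 1) P"
  define A where "A = tw_shift_by (- n) P"
  have X: "X \<in> Ob ?D" and A: "A \<in> Ob ?D" unfolding X_def A_def by (simp_all add: tw_shift_by_Ob P)
  have XA: "sh X = A" by (simp add: X_def A_def tw_shift_by_add)
  obtain Z \<iota>1 \<iota>2 \<pi>1 \<pi>2 where "tw_cone C X Y 0 Z \<iota>1 \<iota>2 \<pi>1 \<pi>2"
    using tw_cone_exists[OF add X Y D.closed_zero[OF X Y]] by blast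
  from tw_cone_dg_ext[OF this]
  have E: "dg_ext ?D A Y Z 0 (diag_mor \<iota>1) (diag_mor \<iota>2) (diag_mor \<pi>1) (diag_mor \<pi>2)"
    using X A Y shift_in_Mor[OF X, of 1] by (simp add: XA D.cmp_zero_left)
  define s where "s = shift_out C (- n) P"
  define t where "t = shift_in C (- n) P"
  have st: "s \<in> Mor ?D P A n" "t \<in> Mor ?D A P (- n)" "dif ?D P A n s = 0" "dif ?D A P (- n) t = 0"
    "cmp ?D P A P (- n) n t s = idn ?D P" "cmp ?D A P A n (- n) s t = idn ?D A"
    unfolding s_def t_def A_def using P
    by (simp_all add: shift_out_Mor shift_in_Mor dif_shift_out dif_shift_in shift_in_out shift_out_in)
  define j where "j = cmp ?D P A Z 0 n (diag_mor \<iota>1) s"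
  define p where "p = cmp ?D Z A P (- n) 0 t (diag_mor \<pi>1)"
  note U = E[unfolded dg_ext_def] D.dg_ext_dif_pi2[OF E] P Y A st
  have "j \<in> Mor ?D P Z n" "p \<in> Mor ?D Z P (- n)" "dif ?D P Z n j = 0" "dif ?D Z P (- n) p = 0"
    unfolding j_def p_def using U by (simp_all add: D.Mor_rules D.leibniz_deg D.cmp_linear)
  moreover have "cmp ?D P Z P (- n) n p j = idn ?D P"
    unfolding j_def p_def using U
    by (simp add: D.Mor_rules D.cmp_assoc_deg D.cmp_cancel[where X = A and Y = Z])
  moreover have "cmp ?D Y Z P (- n) 0 p (diag_mor \<iota>2) = 0"
    unfolding p_def using U by (simp add: D.Mor_rules D.cmp_assoc_deg D.cmp_linear)
  moreover have "cmp ?D P Z Y 0 n (diag_mor \<pi>2) j = 0"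
    unfolding j_def by (rule D.cmp_cancel_zero) (use U in auto)
  moreover have "cmp ?D Z P Z n (- n) j p = cmp ?D Z A Z 0 0 (diag_mor \<iota>1) (diag_mor \<pi>1)"
    unfolding j_def p_def using U
    by (simp add: D.Mor_rules D.cmp_assoc_deg D.cmp_cancel[where X = A and Y = P])
  moreover have "dif ?D Z Y 0 (diag_mor \<pi>2) = 0" using U by (simp add: D.cmp_zero_left)
  ultimately have "Z \<in> Ob ?D \<and> diag_mor \<iota>2 \<in> Mor ?D Y Z 0 \<and> j \<in> Mor ?D P Z n \<and> diag_mor \<pi>2 \<in> Mor ?D Z Y 0 \<and>
     p \<in> Mor ?D Z P (- n) \<and> dif ?D Y Z 0 (diag_mor \<iota>2) = 0 \<and> dif ?D P Z n j = 0 \<and>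
     dif ?D Z Y 0 (diag_mor \<pi>2) = 0 \<and> dif ?D Z P (- n) p = 0 \<and>
     cmp ?D Y Z Y 0 0 (diag_mor \<pi>2) (diag_mor \<iota>2) = idn ?D Y \<and> cmp ?D P Z P (- n) n p j = idn ?D P \<and>
     cmp ?D Y Z P (- n) 0 p (diag_mor \<iota>2) = 0 \<and> cmp ?D P Z Y 0 n (diag_mor \<pi>2) j = 0 \<and>
     cmp ?D Z Y Z 0 0 (diag_mor \<iota>2) (diag_mor \<pi>2) + cmp ?D Z P Z n (- n) j p = idn ?D Z"
    using U by (simp add: add.commute)
  then show "\<exists>Z i j r p. Z \<in> Ob ?D \<and> i \<in> Mor ?D Y Z 0 \<and> j \<in> Mor ?D P Z n \<and> r \<in> Mor ?D Z Y 0 \<and>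
     p \<in> Mor ?D Z P (- n) \<and> dif ?D Y Z 0 i = 0 \<and> dif ?D P Z n j = 0 \<and> dif ?D Z Y 0 r = 0 \<and>
     dif ?D Z P (- n) p = 0 \<and> cmp ?D Y Z Y 0 0 r i = idn ?D Y \<and> cmp ?D P Z P (- n) n p j = idn ?D P \<and>
     cmp ?D Y Z P (- n) 0 p i = 0 \<and> cmp ?D P Z Y 0 n r j = 0 \<and>
     cmp ?D Z Y Z 0 0 i r + cmp ?D Z P Z n (- n) j p = idn ?D Z"
    by (intro exI)
qed

text \<open>The padding consists of zero objects, so the identity at \<open>(0, 0)\<close> is
  already an isomorphism; the same matrix serves in both directions.\<close>

lemma concentrated_iso:
  assumes z: "zero_ob C z" and X: "X \<in> Ob D" and c: "concentrated C X"
  defines "u \<equiv> tw_single_mor (idn C (fst X 0))"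
  shows "u \<in> closed_mor D X (tw_single C (fst X 0))" "u \<in> closed_mor D (tw_single C (fst X 0)) X"
    "cmp D X (tw_single C (fst X 0)) X 0 0 u u = idn D X"
    "cmp D (tw_single C (fst X 0)) X (tw_single C (fst X 0)) 0 0 u u = idn D (tw_single C (fst X 0))"
proof -
  let ?Y = "tw_single C (fst X 0)"
  interpret D: dg_category "PreTr C" by (rule dg_category_PreTr)
  interpret M: dg_category "graded_mat C" by (rule dg_category_graded_mat)
  have O: "fst X i \<in> Ob C" for i using X by (rule PreTr_fst)
  have Y: "?Y \<in> Ob D" by (rule tw_single_Ob[OF z O])
  have OY: "fst ?Y i \<in> Ob C" for i using Y by (rule PreTr_fst)
  have cX: "concentrated C X" "concentrated C ?Y" "fst X 0 = fst ?Y 0" "fst ?Y 0 = fst X 0"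
    using c zero_ob_tw_single[OF z] by (auto simp: concentrated_def)
  have key: "u \<in> closed_mor D X Y \<and> cmp D X Y X 0 0 u u = idn D X"
    if X: "X \<in> Ob D" and Y: "Y \<in> Ob D" and c: "concentrated C X" "concentrated C Y"
      and e: "fst X 0 = fst Y 0" and u: "u = tw_single_mor (idn C (fst X 0))" for X Y u
  proof -
    have O: "fst X i \<in> Ob C" "fst Y i \<in> Ob C" for i using X Y by (simp_all add: PreTr_fst)
    have uM: "u \<in> Mor D X Y 0" "u \<in> Mor D Y X 0"
      using O e O(1)[of 0] by (auto simp: PreTr_simps pretr_Mor_def u tw_single_mor_def zero_Mor idn_Mor)
    have "dif D X Y 0 u = 0"
      using X Y uM c
      by (simp add: PreTr_dif_eq concentrated_def PreTr_graded_mat M.cmp_zero_left M.cmp_zero_right PreTr_Ob_graded_mat)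
        (use O e O(1)[of 0] in \<open>auto simp: graded_mat_simps fun_eq_iff u tw_single_mor_def dif_zero dif_idn\<close>)
    moreover have "cmp D X Y X 0 0 u u = idn D X"
    proof (intro ext)
      fix i j
      have "cmp D X Y X 0 0 u u i j = cmp C (fst X i) (fst Y 0) (fst X j) (- j) i (u 0 j) (u i 0)"
        unfolding PreTr_simps
        by (subst PreTr_cmp_single[where p = 0]) (use X Y uM in \<open>auto simp: u tw_single_mor_def PreTr_simps\<close>)
      also have "\<dots> = idn D X i j"
      proof (cases "i = 0 \<and> j = 0")
        case True
        then show ?thesis using O(1)[of 0] by (simp add: u e[symmetric] PreTr_simps cmp_idn_left idn_Mor)
      next
        case False
        then have "cmp C (fst X i) (fst Y 0) (fst X j) (- j) i (u 0 j) (u i 0) = 0"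
          using O O(1)[of 0] by (auto simp: u tw_single_mor_def e[symmetric] cmp_zero_left cmp_zero_right zero_Mor idn_Mor)
        moreover have "i = j \<Longrightarrow> idn C (fst X i) = 0" using False c(1) by (auto simp: concentrated_def zero_ob_def)
        ultimately show ?thesis by (auto simp: PreTr_simps)
      qed
      finally show "cmp D X Y X 0 0 u u i j = idn D X i j" .
    qed
    ultimately show ?thesis using uM by (simp add: closed_mor_def)
  qed
  from key[OF X Y cX(1,2,3)] key[OF Y X cX(2,1,4)]
  show "u \<in> closed_mor D X ?Y" "u \<in> closed_mor D ?Y X"
    "cmp D X ?Y X 0 0 u u = idn D X" "cmp D ?Y X ?Y 0 0 u u = idn D ?Y"
    by (simp_all add: u_def)
qed

lemma concentrated_conjugate:
  assumes z: "zero_ob C z" and X: "X \<in> Ob D" "Y \<in> Ob D" and c: "concentrated C X" "concentrated C Y"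
    and f: "f \<in> Mor D X Y l"
  shows "graded_conj D X (tw_single C (fst X 0)) Y (tw_single C (fst Y 0)) 0
    (tw_single_mor (idn C (fst Y 0))) (tw_single_mor (idn C (fst X 0))) l f 0 0 = f 0 0"
proof -
  interpret D: dg_category "PreTr C" by (rule dg_category_PreTr)
  let ?sX = "tw_single C (fst X 0)" and ?sY = "tw_single C (fst Y 0)"
  let ?u = "tw_single_mor (idn C (fst Y 0))" and ?v = "tw_single_mor (idn C (fst X 0))"
  note u = concentrated_iso(1)[OF z X(2) c(2), THEN D.closed_mor_Mor]
  note v = concentrated_iso(2)[OF z X(1) c(1), THEN D.closed_mor_Mor]
  have s: "?sX \<in> Ob D" "?sY \<in> Ob D" using X by (simp_all add: tw_single_Ob[OF z] PreTr_fst)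
  have O: "fst X 0 \<in> Ob C" "fst Y 0 \<in> Ob C" using X by (simp_all add: PreTr_fst)
  have f0: "f 0 0 \<in> Mor C (fst X 0) (fst Y 0) l"
    using pretr_entry[of f X Y l l 0 0] f by (simp add: PreTr_simps)
  let ?w = "cmp D ?sX X Y l 0 f ?v"
  have w: "?w \<in> Mor D ?sX Y l" using X s v f by (simp add: D.cmp_Mor_deg)
  have "?w 0 0 = f 0 0"
    unfolding PreTr_simps
    by (subst PreTr_cmp_single[where p = 0])
      (use X s v f O f0 in \<open>auto simp: PreTr_simps tw_single_mor_def cmp_idn_right\<close>)
  moreover have "cmp D ?sX Y ?sY 0 l ?u ?w 0 0 = ?w 0 0"
    unfolding PreTr_simps(4)[of C]
    by (subst PreTr_cmp_single[where p = 0])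
      (use X s u w O f0 \<open>?w 0 0 = f 0 0\<close> in \<open>auto simp: PreTr_simps tw_single_mor_def cmp_idn_left\<close>)
  ultimately show ?thesis by (simp add: graded_conj_def)
qed

text \<open>
  Concentrated complexes get the trivial isomorphism \<open>u X\<close>, so that \<open>F\<close> is strictly the identity on them.
\<close>

lemma convolution_functor:
  assumes z: "zero_ob C z" and one: "has_shifted_sums C" and twist: "has_twists C"
  shows "\<exists>F Fm. dg_functor D C F Fm \<and>
    (\<forall>X\<in>Ob D. \<forall>Y\<in>Ob D. \<forall>l. bij_betw (Fm X Y l) (Mor D X Y l) (Mor C (F X) (F Y) l)) \<and>
    (\<forall>X\<in>Ob D. concentrated C X \<longrightarrow> F X = fst X 0) \<and>
    (\<forall>X\<in>Ob D. \<forall>Y\<in>Ob D. concentrated C X \<longrightarrow> concentrated C Y \<longrightarrow>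
      (\<forall>l. \<forall>f\<in>Mor D X Y l. Fm X Y l f = f 0 0))"
proof -
  interpret D: dg_category "PreTr C" by (rule dg_category_PreTr)
  let ?D = "PreTr C" and ?s = "tw_single C"
  have "\<forall>X\<in>Ob ?D. \<exists>Z u u'. Z \<in> Ob C \<and> u \<in> closed_mor ?D X (?s Z) \<and> u' \<in> closed_mor ?D (?s Z) X \<and>
     cmp ?D X (?s Z) X 0 0 u' u = idn ?D X \<and> cmp ?D (?s Z) X (?s Z) 0 0 u u' = idn ?D (?s Z) \<and>
     (concentrated C X \<longrightarrow> Z = fst X 0 \<and> u = tw_single_mor (idn C (fst X 0)) \<and> u' = tw_single_mor (idn C (fst X 0)))"
    (is "\<forall>X\<in>Ob ?D. ?P X")
  proof
    fix X assume X: "X \<in> Ob ?D"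
    show "?P X"
    proof (cases "concentrated C X")
      case True
      have "fst X 0 \<in> Ob C" using X by (rule PreTr_fst)
      with concentrated_iso[OF z X True] show ?thesis by blast
    next
      case False
      with convolution_exists[OF z one twist X] show ?thesis by blast
    qed
  qed
  then obtain F u u' where *: "\<forall>X\<in>Ob ?D. F X \<in> Ob C \<and> u X \<in> closed_mor ?D X (?s (F X)) \<and>
     u' X \<in> closed_mor ?D (?s (F X)) X \<and> cmp ?D X (?s (F X)) X 0 0 (u' X) (u X) = idn ?D X \<and>
     cmp ?D (?s (F X)) X (?s (F X)) 0 0 (u X) (u' X) = idn ?D (?s (F X)) \<and>
     (concentrated C X \<longrightarrow> F X = fst X 0 \<and> u X = tw_single_mor (idn C (fst X 0)) \<and>
       u' X = tw_single_mor (idn C (fst X 0)))"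
    unfolding bchoice_iff by (elim exE)
  have FO: "\<And>X. X \<in> Ob ?D \<Longrightarrow> F X \<in> Ob C"
    and uc: "\<And>X. X \<in> Ob ?D \<Longrightarrow> u X \<in> closed_mor ?D X (?s (F X))" "\<And>X. X \<in> Ob ?D \<Longrightarrow> u' X \<in> closed_mor ?D (?s (F X)) X"
    and uu: "\<And>X. X \<in> Ob ?D \<Longrightarrow> cmp ?D X (?s (F X)) X 0 0 (u' X) (u X) = idn ?D X"
      "\<And>X. X \<in> Ob ?D \<Longrightarrow> cmp ?D (?s (F X)) X (?s (F X)) 0 0 (u X) (u' X) = idn ?D (?s (F X))"
    and con: "\<And>X. X \<in> Ob ?D \<Longrightarrow> concentrated C X \<Longrightarrow> F X = fst X 0 \<and> u X = tw_single_mor (idn C (fst X 0)) \<and>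
      u' X = tw_single_mor (idn C (fst X 0))"
    using * by simp_all
  note sO = tw_single_Ob[OF z FO]
  note u = uc[THEN D.closed_mor_Mor] and du = uc[THEN D.closed_mor_dif]
  have i: "graded_iso ?D X (?s (F X)) 0 (u X) (u' X)" if "X \<in> Ob ?D" for X
    using that sO u du uu by (simp add: graded_iso_def)
  \<comment> \<open>\<open>G\<close> carries a morphism to one between singles, and
    \<open>Fm\<close> reads off the one entry that matters.\<close>
  define G where "G X Y = graded_conj ?D X (?s (F X)) Y (?s (F Y)) 0 (u Y) (u' X)" for X Y
  define Fm where "Fm X Y l f = G X Y l f 0 0" for X Y l f
  have GM: "G X Y l f \<in> Mor ?D (?s (F X)) (?s (F Y)) l" if "X \<in> Ob ?D" "Y \<in> Ob ?D" "f \<in> Mor ?D X Y l" for X Y l f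
    unfolding G_def by (rule D.graded_conj_Mor[OF i[OF that(1)] i[OF that(2)] that(3)])
  have GF: "G X Y l f = tw_single_mor (Fm X Y l f)" if "X \<in> Ob ?D" "Y \<in> Ob ?D" "f \<in> Mor ?D X Y l" for X Y l f
    unfolding Fm_def using tw_single_entry[OF z FO[OF that(1)] FO[OF that(2)] GM[OF that]] .
  have FM: "Fm X Y l f \<in> Mor C (F X) (F Y) l" if "X \<in> Ob ?D" "Y \<in> Ob ?D" "f \<in> Mor ?D X Y l" for X Y l f
    unfolding Fm_def by (rule tw_single_entry_Mor[OF GM[OF that]])
  have eq00: "a = b" if "tw_single_mor a = tw_single_mor b" for a b :: 'm
    using that[THEN fun_cong, THEN fun_cong, of 0 0] by simp
  have "dg_functor ?D C F Fm"
    unfolding dg_functor_def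
  proof (intro conjI ballI allI)
    fix X assume X: "X \<in> Ob ?D"
    show "F X \<in> Ob C" by (rule FO[OF X])
    show "Fm X X 0 (idn ?D X) = idn C (F X)"
      using D.graded_conj_idn[OF i[OF X]] by (simp add: Fm_def G_def tw_single_idn[OF z FO[OF X]])
    fix Y assume Y: "Y \<in> Ob ?D"
    fix l f assume f: "f \<in> Mor ?D X Y l"
    show "Fm X Y l f \<in> Mor C (F X) (F Y) l" by (rule FM[OF X Y f])
    have "G X Y (l + 1) (dif ?D X Y l f) = dif ?D (?s (F X)) (?s (F Y)) l (G X Y l f)"
      unfolding G_def using D.graded_conj_dif[OF i[OF X] i[OF Y] f] by simp
    then have "tw_single_mor (Fm X Y (l + 1) (dif ?D X Y l f)) = tw_single_mor (dif C (F X) (F Y) l (Fm X Y l f))"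
      by (simp only: GF[OF X Y f] GF[OF X Y D.dif_Mor[OF X Y f]] tw_single_dif[OF z FO[OF X] FO[OF Y] FM[OF X Y f]])
    then show "Fm X Y (l + 1) (dif ?D X Y l f) = dif C (F X) (F Y) l (Fm X Y l f)" by (rule eq00)
    fix g assume "g \<in> Mor ?D X Y l"
    then show "Fm X Y l (f + g) = Fm X Y l f + Fm X Y l g"
      unfolding Fm_def G_def using D.graded_conj_add[OF i[OF X] i[OF Y] f] by simp
  next
    fix X Y Z k l f g assume X: "X \<in> Ob ?D" and Y: "Y \<in> Ob ?D" and Z: "Z \<in> Ob ?D"
      and f: "f \<in> Mor ?D Y Z k" and g: "g \<in> Mor ?D X Y l"
    have "cmp ?D (?s (F X)) (?s (F Y)) (?s (F Z)) k l (G Y Z k f) (G X Y l g) = G X Z (k + l) (cmp ?D X Y Z k l f g)"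
      unfolding G_def by (rule D.graded_conj_cmp[OF i[OF X] i[OF Y] i[OF Z] f g refl])
    then have "tw_single_mor (Fm X Z (k + l) (cmp ?D X Y Z k l f g)) =
        tw_single_mor (cmp C (F X) (F Y) (F Z) k l (Fm Y Z k f) (Fm X Y l g))"
      by (simp only: GF[OF Y Z f] GF[OF X Y g] GF[OF X Z D.cmp_Mor[OF X Y Z f g]]
          tw_single_cmp[OF z FO[OF X] FO[OF Y] FO[OF Z] FM[OF Y Z f] FM[OF X Y g]])
    then show "Fm X Z (k + l) (cmp ?D X Y Z k l f g) = cmp C (F X) (F Y) (F Z) k l (Fm Y Z k f) (Fm X Y l g)"
      by (rule eq00)
  qed
  moreover have "bij_betw (Fm X Y l) (Mor ?D X Y l) (Mor C (F X) (F Y) l)" if X: "X \<in> Ob ?D" and Y: "Y \<in> Ob ?D" for X Y l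
  proof (rule bij_betwI)
    \<comment> \<open>The inverse map regards a morphism of \<open>C\<close> as one of singles and
      conjugates it back.\<close>
    let ?H = "\<lambda>g. graded_conj ?D (?s (F X)) X (?s (F Y)) Y 0 (u' Y) (u X) l (tw_single_mor g)"
    note j = i[OF X, THEN graded_iso_sym, simplified] i[OF Y, THEN graded_iso_sym, simplified]
    show "Fm X Y l \<in> Mor ?D X Y l \<rightarrow> Mor C (F X) (F Y) l" using FM[OF X Y] by blast
    show "?H \<in> Mor C (F X) (F Y) l \<rightarrow> Mor ?D X Y l"
      using D.graded_conj_Mor[OF j tw_single_mor_Mor[OF z FO[OF X] FO[OF Y]]] by blast
    fix f assume f: "f \<in> Mor ?D X Y l"
    show "?H (Fm X Y l f) = f"
      using D.graded_conj_inverse[OF j f] by (simp add: GF[OF X Y f, symmetric] G_def)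
  next
    fix g assume "g \<in> Mor C (F X) (F Y) l"
    from D.graded_conj_inverse[OF i[OF X] i[OF Y] tw_single_mor_Mor[OF z FO[OF X] FO[OF Y] this]]
    show "Fm X Y l (graded_conj ?D (?s (F X)) X (?s (F Y)) Y 0 (u' Y) (u X) l (tw_single_mor g)) = g"
      by (simp add: Fm_def G_def)
  qed
  moreover have "F X = fst X 0" if "X \<in> Ob ?D" "concentrated C X" for X using con[OF that] by simp
  moreover have "Fm X Y l f = f 0 0"
    if "X \<in> Ob ?D" "Y \<in> Ob ?D" "concentrated C X" "concentrated C Y" "f \<in> Mor ?D X Y l" for X Y l f
    using concentrated_conjugate[OF z that] con[OF that(1,3)] con[OF that(2,4)] by (simp add: Fm_def G_def)
  ultimately show ?thesis by blast
qed

end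

section \<open>The homotopy functor of a differential graded functor\<close>

context dg_category
begin

lemma lMor_H0E:
  assumes "\<phi> \<in> lMor (H0 C) X Y"
  obtains f where "f \<in> closed_mor C X Y" "\<phi> = hclass C X Y f"
  using assms by (auto simp: H0_simps)

lemma lMor_H0I: "f \<in> closed_mor C X Y \<Longrightarrow> hclass C X Y f \<in> lMor (H0 C) X Y"
  by (simp add: H0_simps)

lemma lcmp_H0_Mor:
  assumes "X \<in> Ob C" "Y \<in> Ob C" "Z \<in> Ob C" "\<phi> \<in> lMor (H0 C) Y Z" "\<psi> \<in> lMor (H0 C) X Y"
  shows "lcmp (H0 C) X Y Z \<phi> \<psi> \<in> lMor (H0 C) X Z"
  using assms by (elim lMor_H0E) (simp add: H0_cmp closed_cmp lMor_H0I)

lemma lcmp_H0_assoc: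
  assumes "W \<in> Ob C" "X \<in> Ob C" "Y \<in> Ob C" "Z \<in> Ob C"
    "\<phi> \<in> lMor (H0 C) Y Z" "\<psi> \<in> lMor (H0 C) X Y" "\<chi> \<in> lMor (H0 C) W X"
  shows "lcmp (H0 C) W X Z (lcmp (H0 C) X Y Z \<phi> \<psi>) \<chi> = lcmp (H0 C) W Y Z \<phi> (lcmp (H0 C) W X Y \<psi> \<chi>)"
  using assms by (elim lMor_H0E) (simp add: H0_cmp closed_cmp cmp_assoc_0)

lemma l_iso_H0_comp:
  assumes "X \<in> Ob C" "Y \<in> Ob C" "Z \<in> Ob C" "l_iso (H0 C) X Y \<phi>" "l_iso (H0 C) Y Z \<psi>"
  shows "l_iso (H0 C) X Z (lcmp (H0 C) X Y Z \<psi> \<phi>)"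
proof -
  obtain f f' g g' where "\<phi> = hclass C X Y f" "h_inverse C X Y f f'" "\<psi> = hclass C Y Z g" "h_inverse C Y Z g g'"
    using assms by (auto simp: l_iso_H0)
  moreover from this have "lcmp (H0 C) X Y Z \<psi> \<phi> = hclass C X Z (cmp C X Y Z 0 0 g f)"
    using assms(1-3) by (simp add: H0_cmp h_inverse_def)
  ultimately show ?thesis
    unfolding l_iso_H0[OF assms(1,3)] using h_inverse_comp[OF assms(1-3)] by blast
qed

lemma strict_h_inverse:
  assumes "f \<in> closed_mor C X Y" "g \<in> closed_mor C Y X" "cmp C X Y X 0 0 g f = idn C X" "cmp C Y X Y 0 0 f g = idn C Y"
  shows "h_inverse C X Y f g"
  using assms by (simp add: h_inverse_def)

text \<open>A dg functor sends a cone to an extension by \<open>F (sh A)\<close>, while a cone of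
  the image morphism is one by \<open>sh (F A)\<close>; this lemma exchanges the two.\<close>

lemma dg_ext_transport:
  assumes E: "dg_ext C A Y Z \<phi> \<iota>1 \<iota>2 \<pi>1 \<pi>2" and A': "A' \<in> Ob C"
    and t: "t \<in> closed_mor C A A'" "t' \<in> closed_mor C A' A" "cmp C A A' A 0 0 t' t = idn C A" "cmp C A' A A' 0 0 t t' = idn C A'"
  shows "dg_ext C A' Y Z (cmp C A' A Y 1 0 \<phi> t') (cmp C A' A Z 0 0 \<iota>1 t') \<iota>2 (cmp C Z A A' 0 0 t \<pi>1) \<pi>2"
proof -
  note U = E[unfolded dg_ext_def] A' t[unfolded closed_mor_def, simplified]
  have 1: "cmp C A' Z A' 0 0 (cmp C Z A A' 0 0 t \<pi>1) (cmp C A' A Z 0 0 \<iota>1 t') = idn C A'"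
    using U by (simp add: Mor_rules cmp_assoc_deg cmp_cancel[where X = A and Y = Z])
  have 2: "cmp C A' Z Y 0 0 \<pi>2 (cmp C A' A Z 0 0 \<iota>1 t') = 0"
    by (rule cmp_cancel_zero) (use U in auto)
  have 3: "cmp C Z A' Z 0 0 (cmp C A' A Z 0 0 \<iota>1 t') (cmp C Z A A' 0 0 t \<pi>1) = cmp C Z A Z 0 0 \<iota>1 \<pi>1"
    using U by (simp add: Mor_rules cmp_assoc_deg cmp_cancel[where X = A and Y = A'])
  show ?thesis
    unfolding dg_ext_def 1 2 3 using U
    by (simp add: Mor_rules leibniz_deg cmp_linear cmp_assoc_deg)
qed

text \<open>For equal \<open>\<phi>\<close> the block matrices with identities on the diagonal and
  corner 0 are closed, and those in the two directions compose to identities.\<close>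

lemma dg_ext_unique:
  assumes E: "dg_ext C A Y Z \<phi> \<iota>1 \<iota>2 \<pi>1 \<pi>2" and E': "dg_ext C A Y Z' \<phi> \<iota>1' \<iota>2' \<pi>1' \<pi>2'"
  shows "\<exists>\<kappa> \<kappa>'. \<kappa> \<in> closed_mor C Z Z' \<and> h_inverse C Z Z' \<kappa> \<kappa>' \<and> cmp C Y Z Z' 0 0 \<kappa> \<iota>2 = \<iota>2' \<and>
    cmp C Z Z' A 0 0 \<pi>1' \<kappa> = \<pi>1"
proof -
  have O: "A \<in> Ob C" "Y \<in> Ob C" "Z \<in> Ob C" "Z' \<in> Ob C" and \<phi>: "\<phi> \<in> Mor C A Y 1"
    using E E' by (simp_all add: dg_ext_def)
  have U: "\<iota>2' \<in> Mor C Y Z' 0" "\<pi>1 \<in> Mor C Z A 0" using E E' by (simp_all add: dg_ext_def)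
  have i: "idn C A \<in> Mor C A A 0" "idn C Y \<in> Mor C Y Y 0" "0 \<in> Mor C A Y 0" using O by (simp_all add: idn_Mor zero_Mor)
  have c: "dif C A Y 0 0 = cmp C A Y Y 0 1 (idn C Y) \<phi> - cmp C A A Y 1 0 \<phi> (idn C A)"
    using O \<phi> by (simp add: cmp_idn_left cmp_idn_right dif_zero)
  let ?k = "ext_mat C A Y Z A Y Z' \<iota>1' \<iota>2' \<pi>1 \<pi>2 (idn C A) (idn C Y) 0"
  let ?k' = "ext_mat C A Y Z' A Y Z \<iota>1 \<iota>2 \<pi>1' \<pi>2' (idn C A) (idn C Y) 0"
  have kc: "?k \<in> closed_mor C Z Z'" "?k' \<in> closed_mor C Z' Z"
    using ext_mat_closed[OF E E' _ _ i(3) c] ext_mat_closed[OF E' E _ _ i(3) c] O by (simp_all add: closed_idn)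
  have "cmp C Z Z' Z 0 0 ?k' ?k = idn C Z" "cmp C Z' Z Z' 0 0 ?k ?k' = idn C Z'"
    using ext_mat_cmp[OF E E' i i] ext_mat_cmp[OF E' E i i] O i ext_mat_idn[OF E] ext_mat_idn[OF E']
    by (simp_all add: cmp_idn_left cmp_zero_left cmp_zero_right)
  then have "h_inverse C Z Z' ?k ?k'" using kc by (simp add: strict_h_inverse)
  moreover have "cmp C Y Z Z' 0 0 ?k \<iota>2 = \<iota>2'" "cmp C Z Z' A 0 0 \<pi>1' ?k = \<pi>1"
    using ext_mat_incl[OF E E' i] ext_mat_proj[OF E E' i] O U by (simp_all add: cmp_idn_left cmp_idn_right)
  ultimately show ?thesis using kc by blast
qed

end

section \<open>Functors induced on homotopy categories\<close>

locale dg_functor_cats =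
  C: dg_category C + D: dg_category D
  for C :: "('o, 'm::ab_group_add) dgcat" and D :: "('p, 'n::ab_group_add) dgcat" +
  fixes F :: "'o \<Rightarrow> 'p" and Fm :: "'o \<Rightarrow> 'o \<Rightarrow> int \<Rightarrow> 'm \<Rightarrow> 'n"
  assumes dg_functor: "dg_functor C D F Fm"
begin

lemma F_Ob: "X \<in> Ob C \<Longrightarrow> F X \<in> Ob D"
  and F_idn: "X \<in> Ob C \<Longrightarrow> Fm X X 0 (idn C X) = idn D (F X)"
  and F_Mor: "\<lbrakk>X \<in> Ob C; Y \<in> Ob C; f \<in> Mor C X Y i\<rbrakk> \<Longrightarrow> Fm X Y i f \<in> Mor D (F X) (F Y) i"
  and F_add: "\<lbrakk>X \<in> Ob C; Y \<in> Ob C; f \<in> Mor C X Y i; g \<in> Mor C X Y i\<rbrakk> \<Longrightarrow> Fm X Y i (f + g) = Fm X Y i f + Fm X Y i g"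
  using dg_functor unfolding dg_functor_def by blast+

lemma F_dif: "\<lbrakk>X \<in> Ob C; Y \<in> Ob C; f \<in> Mor C X Y i; n = i + 1\<rbrakk> \<Longrightarrow>
    Fm X Y n (dif C X Y i f) = dif D (F X) (F Y) i (Fm X Y i f)"
  using dg_functor unfolding dg_functor_def by blast

lemma F_cmp: "\<lbrakk>X \<in> Ob C; Y \<in> Ob C; Z \<in> Ob C; f \<in> Mor C Y Z i; g \<in> Mor C X Y j; n = i + j\<rbrakk> \<Longrightarrow>
    Fm X Z n (cmp C X Y Z i j f g) = cmp D (F X) (F Y) (F Z) i j (Fm Y Z i f) (Fm X Y j g)"
  using dg_functor unfolding dg_functor_def by blast

lemma F_zero: "\<lbrakk>X \<in> Ob C; Y \<in> Ob C\<rbrakk> \<Longrightarrow> Fm X Y i 0 = 0"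
  using F_add[of X Y 0 i 0] C.zero_Mor[of X Y i] by simp

lemma F_closed: "\<lbrakk>X \<in> Ob C; Y \<in> Ob C; f \<in> closed_mor C X Y\<rbrakk> \<Longrightarrow> Fm X Y 0 f \<in> closed_mor D (F X) (F Y)"
  using F_dif[of X Y f 0 1] by (simp add: closed_mor_def F_Mor F_zero)

lemma F_hclass_cong:
  assumes "X \<in> Ob C" "Y \<in> Ob C" "f \<in> Mor C X Y 0" "g \<in> Mor C X Y 0" "hclass C X Y f = hclass C X Y g"
  shows "hclass D (F X) (F Y) (Fm X Y 0 f) = hclass D (F X) (F Y) (Fm X Y 0 g)"
proof -
  obtain h where h: "h \<in> Mor C X Y (-1)" "f = g + dif C X Y (-1) h"
    using assms by (auto simp: C.hclass_eq_iff)
  then have "Fm X Y 0 f = Fm X Y 0 g + dif D (F X) (F Y) (-1) (Fm X Y (-1) h)"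
    using assms by (simp add: F_add F_dif C.dif_Mor_deg)
  then show ?thesis
    using F_Mor[OF assms(1,2) h(1)] assms(1,2) by (auto simp: D.hclass_eq_iff F_Ob)
qed

lemma H0_mor_hclass:
  assumes "X \<in> Ob C" "Y \<in> Ob C" "f \<in> closed_mor C X Y"
  shows "H0_mor D F Fm X Y (hclass C X Y f) = hclass D (F X) (F Y) (Fm X Y 0 f)"
proof -
  have "hclass D (F X) (F Y) (Fm X Y 0 g) = hclass D (F X) (F Y) (Fm X Y 0 f)" if "g \<in> hclass C X Y f" for g
  proof (rule F_hclass_cong)
    show "g \<in> Mor C X Y 0"
      using that assms by (auto simp: hclass_def closed_mor_def C.add_Mor C.dif_Mor_deg)
  qed (use that assms C.hclass_mem_eq in \<open>auto simp: closed_mor_def\<close>)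
  then have "H0_mor D F Fm X Y (hclass C X Y f) = (\<Union>g\<in>hclass C X Y f. hclass D (F X) (F Y) (Fm X Y 0 f))"
    unfolding H0_mor_def by (rule SUP_cong[OF refl])
  then show ?thesis using C.mem_hclass[OF assms(1,2), of f] by auto
qed

abbreviation FH :: "'o \<Rightarrow> 'o \<Rightarrow> 'm set \<Rightarrow> 'n set" where
  "FH \<equiv> H0_mor D F Fm"

lemma FH_Mor: "\<lbrakk>X \<in> Ob C; Y \<in> Ob C; \<phi> \<in> lMor (H0 C) X Y\<rbrakk> \<Longrightarrow> FH X Y \<phi> \<in> lMor (H0 D) (F X) (F Y)"
  by (elim C.lMor_H0E) (simp add: H0_mor_hclass F_closed D.lMor_H0I)

lemma FH_cmp:
  assumes O: "X \<in> Ob C" "Y \<in> Ob C" "Z \<in> Ob C" and m: "\<phi> \<in> lMor (H0 C) Y Z" "\<psi> \<in> lMor (H0 C) X Y"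
  shows "FH X Z (lcmp (H0 C) X Y Z \<phi> \<psi>) = lcmp (H0 D) (F X) (F Y) (F Z) (FH Y Z \<phi>) (FH X Y \<psi>)"
proof -
  obtain f g where "f \<in> closed_mor C Y Z" "\<phi> = hclass C Y Z f" "g \<in> closed_mor C X Y" "\<psi> = hclass C X Y g"
    using m by (auto elim!: C.lMor_H0E)
  then show ?thesis
    using O by (simp add: C.H0_cmp D.H0_cmp H0_mor_hclass F_closed F_Ob C.closed_cmp F_cmp C.closed_mor_Mor)
qed

lemma FH_add:
  assumes O: "X \<in> Ob C" "Y \<in> Ob C" and m: "\<phi> \<in> lMor (H0 C) X Y" "\<psi> \<in> lMor (H0 C) X Y"
  shows "FH X Y (ladd (H0 C) X Y \<phi> \<psi>) = ladd (H0 D) (F X) (F Y) (FH X Y \<phi>) (FH X Y \<psi>)"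
proof -
  obtain f g where "f \<in> closed_mor C X Y" "\<phi> = hclass C X Y f" "g \<in> closed_mor C X Y" "\<psi> = hclass C X Y g"
    using m by (auto elim!: C.lMor_H0E)
  then show ?thesis
    using O by (simp add: C.H0_add D.H0_add H0_mor_hclass F_Ob C.closed_add F_add C.closed_mor_Mor)
qed

lemma FH_idn: "X \<in> Ob C \<Longrightarrow> FH X X (lidn (H0 C) X) = lidn (H0 D) (F X)"
  by (simp add: H0_simps H0_mor_hclass C.closed_idn F_idn)

lemma FH_l_iso: "X \<in> Ob C \<Longrightarrow> Y \<in> Ob C \<Longrightarrow> l_iso (H0 C) X Y \<phi> \<Longrightarrow> l_iso (H0 D) (F X) (F Y) (FH X Y \<phi>)"
  unfolding l_iso_def by (metis FH_Mor FH_cmp FH_idn)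

lemma F_l_isomorphic: "X \<in> Ob C \<Longrightarrow> Y \<in> Ob C \<Longrightarrow> l_isomorphic (H0 C) X Y \<Longrightarrow> l_isomorphic (H0 D) (F X) (F Y)"
  unfolding l_isomorphic_def using FH_l_iso by blast

lemma F_l_zero_ob: "l_zero_ob (H0 C) Z \<Longrightarrow> l_zero_ob (H0 D) (F Z)"
  using F_hclass_cong[of Z Z "idn C Z" 0]
  by (auto simp: C.l_zero_ob_H0 D.l_zero_ob_H0 F_Ob F_idn F_zero C.idn_Mor C.zero_Mor)

lemma F_dg_ext:
  assumes E: "dg_ext C A Y Z \<phi> \<iota>1 \<iota>2 \<pi>1 \<pi>2"
  shows "dg_ext D (F A) (F Y) (F Z) (Fm A Y 1 \<phi>) (Fm A Z 0 \<iota>1) (Fm Y Z 0 \<iota>2) (Fm Z A 0 \<pi>1) (Fm Z Y 0 \<pi>2)"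
proof -
  note U = E[unfolded dg_ext_def]
  have I: "cmp C Z A Z 0 0 \<iota>1 \<pi>1 + cmp C Z Y Z 0 0 \<iota>2 \<pi>2 = idn C Z" using U by blast
  have "idn D (F Z) = Fm Z Z 0 (idn C Z)" using U by (simp add: F_idn)
  also have "\<dots> = Fm Z Z 0 (cmp C Z A Z 0 0 \<iota>1 \<pi>1) + Fm Z Z 0 (cmp C Z Y Z 0 0 \<iota>2 \<pi>2)"
    unfolding I[symmetric] using U by (intro F_add) (simp_all add: C.cmp_Mor_deg)
  also have "\<dots> = cmp D (F Z) (F A) (F Z) 0 0 (Fm A Z 0 \<iota>1) (Fm Z A 0 \<pi>1) +
      cmp D (F Z) (F Y) (F Z) 0 0 (Fm Y Z 0 \<iota>2) (Fm Z Y 0 \<pi>2)"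
    using U by (simp add: F_cmp)
  finally have 1: "cmp D (F Z) (F A) (F Z) 0 0 (Fm A Z 0 \<iota>1) (Fm Z A 0 \<pi>1) +
      cmp D (F Z) (F Y) (F Z) 0 0 (Fm Y Z 0 \<iota>2) (Fm Z Y 0 \<pi>2) = idn D (F Z)" by simp
  show ?thesis
    unfolding dg_ext_def using U 1
    by (simp add: F_Ob F_Mor F_cmp[symmetric] F_idn F_zero F_dif[symmetric])
qed

text \<open>Three degrees enter. Surjectivity in degree -1 lifts homotopies, degree 0 compares and
  lifts the morphisms themselves, and injectivity in degree 1 shows that a preimage of a closed
  morphism is closed.\<close>

lemma FH_bij:
  assumes O: "X \<in> Ob C" "Y \<in> Ob C" and b: "\<And>l. bij_betw (Fm X Y l) (Mor C X Y l) (Mor D (F X) (F Y) l)"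
  shows "bij_betw (FH X Y) (lMor (H0 C) X Y) (lMor (H0 D) (F X) (F Y))"
proof (rule bij_betw_imageI)
  note O' = O[THEN F_Ob]
  have inj: "f = g" if "f \<in> Mor C X Y l" "g \<in> Mor C X Y l" "Fm X Y l f = Fm X Y l g" for f g l
    using that bij_betw_imp_inj_on[OF b[of l]] by (meson inj_onD)
  have surj: "\<exists>f\<in>Mor C X Y l. Fm X Y l f = g" if "g \<in> Mor D (F X) (F Y) l" for g l
    using that bij_betw_imp_surj_on[OF b[of l]] by (metis imageE)
  show "inj_on (FH X Y) (lMor (H0 C) X Y)"
  proof (rule inj_onI)
    fix \<phi> \<psi> assume m: "\<phi> \<in> lMor (H0 C) X Y" "\<psi> \<in> lMor (H0 C) X Y" and e: "FH X Y \<phi> = FH X Y \<psi>"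
    obtain f g where f: "f \<in> closed_mor C X Y" "\<phi> = hclass C X Y f" and g: "g \<in> closed_mor C X Y" "\<psi> = hclass C X Y g"
      using m by (auto elim!: C.lMor_H0E)
    then obtain k where k: "k \<in> Mor D (F X) (F Y) (-1)" "Fm X Y 0 f = Fm X Y 0 g + dif D (F X) (F Y) (-1) k"
      using e O O' by (auto simp: H0_mor_hclass D.hclass_eq_iff)
    obtain h where h: "h \<in> Mor C X Y (-1)" "Fm X Y (-1) h = k" using surj[OF k(1)] by blast
    have dh: "dif C X Y (-1) h \<in> Mor C X Y 0" using O h by (simp add: C.dif_Mor_deg)
    have "Fm X Y 0 f = Fm X Y 0 (g + dif C X Y (-1) h)"
      using O g h k dh by (simp add: F_add F_dif closed_mor_def)
    then have "f = g + dif C X Y (-1) h"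
      using O f g dh by (intro inj[of _ 0]) (simp_all add: closed_mor_def C.add_Mor)
    then show "\<phi> = \<psi>" using f g h(1) O by (auto simp: C.hclass_eq_iff)
  qed
  show "FH X Y ` lMor (H0 C) X Y = lMor (H0 D) (F X) (F Y)"
  proof (intro equalityI subsetI)
    fix \<psi> assume "\<psi> \<in> FH X Y ` lMor (H0 C) X Y"
    then show "\<psi> \<in> lMor (H0 D) (F X) (F Y)" using FH_Mor[OF O] by blast
  next
    fix \<psi> assume "\<psi> \<in> lMor (H0 D) (F X) (F Y)"
    then obtain g where g: "g \<in> closed_mor D (F X) (F Y)" "\<psi> = hclass D (F X) (F Y) g" by (auto elim!: D.lMor_H0E)
    then obtain f where f: "f \<in> Mor C X Y 0" "Fm X Y 0 f = g" using surj[of g 0] by (auto simp: closed_mor_def)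
    have "Fm X Y 1 (dif C X Y 0 f) = Fm X Y 1 0" using O f g by (simp add: F_dif F_zero closed_mor_def)
    then have "dif C X Y 0 f = 0" using O f by (intro inj[of _ 1]) (simp_all add: C.dif_Mor_deg C.zero_Mor)
    then have "f \<in> closed_mor C X Y" using f by (simp add: closed_mor_def)
    then have "hclass C X Y f \<in> lMor (H0 C) X Y" "FH X Y (hclass C X Y f) = \<psi>"
      using O f g by (simp_all add: C.lMor_H0I H0_mor_hclass)
    then show "\<psi> \<in> FH X Y ` lMor (H0 C) X Y" by blast
  qed
qed

end

context dg_category
begin

section \<open>Conjugation with shift maps and homotopy invariance of cones\<close>

lemma graded_conj_closed:
  assumes "graded_iso C X X' d s t" "graded_iso C Y Y' d s' t'" "f \<in> closed_mor C X Y"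
  shows "graded_conj C X X' Y Y' d s' t 0 f \<in> closed_mor C X' Y'"
proof -
  have O: "X \<in> Ob C" "Y \<in> Ob C" "X' \<in> Ob C" "Y' \<in> Ob C" using assms by (simp_all add: graded_iso_def)
  have "graded_conj C X X' Y Y' d s' t 1 0 = 0"
    using assms(1,2) by (simp add: graded_conj_def graded_iso_def cmp_linear)
  then show ?thesis
    using assms graded_conj_dif[OF assms(1,2), of f 0 1] by (simp add: closed_mor_def graded_conj_Mor)
qed

text \<open>The shift in \<open>Tr\<close> acts on a class as the image of a set, so equality of
  sets is needed. The boundary of \<open>h\<close> goes to the boundary of \<open>(-1)^d\<close>
  times its conjugate, and conjugating back reaches every element.\<close>

lemma graded_conj_hclass_image:
  assumes i: "graded_iso C X X' d s t" "graded_iso C Y Y' d s' t'" and f: "f \<in> closed_mor C X Y"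
  shows "graded_conj C X X' Y Y' d s' t 0 ` hclass C X Y f = hclass C X' Y' (graded_conj C X X' Y Y' d s' t 0 f)"
proof -
  have O: "X \<in> Ob C" "Y \<in> Ob C" "X' \<in> Ob C" "Y' \<in> Ob C" using i by (simp_all add: graded_iso_def)
  let ?c = "graded_conj C X X' Y Y' d s' t"
  have key: "?c 0 (f + dif C X Y (-1) h) = ?c 0 f + dif C X' Y' (-1) (sgn_pow d (?c (-1) h))"
    if h: "h \<in> Mor C X Y (-1)" for h
  proof -
    have "dif C X Y (-1) h \<in> Mor C X Y 0" using O h by (simp add: dif_Mor_deg)
    then show ?thesis
      using O h f graded_conj_dif[OF i h, of 0] graded_conj_Mor[OF i h]
      by (simp add: graded_conj_add[OF i] closed_mor_Mor dif_sgn sgn_pow_eq_self)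
  qed
  show ?thesis
  proof (intro equalityI subsetI)
    fix x assume "x \<in> ?c 0 ` hclass C X Y f"
    then obtain h where h: "h \<in> Mor C X Y (-1)" "x = ?c 0 (f + dif C X Y (-1) h)" by (auto simp: hclass_def)
    have "sgn_pow d (?c (-1) h) \<in> Mor C X' Y' (-1)" using O h graded_conj_Mor[OF i h(1)] by (simp add: sgn_Mor)
    then show "x \<in> hclass C X' Y' (?c 0 f)" using h key by (auto simp: hclass_def)
  next
    fix x assume "x \<in> hclass C X' Y' (?c 0 f)"
    then obtain k where k: "k \<in> Mor C X' Y' (-1)" "x = ?c 0 f + dif C X' Y' (-1) k" by (auto simp: hclass_def)
    let ?k = "graded_conj C X' X Y' Y (- d) t' s (-1) k"
    have kM: "?k \<in> Mor C X Y (-1)"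
      by (rule graded_conj_Mor[OF graded_iso_sym[OF i(1)] graded_iso_sym[OF i(2)] k(1)])
    then have sk: "sgn_pow d ?k \<in> Mor C X Y (-1)" using O by (simp add: sgn_Mor)
    have "?c 0 (f + dif C X Y (-1) (sgn_pow d ?k)) = ?c 0 f + dif C X' Y' (-1) (sgn_pow d (?c (-1) (sgn_pow d ?k)))"
      by (rule key[OF sk])
    also have "sgn_pow d (?c (-1) (sgn_pow d ?k)) = k"
      using graded_conj_inverse[OF i k(1)] by (simp add: graded_conj_sgn[OF i kM] sgn_pow_eq_self)
    finally have "x = ?c 0 (f + dif C X Y (-1) (sgn_pow d ?k))" using k by simp
    then show "x \<in> ?c 0 ` hclass C X Y f" using sk by (auto simp: hclass_def)
  qed
qed

lemma graded_conj_h_inverse: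
  assumes i: "graded_iso C X X' d s t" "graded_iso C Y Y' d s' t'" and h: "h_inverse C X Y f g"
  shows "h_inverse C X' Y' (graded_conj C X X' Y Y' d s' t 0 f) (graded_conj C Y Y' X X' d s t' 0 g)"
proof -
  have O: "X \<in> Ob C" "Y \<in> Ob C" using i by (simp_all add: graded_iso_def)
  note H = h[unfolded h_inverse_def]
  have c: "f \<in> closed_mor C X Y" "g \<in> closed_mor C Y X" using H by auto
  have 1: "hclass C X' X' (graded_conj C X X' X X' d s t 0 (cmp C X Y X 0 0 g f)) = hclass C X' X' (idn C X')"
    using graded_conj_hclass_image[OF i(1,1), of "cmp C X Y X 0 0 g f"] graded_conj_hclass_image[OF i(1,1), of "idn C X"] H O
    by (simp add: closed_cmp closed_idn graded_conj_idn[OF i(1)])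
  have 2: "hclass C Y' Y' (graded_conj C Y Y' Y Y' d s' t' 0 (cmp C Y X Y 0 0 f g)) = hclass C Y' Y' (idn C Y')"
    using graded_conj_hclass_image[OF i(2,2), of "cmp C Y X Y 0 0 f g"] graded_conj_hclass_image[OF i(2,2), of "idn C Y"] H O
    by (simp add: closed_cmp closed_idn graded_conj_idn[OF i(2)])
  show ?thesis
    unfolding h_inverse_def
    using 1 2 graded_conj_cmp[OF i(1) i(2) i(1), of g 0 f 0 0] graded_conj_cmp[OF i(2) i(1) i(2), of f 0 g 0 0]
      graded_conj_closed[OF i c(1)] graded_conj_closed[OF i(2,1) c(2)] c
    by (simp add: closed_mor_Mor)
qed

lemma shift_graded_iso: "X \<in> Ob D \<Longrightarrow> graded_iso D X (sh X) (-1) (shift_out C 1 X) (shift_in C 1 X)"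
  by (simp add: graded_iso_def tw_shift_by_Ob shift_out_Mor shift_in_Mor dif_shift_out dif_shift_in shift_in_out shift_out_in)

lemma tw_shift_mor_conj:
  assumes "X \<in> Ob D" "Y \<in> Ob D" "f \<in> Mor D X Y 0"
  shows "tw_shift_mor f = graded_conj D X (sh X) Y (sh Y) (-1) (shift_out C 1 Y) (shift_in C 1 X) 0 f"
  by (simp add: graded_conj_def tw_shift_mor_eq[OF assms])

lemma tw_shift_mor_closed:
  assumes "X \<in> Ob D" "Y \<in> Ob D" "f \<in> closed_mor D X Y"
  shows "tw_shift_mor f \<in> closed_mor D (sh X) (sh Y)"
proof -
  interpret D: dg_category "PreTr C" by (rule dg_category_PreTr)
  show ?thesis
    using D.graded_conj_closed[OF shift_graded_iso[OF assms(1)] shift_graded_iso[OF assms(2)] assms(3)] assms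
    by (simp add: tw_shift_mor_conj D.closed_mor_Mor)
qed

lemma tw_shift_mor_hclass:
  assumes X: "X \<in> Ob D" and Y: "Y \<in> Ob D" and f: "f \<in> closed_mor D X Y"
  shows "tw_shift_mor ` hclass D X Y f = hclass D (sh X) (sh Y) (tw_shift_mor f)"
proof -
  interpret D: dg_category "PreTr C" by (rule dg_category_PreTr)
  let ?c = "graded_conj D X (sh X) Y (sh Y) (-1) (shift_out C 1 Y) (shift_in C 1 X) 0"
  have "g \<in> Mor D X Y 0" if "g \<in> hclass D X Y f" for g
    using that X Y f by (auto simp: hclass_def closed_mor_def D.add_Mor D.dif_Mor_deg)
  then have "tw_shift_mor ` hclass D X Y f = ?c ` hclass D X Y f"
    by (intro image_cong refl tw_shift_mor_conj[OF X Y])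
  then show ?thesis
    using D.graded_conj_hclass_image[OF shift_graded_iso[OF X] shift_graded_iso[OF Y] f] X Y f
    by (simp add: tw_shift_mor_conj D.closed_mor_Mor)
qed

lemma tw_shift_mor_idn: "tw_shift_mor (idn D X) = idn D (sh X)"
  by (simp add: tw_shift_mor_def PreTr_simps tw_shift_by_def fun_eq_iff)

lemma shift_l_isomorphic_iff:
  assumes "X \<in> Ob D" "Y \<in> Ob D"
  shows "l_isomorphic (H0 D) (sh X) (sh Y) \<longleftrightarrow> l_isomorphic (H0 D) X Y"
proof -
  interpret D: dg_category "PreTr C" by (rule dg_category_PreTr)
  note i = shift_graded_iso[OF assms(1)] shift_graded_iso[OF assms(2)]
  show ?thesis
    using D.graded_conj_h_inverse[OF i] D.graded_conj_h_inverse[OF i[THEN graded_iso_sym]] assms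
    by (simp add: D.l_isomorphic_H0 tw_shift_by_Ob) blast
qed

text \<open>A homotopy between \<open>f' a\<close> and \<open>b f\<close>, composed with the degree
  1 map \<open>shift_in\<close>, is the corner of a block matrix between the cones.
  \<open>ext_mat_h_inverse\<close> also needs a corner for \<open>a'\<close>, \<open>b'\<close>,
  whose square commutes up to homotopy as well.\<close>

lemma cone_h_inverse:
  assumes X: "X \<in> Ob D" and X': "X' \<in> Ob D"
    and E: "dg_ext D (sh X) Y Z (cmp D (sh X) X Y 0 1 f (shift_in C 1 X)) \<iota>1 \<iota>2 \<pi>1 \<pi>2"
    and E': "dg_ext D (sh X') Y' Z' (cmp D (sh X') X' Y' 0 1 f' (shift_in C 1 X')) \<iota>1' \<iota>2' \<pi>1' \<pi>2'"
    and f: "f \<in> closed_mor D X Y" "f' \<in> closed_mor D X' Y'"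
    and a: "h_inverse D X X' a a'" and b: "h_inverse D Y Y' b b'"
    and fa: "hclass D X Y' (cmp D X X' Y' 0 0 f' a) = hclass D X Y' (cmp D X Y Y' 0 0 b f)"
  shows "l_isomorphic (H0 D) Z Z'"
proof -
  interpret D: dg_category "PreTr C" by (rule dg_category_PreTr)
  let ?D = "PreTr C"
  have O: "Y \<in> Ob ?D" "Z \<in> Ob ?D" "Y' \<in> Ob ?D" "Z' \<in> Ob ?D" using E E' by (simp_all add: dg_ext_def)
  have c: "a \<in> closed_mor ?D X X'" "a' \<in> closed_mor ?D X' X" "b \<in> closed_mor ?D Y Y'" "b' \<in> closed_mor ?D Y' Y"
    using a b by (auto simp: h_inverse_def)
  have key: "\<exists>h\<in>Mor ?D (sh X) Y' 0. dif ?D (sh X) Y' 0 h =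
      cmp ?D (sh X) Y Y' 0 1 b (cmp ?D (sh X) X Y 0 1 f (shift_in C 1 X)) -
      cmp ?D (sh X) (sh X') Y' 1 0 (cmp ?D (sh X') X' Y' 0 1 f' (shift_in C 1 X'))
        (graded_conj ?D X (sh X) X' (sh X') (-1) (shift_out C 1 X') (shift_in C 1 X) 0 a)"
    if X: "X \<in> Ob ?D" "X' \<in> Ob ?D" "Y \<in> Ob ?D" "Y' \<in> Ob ?D"
      and f: "f \<in> closed_mor ?D X Y" "f' \<in> closed_mor ?D X' Y'" "a \<in> closed_mor ?D X X'" "b \<in> closed_mor ?D Y Y'"
      and fa: "hclass ?D X Y' (cmp ?D X Y Y' 0 0 b f) = hclass ?D X Y' (cmp ?D X X' Y' 0 0 f' a)"
    for X X' Y Y' f f' a b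
  proof -
    note i = shift_graded_iso[OF X(1), unfolded graded_iso_def] shift_graded_iso[OF X(2), unfolded graded_iso_def]
      X f[THEN D.closed_mor_Mor]
    obtain h where h: "h \<in> Mor ?D X Y' (-1)" and bf: "cmp ?D X Y Y' 0 0 b f = cmp ?D X X' Y' 0 0 f' a + dif ?D X Y' (-1) h"
      using fa X by (auto simp: D.hclass_eq_iff)
    have 1: "cmp ?D (sh X) (sh X') Y' 1 0 (cmp ?D (sh X') X' Y' 0 1 f' (shift_in C 1 X'))
        (graded_conj ?D X (sh X) X' (sh X') (-1) (shift_out C 1 X') (shift_in C 1 X) 0 a) =
      cmp ?D (sh X) X Y' 0 1 (cmp ?D X X' Y' 0 0 f' a) (shift_in C 1 X)"
      unfolding graded_conj_def using i
      by (simp add: D.Mor_rules D.cmp_assoc_deg D.cmp_cancel[where X = X' and Y = "sh X'"])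
    have 2: "cmp ?D (sh X) Y Y' 0 1 b (cmp ?D (sh X) X Y 0 1 f (shift_in C 1 X)) =
      cmp ?D (sh X) X Y' 0 1 (cmp ?D X Y Y' 0 0 b f) (shift_in C 1 X)"
      using i by (simp add: D.cmp_assoc_deg)
    have 3: "dif ?D (sh X) Y' 0 (cmp ?D (sh X) X Y' (-1) 1 h (shift_in C 1 X)) =
      - cmp ?D (sh X) X Y' 0 1 (dif ?D X Y' (-1) h) (shift_in C 1 X)"
      using i h by (simp add: D.leibniz_deg D.cmp_linear)
    show ?thesis
    \<comment> \<open>The minus sign compensates the Leibniz rule, where moving the differential
      past the degree 1 factor \<open>shift_in\<close> changes the sign.\<close>
    proof (rule bexI[of _ "- cmp ?D (sh X) X Y' (-1) 1 h (shift_in C 1 X)"])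
      show "- cmp ?D (sh X) X Y' (-1) 1 h (shift_in C 1 X) \<in> Mor ?D (sh X) Y' 0"
        using i h by (simp add: D.Mor_rules)
    qed (use i h in \<open>simp add: 1 2 3 bf D.dif_minus D.Mor_rules D.cmp_linear\<close>)
  qed
  obtain h where h: "h \<in> Mor ?D (sh X) Y' 0" "dif ?D (sh X) Y' 0 h =
      cmp ?D (sh X) Y Y' 0 1 b (cmp ?D (sh X) X Y 0 1 f (shift_in C 1 X)) -
      cmp ?D (sh X) (sh X') Y' 1 0 (cmp ?D (sh X') X' Y' 0 1 f' (shift_in C 1 X'))
        (graded_conj ?D X (sh X) X' (sh X') (-1) (shift_out C 1 X') (shift_in C 1 X) 0 a)"
    using key[OF X X' O(1,3) f c(1,3) fa[symmetric]] by blast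
  \<comment> \<open>Up to homotopy \<open>b' f' = b' f' a a' = b' b f a' = f a'\<close>.\<close>
  have "hclass ?D X' Y (cmp ?D X' Y' Y 0 0 b' f') = hclass ?D X' Y (cmp ?D X' X Y 0 0 f a')"
  proof -
    note B = b[unfolded h_inverse_def] and A = a[unfolded h_inverse_def]
    have "hclass ?D X' Y (cmp ?D X' Y' Y 0 0 b' f') =
        hclass ?D X' Y (cmp ?D X' X' Y 0 0 (cmp ?D X' Y' Y 0 0 b' f') (cmp ?D X' X X' 0 0 a a'))"
      using D.hclass_cmp_left_cong[of X' X' Y "cmp ?D X' Y' Y 0 0 b' f'" "cmp ?D X' X X' 0 0 a a'" "idn ?D X'"] A c f O X X'
      by (simp add: D.closed_cmp D.closed_idn D.cmp_idn_right_0)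
    also have "\<dots> = hclass ?D X' Y (cmp ?D X' Y' Y 0 0 b' (cmp ?D X' X Y' 0 0 (cmp ?D X X' Y' 0 0 f' a) a'))"
      using c f O X X' by (simp add: D.cmp_assoc_0 D.closed_cmp)
    also have "\<dots> = hclass ?D X' Y (cmp ?D X' Y' Y 0 0 b' (cmp ?D X' X Y' 0 0 (cmp ?D X Y Y' 0 0 b f) a'))"
      using c f O X X' by (intro D.hclass_cmp_left_cong D.hclass_cmp_right_cong fa) (simp_all add: D.closed_cmp)
    also have "\<dots> = hclass ?D X' Y (cmp ?D X' Y Y 0 0 (cmp ?D Y Y' Y 0 0 b' b) (cmp ?D X' X Y 0 0 f a'))"
      using c f O X X' by (simp add: D.cmp_assoc_0 D.closed_cmp)
    also have "\<dots> = hclass ?D X' Y (cmp ?D X' X Y 0 0 f a')"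
      using D.hclass_cmp_right_cong[of X' Y Y "cmp ?D Y Y' Y 0 0 b' b" "idn ?D Y" "cmp ?D X' X Y 0 0 f a'"] B c f O X X'
      by (simp add: D.closed_cmp D.closed_idn D.cmp_idn_left_0)
    finally show ?thesis .
  qed
  from key[OF X' X O(3,1) f(2,1) c(2,4) this]
  obtain h' where h': "h' \<in> Mor ?D (sh X') Y 0" "dif ?D (sh X') Y 0 h' =
      cmp ?D (sh X') Y' Y 0 1 b' (cmp ?D (sh X') X' Y' 0 1 f' (shift_in C 1 X')) -
      cmp ?D (sh X') (sh X) Y 1 0 (cmp ?D (sh X) X Y 0 1 f (shift_in C 1 X))
        (graded_conj ?D X' (sh X') X (sh X) (-1) (shift_out C 1 X) (shift_in C 1 X') 0 a')"
    by blast
  have "\<exists>g g'. h_inverse ?D Z Z' g g'"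
    using D.ext_mat_h_inverse[OF E E' D.graded_conj_h_inverse[OF shift_graded_iso[OF X] shift_graded_iso[OF X'] a] b h h']
    by blast
  then show ?thesis using O by (simp add: D.l_isomorphic_H0)
qed

end

section \<open>Triangulated subcategories\<close>

lemma Tr_simps:
  "lOb (Tr C) = Ob (PreTr C)" "lMor (Tr C) = lMor (H0 (PreTr C))" "lcmp (Tr C) = lcmp (H0 (PreTr C))"
  "lidn (Tr C) = lidn (H0 (PreTr C))" "lzero (Tr C) = lzero (H0 (PreTr C))" "ladd (Tr C) = ladd (H0 (PreTr C))"
  "tsh (Tr C) = tw_shift_by 1" "tshm (Tr C) = (\<lambda>X Y \<phi>. tw_shift_mor ` \<phi>)"
  by (simp_all add: Tr_def Let_def H0_simps tw_shift_eq fun_eq_iff)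

lemma Tr_iso_simps:
  "l_iso (Tr C) = l_iso (H0 (PreTr C))" "l_isomorphic (Tr C) = l_isomorphic (H0 (PreTr C))"
  "l_zero_ob (Tr C) = l_zero_ob (H0 (PreTr C))"
  by (simp_all add: fun_eq_iff l_isomorphic_def l_iso_def l_zero_ob_def Tr_simps H0_simps(1))

lemma tri_TrI:
  assumes "X \<in> Ob (PreTr C)" "Y \<in> Ob (PreTr C)" "Z \<in> Ob (PreTr C)"
    and "\<phi> \<in> lMor (H0 (PreTr C)) X Y" "\<psi> \<in> lMor (H0 (PreTr C)) Y Z" "\<chi> \<in> lMor (H0 (PreTr C)) Z (sh X)"
    and "tw_cone C A B f E \<iota>1 \<iota>2 \<pi>1 \<pi>2"
    and "l_iso (H0 (PreTr C)) A X \<alpha>" "l_iso (H0 (PreTr C)) B Y \<beta>" "l_iso (H0 (PreTr C)) E Z \<gamma>"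
    and "lcmp (H0 (PreTr C)) A X Y \<phi> \<alpha> = lcmp (H0 (PreTr C)) A B Y \<beta> (hclass (PreTr C) A B f)"
    and "lcmp (H0 (PreTr C)) B Y Z \<psi> \<beta> = lcmp (H0 (PreTr C)) B E Z \<gamma> (hclass (PreTr C) B E (diag_mor \<iota>2))"
    and "lcmp (H0 (PreTr C)) E Z (sh X) \<chi> \<gamma> =
      lcmp (H0 (PreTr C)) E (sh A) (sh X) (tw_shift_mor ` \<alpha>)
        (hclass (PreTr C) E (sh A) (diag_mor \<pi>1))"
  shows "(X, Y, Z, \<phi>, \<psi>, \<chi>) \<in> tri (Tr C)"
proof -
  have "(A, B, E, hclass (PreTr C) A B f, hclass (PreTr C) B E (diag_mor \<iota>2),
      hclass (PreTr C) E (tw_shift A) (diag_mor \<pi>1)) \<in> std_tri C"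
    using assms(7) unfolding std_tri_def by blast
  then show ?thesis
    using assms unfolding Tr_def Let_def tcat.simps tw_shift_eq H0_simps(1) by blast
qed

lemma tri_TrE:
  assumes "(X, Y, Z, \<phi>, \<psi>, \<chi>) \<in> tri (Tr C)"
  obtains A B f E \<iota>1 \<iota>2 \<pi>1 \<pi>2 \<alpha> \<beta> \<gamma> where
    "X \<in> Ob (PreTr C)" "Y \<in> Ob (PreTr C)" "Z \<in> Ob (PreTr C)"
    "\<phi> \<in> lMor (H0 (PreTr C)) X Y" "\<psi> \<in> lMor (H0 (PreTr C)) Y Z" "\<chi> \<in> lMor (H0 (PreTr C)) Z (sh X)"
    "tw_cone C A B f E \<iota>1 \<iota>2 \<pi>1 \<pi>2"
    "l_iso (H0 (PreTr C)) A X \<alpha>" "l_iso (H0 (PreTr C)) B Y \<beta>" "l_iso (H0 (PreTr C)) E Z \<gamma>"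
    "lcmp (H0 (PreTr C)) A X Y \<phi> \<alpha> = lcmp (H0 (PreTr C)) A B Y \<beta> (hclass (PreTr C) A B f)"
    "lcmp (H0 (PreTr C)) B Y Z \<psi> \<beta> = lcmp (H0 (PreTr C)) B E Z \<gamma> (hclass (PreTr C) B E (diag_mor \<iota>2))"
    "lcmp (H0 (PreTr C)) E Z (sh X) \<chi> \<gamma> =
      lcmp (H0 (PreTr C)) E (sh A) (sh X) (tw_shift_mor ` \<alpha>)
        (hclass (PreTr C) E (sh A) (diag_mor \<pi>1))"
proof -
  have *: "X \<in> Ob (PreTr C) \<and> Y \<in> Ob (PreTr C) \<and> Z \<in> Ob (PreTr C) \<and>
    \<phi> \<in> lMor (H0 (PreTr C)) X Y \<and> \<psi> \<in> lMor (H0 (PreTr C)) Y Z \<and> \<chi> \<in> lMor (H0 (PreTr C)) Z (sh X) \<and>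
    (\<exists>(A, B, E, u, v, w)\<in>std_tri C. \<exists>\<alpha> \<beta> \<gamma>.
      l_iso (H0 (PreTr C)) A X \<alpha> \<and> l_iso (H0 (PreTr C)) B Y \<beta> \<and> l_iso (H0 (PreTr C)) E Z \<gamma> \<and>
      lcmp (H0 (PreTr C)) A X Y \<phi> \<alpha> = lcmp (H0 (PreTr C)) A B Y \<beta> u \<and>
      lcmp (H0 (PreTr C)) B Y Z \<psi> \<beta> = lcmp (H0 (PreTr C)) B E Z \<gamma> v \<and>
      lcmp (H0 (PreTr C)) E Z (sh X) \<chi> \<gamma> =
        lcmp (H0 (PreTr C)) E (sh A) (sh X) (tw_shift_mor ` \<alpha>) w)"
    using assms unfolding Tr_def Let_def tcat.simps tw_shift_eq H0_simps(1) mem_Collect_eq prod.case .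
  then obtain A B E u v w \<alpha> \<beta> \<gamma> where s: "(A, B, E, u, v, w) \<in> std_tri C"
    and i: "l_iso (H0 (PreTr C)) A X \<alpha>" "l_iso (H0 (PreTr C)) B Y \<beta>" "l_iso (H0 (PreTr C)) E Z \<gamma>"
      "lcmp (H0 (PreTr C)) A X Y \<phi> \<alpha> = lcmp (H0 (PreTr C)) A B Y \<beta> u"
      "lcmp (H0 (PreTr C)) B Y Z \<psi> \<beta> = lcmp (H0 (PreTr C)) B E Z \<gamma> v"
      "lcmp (H0 (PreTr C)) E Z (sh X) \<chi> \<gamma> =
        lcmp (H0 (PreTr C)) E (sh A) (sh X) (tw_shift_mor ` \<alpha>) w"
    by blast
  from s obtain f \<iota>1 \<iota>2 \<pi>1 \<pi>2 where "tw_cone C A B f E \<iota>1 \<iota>2 \<pi>1 \<pi>2" "u = hclass (PreTr C) A B f"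
    "v = hclass (PreTr C) B E (diag_mor \<iota>2)" "w = hclass (PreTr C) E (sh A) (diag_mor \<pi>1)"
    unfolding std_tri_def tw_shift_eq by blast
  then show ?thesis using that * i by simp
qed

lemma tri_Tr_Ob: "(X, Y, Z, \<phi>, \<psi>, \<chi>) \<in> tri (Tr C) \<Longrightarrow> X \<in> Ob (PreTr C) \<and> Y \<in> Ob (PreTr C) \<and> Z \<in> Ob (PreTr C)"
  by (elim tri_TrE) simp

lemma tri_gen_subset: "S \<subseteq> tri_gen T S"
  by (auto simp: tri_gen_def)

lemma tri_gen_least: "tri_subcat T S' \<Longrightarrow> S \<subseteq> S' \<Longrightarrow> tri_gen T S \<subseteq> S'"
  by (auto simp: tri_gen_def)

context dg_category
begin

lemma tw_cone_tri:
  assumes T: "tw_cone C X Y f Z \<iota>1 \<iota>2 \<pi>1 \<pi>2"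
  shows "(X, Y, Z, hclass D X Y f, hclass D Y Z (diag_mor \<iota>2),
    hclass D Z (sh X) (diag_mor \<pi>1)) \<in> tri (Tr C)"
proof -
  interpret D: dg_category "PreTr C" by (rule dg_category_PreTr)
  have O: "X \<in> Ob D" "Y \<in> Ob D" "Z \<in> Ob D" and f: "f \<in> closed_mor D X Y"
    using T by (simp_all add: tw_cone_def)
  note s = tw_shift_by_Ob[OF O(1), of 1]
  have i: "diag_mor \<iota>2 \<in> closed_mor D Y Z" and p: "diag_mor \<pi>1 \<in> closed_mor D Z (sh X)"
    using tw_cone_dg_ext[OF T] by (simp_all add: dg_ext_def closed_mor_def)
  have id: "l_iso (H0 D) V V (hclass D V V (idn D V))" if "V \<in> Ob D" for V
    using D.h_inverse_idn[OF that] that by (auto simp: D.l_iso_H0)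
  show ?thesis
    by (rule tri_TrI[OF O _ _ _ T id[OF O(1)] id[OF O(2)] id[OF O(3)]])
      (use O s f i p in \<open>simp_all add: D.lMor_H0I D.H0_cmp D.closed_idn D.cmp_idn_left_0 D.cmp_idn_right_0
        tw_shift_mor_hclass tw_shift_mor_idn\<close>)
qed

lemma l_zero_ob_exists:
  assumes "dg_additive C"
  shows "\<exists>Z. l_zero_ob (H0 D) Z"
proof -
  interpret D: dg_category "PreTr C" by (rule dg_category_PreTr)
  obtain z where "zero_ob C z" using assms by (auto simp: dg_additive_def)
  from zero_ob_PreTr[OF this] have "l_zero_ob (H0 D) ((\<lambda>i. z), 0)"
    by (simp add: D.l_zero_ob_H0 zero_ob_def)
  then show ?thesis by blast
qed

lemma tri_subcat_Tr_iff:
  "tri_subcat (Tr C) S \<longleftrightarrow> S \<subseteq> Ob D \<and> (\<exists>Z\<in>S. l_zero_ob (H0 D) Z) \<and>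
     (\<forall>X\<in>S. \<forall>Y\<in>Ob D. l_isomorphic (H0 D) X Y \<longrightarrow> Y \<in> S) \<and>
     (\<forall>X\<in>Ob D. sh X \<in> S \<longleftrightarrow> X \<in> S) \<and>
     (\<forall>X Y Z \<phi> \<psi> \<chi>. (X, Y, Z, \<phi>, \<psi>, \<chi>) \<in> tri (Tr C) \<longrightarrow> X \<in> S \<longrightarrow> Y \<in> S \<longrightarrow> Z \<in> S)"
proof -
  have "(\<forall>(X, Y, Z, \<phi>, \<psi>, \<chi>)\<in>tri (Tr C). X \<in> S \<and> Y \<in> S \<longrightarrow> Z \<in> S) \<longleftrightarrow>
      (\<forall>X Y Z \<phi> \<psi> \<chi>. (X, Y, Z, \<phi>, \<psi>, \<chi>) \<in> tri (Tr C) \<longrightarrow> X \<in> S \<longrightarrow> Y \<in> S \<longrightarrow> Z \<in> S)"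
    by (simp add: Ball_def split_paired_All imp_conjL)
  then show ?thesis unfolding tri_subcat_def Tr_simps Tr_iso_simps by (intro arg_cong2[where f = conj] refl)
qed

lemma tri_subcat_Tr:
  assumes "tri_subcat (Tr C) S"
  shows "S \<subseteq> Ob D" "\<exists>Z\<in>S. l_zero_ob (H0 D) Z"
    "\<And>X Y. X \<in> S \<Longrightarrow> Y \<in> Ob D \<Longrightarrow> l_isomorphic (H0 D) X Y \<Longrightarrow> Y \<in> S"
    "\<And>X. X \<in> Ob D \<Longrightarrow> sh X \<in> S \<longleftrightarrow> X \<in> S"
    "\<And>X Y Z \<phi> \<psi> \<chi>. (X, Y, Z, \<phi>, \<psi>, \<chi>) \<in> tri (Tr C) \<Longrightarrow> X \<in> S \<Longrightarrow> Y \<in> S \<Longrightarrow> Z \<in> S"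
proof -
  note * = assms[unfolded tri_subcat_Tr_iff]
  show "S \<subseteq> Ob D" using * by (rule conjunct1)
  show "\<exists>Z\<in>S. l_zero_ob (H0 D) Z" using * by (elim conjE)
  show "\<And>X Y. X \<in> S \<Longrightarrow> Y \<in> Ob D \<Longrightarrow> l_isomorphic (H0 D) X Y \<Longrightarrow> Y \<in> S"
    by (rule *[THEN conjunct2, THEN conjunct2, THEN conjunct1, rule_format])
  show "\<And>X. X \<in> Ob D \<Longrightarrow> sh X \<in> S \<longleftrightarrow> X \<in> S"
    by (rule *[THEN conjunct2, THEN conjunct2, THEN conjunct2, THEN conjunct1, rule_format])
  show "\<And>X Y Z \<phi> \<psi> \<chi>. (X, Y, Z, \<phi>, \<psi>, \<chi>) \<in> tri (Tr C) \<Longrightarrow> X \<in> S \<Longrightarrow> Y \<in> S \<Longrightarrow> Z \<in> S"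
    by (rule *[THEN conjunct2, THEN conjunct2, THEN conjunct2, THEN conjunct2, rule_format])
qed

text \<open>Closure conditions pass to intersections, but existence of a zero object does not by
  itself. One fixed zero object lies in every member, since zero objects are isomorphic and members
  are strict.\<close>

lemma tri_subcat_tri_gen:
  assumes "dg_additive C" "S \<subseteq> Ob D"
  shows "tri_subcat (Tr C) (tri_gen (Tr C) S)"
proof -
  interpret D: dg_category "PreTr C" by (rule dg_category_PreTr)
  let ?G = "tri_gen (Tr C) S"
  have memI: "V \<in> ?G" if "\<And>S'. tri_subcat (Tr C) S' \<Longrightarrow> S \<subseteq> S' \<Longrightarrow> V \<in> S'" for V
    using that by (simp add: tri_gen_def)
  have memD: "V \<in> S'" if "V \<in> ?G" "tri_subcat (Tr C) S'" "S \<subseteq> S'" for V S'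
    using that tri_gen_least by blast
  obtain Z where Z: "l_zero_ob (H0 D) Z" using l_zero_ob_exists[OF assms(1)] by blast
  then have ZO: "Z \<in> Ob D" by (simp add: D.l_zero_ob_H0)
  \<comment> \<open>The set of all objects is a member of the family, which bounds the
    intersection.\<close>
  have "tri_subcat (Tr C) (Ob D)"
    unfolding tri_subcat_Tr_iff
  proof (intro conjI ballI allI impI)
    show "\<exists>Z\<in>Ob D. l_zero_ob (H0 D) Z" using Z ZO by blast
  qed (auto simp: tw_shift_by_Ob dest: tri_Tr_Ob)
  then have g1: "?G \<subseteq> Ob D" using assms(2) by (rule tri_gen_least)
  have g2: "Z \<in> ?G"
  proof (rule memI)
    fix S' assume S': "tri_subcat (Tr C) S'"
    then obtain Z' where "Z' \<in> S'" "l_zero_ob (H0 D) Z'" using tri_subcat_Tr(2) by blast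
    then show "Z \<in> S'" using tri_subcat_Tr(3)[OF S' _ ZO] D.l_zero_ob_iso[OF _ Z] by blast
  qed
  have g3: "Y \<in> ?G"
    if "X \<in> ?G" "Y \<in> Ob D" "l_isomorphic (H0 D) X Y" for X Y
  proof (rule memI)
    fix S' assume S': "tri_subcat (Tr C) S'" "S \<subseteq> S'"
    show "Y \<in> S'" by (rule tri_subcat_Tr(3)[OF S'(1) memD[OF that(1) S'] that(2,3)])
  qed
  have g4: "sh X \<in> ?G \<longleftrightarrow> X \<in> ?G" if X: "X \<in> Ob D" for X
  proof
    assume G: "sh X \<in> ?G"
    show "X \<in> ?G"
    proof (rule memI)
      fix S' assume S': "tri_subcat (Tr C) S'" "S \<subseteq> S'"
      show "X \<in> S'" using memD[OF G S'] tri_subcat_Tr(4)[OF S'(1) X] by simp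
    qed
  next
    assume G: "X \<in> ?G"
    show "sh X \<in> ?G"
    proof (rule memI)
      fix S' assume S': "tri_subcat (Tr C) S'" "S \<subseteq> S'"
      show "sh X \<in> S'" using memD[OF G S'] tri_subcat_Tr(4)[OF S'(1) X] by simp
    qed
  qed
  have g5: "Z \<in> ?G"
    if "(X, Y, Z, \<phi>, \<psi>, \<chi>) \<in> tri (Tr C)" "X \<in> ?G" "Y \<in> ?G" for X Y Z \<phi> \<psi> \<chi>
  proof (rule memI)
    fix S' assume S': "tri_subcat (Tr C) S'" "S \<subseteq> S'"
    show "Z \<in> S'" by (rule tri_subcat_Tr(5)[OF S'(1) that(1) memD[OF that(2) S'] memD[OF that(3) S']])
  qed
  show ?thesis
    unfolding tri_subcat_Tr_iff
  proof (intro conjI ballI allI impI)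
    show "?G \<subseteq> Ob D" by (rule g1)
    show "\<exists>Z\<in>?G. l_zero_ob (H0 D) Z" using g2 Z by (rule bexI[rotated])
  next
    fix X Y assume "X \<in> ?G" "Y \<in> Ob D" "l_isomorphic (H0 D) X Y"
    then show "Y \<in> ?G" by (rule g3)
  next
    fix X assume "X \<in> Ob D"
    then show "sh X \<in> ?G \<longleftrightarrow> X \<in> ?G" by (rule g4)
  next
    fix X Y Z \<phi> \<psi> \<chi> assume "(X, Y, Z, \<phi>, \<psi>, \<chi>) \<in> tri (Tr C)" "X \<in> ?G" "Y \<in> ?G"
    then show "Z \<in> ?G" by (rule g5)
  qed
qed

end

section \<open>Functors between categories of twisted complexes\<close>

context dg_functor_cats
begin

lemma F_graded_iso:
  assumes "graded_iso C X Y d s t"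
  shows "graded_iso D (F X) (F Y) d (Fm X Y d s) (Fm Y X (- d) t)"
  using assms by (simp add: graded_iso_def F_Ob F_Mor F_zero F_idn F_dif[symmetric] F_cmp[symmetric])

end

section \<open>Compatibility of a dg functor with shifts and cones\<close>

locale pretr_functor =
  E: dg_category E + C: dg_category C
  for E :: "('o, 'm::ab_group_add) dgcat" and C :: "('p, 'n::ab_group_add) dgcat" +
  fixes F :: "('o, 'm) tw \<Rightarrow> ('p, 'n) tw"
    and Fm :: "('o, 'm) tw \<Rightarrow> ('o, 'm) tw \<Rightarrow> int \<Rightarrow> (int \<Rightarrow> int \<Rightarrow> 'm) \<Rightarrow> (int \<Rightarrow> int \<Rightarrow> 'n)"
  assumes additive: "dg_additive C" and pretr_functor: "dg_functor E.D C.D F Fm"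
begin

sublocale P: dg_functor_cats "PreTr E" "PreTr C" F Fm
  by (intro dg_functor_cats.intro dg_functor_cats_axioms.intro E.dg_category_PreTr C.dg_category_PreTr pretr_functor)

text \<open>The comparison of the image of a shift with the shift of the image: undo the shift by
  the image of \<open>shift_in\<close> of degree 1, then shift by \<open>shift_out\<close> of degree
  -1.\<close>

definition th :: "('o, 'm) tw \<Rightarrow> int \<Rightarrow> int \<Rightarrow> 'n" where
  "th X = cmp C.D (F (sh X)) (F X) (sh (F X)) (-1) 1 (shift_out C 1 (F X)) (Fm (sh X) X 1 (shift_in E 1 X))"

definition th_inv :: "('o, 'm) tw \<Rightarrow> int \<Rightarrow> int \<Rightarrow> 'n" where
  "th_inv X = cmp C.D (sh (F X)) (F X) (F (sh X)) (-1) 1 (Fm X (sh X) (-1) (shift_out E 1 X)) (shift_in C 1 (F X))"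

lemma th_iso: "X \<in> Ob E.D \<Longrightarrow> graded_iso C.D (F (sh X)) (sh (F X)) 0 (th X) (th_inv X)"
  using P.D.graded_iso_comp[OF P.F_graded_iso[OF graded_iso_sym[OF E.shift_graded_iso]] C.shift_graded_iso[OF P.F_Ob], of X]
  by (simp add: th_def th_inv_def)

lemma th_closed: "X \<in> Ob E.D \<Longrightarrow> th X \<in> closed_mor C.D (F (sh X)) (sh (F X))"
  using th_iso[of X] by (simp add: graded_iso_def closed_mor_def)

lemma F_shift_isomorphic: "X \<in> Ob E.D \<Longrightarrow> l_isomorphic (H0 C.D) (F (sh X)) (sh (F X))"
  using th_iso[of X] P.D.graded_iso_h_inverse[of "F (sh X)" "sh (F X)" "th X" "th_inv X"]
  by (auto simp: graded_iso_def P.D.l_isomorphic_H0)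

text \<open>Both shifts of a morphism are conjugations with shift maps; the inner pairs cancel, on
  the left inside the image of the functor and on the right in \<open>C.D\<close>.\<close>

lemma th_natural:
  assumes X: "X \<in> Ob E.D" and Y: "Y \<in> Ob E.D" and f: "f \<in> closed_mor E.D X Y"
  shows "cmp C.D (F (sh X)) (F (sh Y)) (sh (F Y)) 0 0 (th Y) (Fm (sh X) (sh Y) 0 (tw_shift_mor f)) =
    cmp C.D (F (sh X)) (sh (F X)) (sh (F Y)) 0 0 (tw_shift_mor (Fm X Y 0 f)) (th X)"
proof -
  note fM = P.C.closed_mor_Mor[OF f]
  note FfM = P.F_Mor[OF X Y fM]
  note i = E.shift_graded_iso[OF X, unfolded graded_iso_def] E.shift_graded_iso[OF Y, unfolded graded_iso_def]
  note j = C.shift_graded_iso[OF P.F_Ob[OF X], unfolded graded_iso_def] C.shift_graded_iso[OF P.F_Ob[OF Y], unfolded graded_iso_def]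
  note k = P.F_graded_iso[OF E.shift_graded_iso[OF X], unfolded graded_iso_def]
    P.F_graded_iso[OF E.shift_graded_iso[OF Y], unfolded graded_iso_def]
  have 1: "Fm (sh X) (sh Y) 0 (tw_shift_mor f) = cmp C.D (F (sh X)) (F Y) (F (sh Y)) (-1) 1
      (Fm Y (sh Y) (-1) (shift_out E 1 Y)) (cmp C.D (F (sh X)) (F X) (F Y) 0 1 (Fm X Y 0 f) (Fm (sh X) X 1 (shift_in E 1 X)))"
    unfolding E.tw_shift_mor_eq[OF X Y fM] using i fM by (simp add: P.F_cmp P.C.cmp_Mor_deg)
  show ?thesis
    unfolding 1 unfolding C.tw_shift_mor_eq[OF P.F_Ob[OF X] P.F_Ob[OF Y] FfM] th_def
    using j k FfM
    by (simp add: P.D.Mor_rules P.D.cmp_assoc_deg P.D.cmp_cancel[where X = "F Y" and Y = "F (sh Y)"]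
        P.D.cmp_cancel[where X = "F X" and Y = "sh (F X)"])
qed

text \<open>The terms of \<open>F G\<close> need not be direct sums of the required kind, so
  \<open>F G\<close> is not claimed to be a \<open>tw_cone\<close>. Transport along
  \<open>th\<close> makes it an extension with the same degree 1 morphism as any cone of
  \<open>Fm A B 0 f\<close>, which suffices for comparison.\<close>

lemma F_cone:
  assumes T: "tw_cone E A B f G \<iota>1 \<iota>2 \<pi>1 \<pi>2"
  shows "dg_ext C.D (sh (F A)) (F B) (F G)
     (cmp C.D (sh (F A)) (F A) (F B) 0 1 (Fm A B 0 f) (shift_in C 1 (F A)))
     (cmp C.D (sh (F A)) (F (sh A)) (F G) 0 0 (Fm (sh A) G 0 (diag_mor \<iota>1)) (th_inv A))
     (Fm B G 0 (diag_mor \<iota>2))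
     (cmp C.D (F G) (F (sh A)) (sh (F A)) 0 0 (th A) (Fm G (sh A) 0 (diag_mor \<pi>1)))
     (Fm G B 0 (diag_mor \<pi>2))"
proof -
  have A: "A \<in> Ob E.D" and B: "B \<in> Ob E.D" and f: "f \<in> closed_mor E.D A B"
    using T by (simp_all add: tw_cone_def)
  note fM = P.C.closed_mor_Mor[OF f]
  note FfM = P.F_Mor[OF A B fM]
  note i = E.shift_graded_iso[OF A, unfolded graded_iso_def]
  note j = C.shift_graded_iso[OF P.F_Ob[OF A], unfolded graded_iso_def]
  note k = P.F_graded_iso[OF E.shift_graded_iso[OF A], unfolded graded_iso_def]
  note t = th_iso[OF A, unfolded graded_iso_def, simplified]
  have 1: "Fm (sh A) B 1 (cmp E.D (sh A) A B 0 1 f (shift_in E 1 A)) =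
     cmp C.D (F (sh A)) (F A) (F B) 0 1 (Fm A B 0 f) (Fm (sh A) A 1 (shift_in E 1 A))"
    using i fM B by (simp add: P.F_cmp)
  have 2: "cmp C.D (sh (F A)) (F (sh A)) (F B) 1 0
      (Fm (sh A) B 1 (cmp E.D (sh A) A B 0 1 f (shift_in E 1 A))) (th_inv A) =
      cmp C.D (sh (F A)) (F A) (F B) 0 1 (Fm A B 0 f) (shift_in C 1 (F A))"
    unfolding 1 th_inv_def using j k FfM P.F_Ob[OF B]
    by (simp add: P.D.Mor_rules P.D.cmp_assoc_deg P.D.cmp_cancel[where X = "F A" and Y = "F (sh A)"])
  show ?thesis
    unfolding 2[symmetric]
    by (rule P.D.dg_ext_transport[OF P.F_dg_ext[OF E.tw_cone_dg_ext[OF T]]])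
      (use t in \<open>auto simp: closed_mor_def\<close>)
qed

definition theta :: "('o, 'm) tw \<Rightarrow> (int \<Rightarrow> int \<Rightarrow> 'n) set" where
  "theta X = hclass C.D (F (sh X)) (sh (F X)) (th X)"

lemma theta_Mor: "X \<in> Ob E.D \<Longrightarrow> theta X \<in> lMor (H0 C.D) (F (sh X)) (sh (F X))"
  by (simp add: theta_def P.D.lMor_H0I th_closed)

lemma theta_natural:
  assumes X: "X \<in> Ob E.D" and Y: "Y \<in> Ob E.D" and \<phi>: "\<phi> \<in> lMor (H0 E.D) X Y"
  shows "lcmp (H0 C.D) (F (sh X)) (F (sh Y)) (sh (F Y)) (theta Y) (P.FH (sh X) (sh Y) (tw_shift_mor ` \<phi>)) =
    lcmp (H0 C.D) (F (sh X)) (sh (F X)) (sh (F Y)) (tw_shift_mor ` P.FH X Y \<phi>) (theta X)"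
proof -
  obtain f where f: "f \<in> closed_mor E.D X Y" "\<phi> = hclass E.D X Y f" using \<phi> by (rule P.C.lMor_H0E)
  note s = X Y E.tw_shift_by_Ob[OF X, of 1] E.tw_shift_by_Ob[OF Y, of 1]
  note O = s[THEN P.F_Ob] C.tw_shift_by_Ob[OF P.F_Ob[OF X], of 1] C.tw_shift_by_Ob[OF P.F_Ob[OF Y], of 1]
  note c = E.tw_shift_mor_closed[OF X Y f(1)] P.F_closed[OF X Y f(1)]
  show ?thesis
    unfolding f(2) theta_def E.tw_shift_mor_hclass[OF X Y f(1)] P.H0_mor_hclass[OF X Y f(1)]
      P.H0_mor_hclass[OF s(3,4) c(1)] C.tw_shift_mor_hclass[OF O(1,2) c(2)]
    using O c th_closed[OF X] th_closed[OF Y] P.F_closed[OF s(3,4) c(1)]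
      C.tw_shift_mor_closed[OF O(1,2) c(2)] th_natural[OF X Y f(1)]
    by (simp add: P.D.H0_cmp)
qed

text \<open>An actual cone \<open>Z'\<close> of the image morphism exists by additivity, and
  \<open>dg_ext_unique\<close> gives an isomorphism \<open>\<kappa>\<close> from it to
  \<open>F G\<close>. The third comparison isomorphism is \<open>\<kappa>\<close> followed by the
  image of \<open>\<gamma>\<close>; naturality of \<open>theta\<close> settles the square involving
  the shift.\<close>

lemma tri_Tr_map:
  assumes T: "(X, Y, Z, \<phi>, \<psi>, \<chi>) \<in> tri (Tr E)"
  shows "(F X, F Y, F Z, P.FH X Y \<phi>, P.FH Y Z \<psi>,
    lcmp (H0 C.D) (F Z) (F (sh X)) (sh (F X)) (theta X) (P.FH Z (sh X) \<chi>)) \<in> tri (Tr C)"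
proof -
  let ?H = "H0 E.D" and ?K = "H0 C.D"
  obtain A B f G \<iota>1 \<iota>2 \<pi>1 \<pi>2 \<alpha> \<beta> \<gamma> where O: "X \<in> Ob E.D" "Y \<in> Ob E.D" "Z \<in> Ob E.D"
    and m: "\<phi> \<in> lMor ?H X Y" "\<psi> \<in> lMor ?H Y Z" "\<chi> \<in> lMor ?H Z (sh X)"
    and cone: "tw_cone E A B f G \<iota>1 \<iota>2 \<pi>1 \<pi>2"
    and iso: "l_iso ?H A X \<alpha>" "l_iso ?H B Y \<beta>" "l_iso ?H G Z \<gamma>"
    and e: "lcmp ?H A X Y \<phi> \<alpha> = lcmp ?H A B Y \<beta> (hclass E.D A B f)"
      "lcmp ?H B Y Z \<psi> \<beta> = lcmp ?H B G Z \<gamma> (hclass E.D B G (diag_mor \<iota>2))"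
      "lcmp ?H G Z (sh X) \<chi> \<gamma> = lcmp ?H G (sh A) (sh X) (tw_shift_mor ` \<alpha>) (hclass E.D G (sh A) (diag_mor \<pi>1))"
    using T by (rule tri_TrE)
  have OA: "A \<in> Ob E.D" "B \<in> Ob E.D" "G \<in> Ob E.D" and f: "f \<in> closed_mor E.D A B"
    using cone by (simp_all add: tw_cone_def)
  have c: "diag_mor \<iota>2 \<in> closed_mor E.D B G" "diag_mor \<pi>1 \<in> closed_mor E.D G (sh A)"
    using E.tw_cone_dg_ext[OF cone] by (simp_all add: dg_ext_def closed_mor_def)
  note s = E.tw_shift_by_Ob[OF O(1), of 1] E.tw_shift_by_Ob[OF OA(1), of 1]
  note FO = O[THEN P.F_Ob] OA[THEN P.F_Ob] s[THEN P.F_Ob]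
  note sF = C.tw_shift_by_Ob[OF FO(1), of 1] C.tw_shift_by_Ob[OF FO(4), of 1]
  have im: "\<alpha> \<in> lMor ?H A X" "\<beta> \<in> lMor ?H B Y" "\<gamma> \<in> lMor ?H G Z" using iso by (auto simp: l_iso_def)
  note hm = P.C.lMor_H0I[OF f] P.C.lMor_H0I[OF c(1)] P.C.lMor_H0I[OF c(2)]
  obtain a where a: "a \<in> closed_mor E.D A X" "\<alpha> = hclass E.D A X a" using im(1) by (rule P.C.lMor_H0E)
  have sm: "tw_shift_mor ` \<alpha> \<in> lMor ?H (sh A) (sh X)"
    unfolding a(2) E.tw_shift_mor_hclass[OF OA(1) O(1) a(1)]
    by (rule P.C.lMor_H0I[OF E.tw_shift_mor_closed[OF OA(1) O(1) a(1)]])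
  have Fsm: "tw_shift_mor ` P.FH A X \<alpha> \<in> lMor ?K (sh (F A)) (sh (F X))"
    unfolding a(2) P.H0_mor_hclass[OF OA(1) O(1) a(1)]
      C.tw_shift_mor_hclass[OF FO(4,1) P.F_closed[OF OA(1) O(1) a(1)]]
    by (rule P.D.lMor_H0I[OF C.tw_shift_mor_closed[OF FO(4,1) P.F_closed[OF OA(1) O(1) a(1)]]])
  obtain Z' \<kappa>1 \<kappa>2 \<rho>1 \<rho>2 where cone': "tw_cone C (F A) (F B) (Fm A B 0 f) Z' \<kappa>1 \<kappa>2 \<rho>1 \<rho>2"
    using C.tw_cone_exists[OF additive FO(4,5) P.F_closed[OF OA(1,2) f]] by blast
  have Z': "Z' \<in> Ob C.D" using cone' by (simp add: tw_cone_def)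
  have c': "diag_mor \<kappa>2 \<in> closed_mor C.D (F B) Z'" "diag_mor \<rho>1 \<in> closed_mor C.D Z' (sh (F A))"
    using C.tw_cone_dg_ext[OF cone'] by (simp_all add: dg_ext_def closed_mor_def)
  obtain k k' where k: "k \<in> closed_mor C.D Z' (F G)" and kk: "h_inverse C.D Z' (F G) k k'"
    \<comment> \<open>Compatibility with inclusion and projection is what turns
      \<open>\<kappa>\<close> into an isomorphism of triangles.\<close>
    and ki: "cmp C.D (F B) Z' (F G) 0 0 k (diag_mor \<kappa>2) = Fm B G 0 (diag_mor \<iota>2)"
    and kp: "cmp C.D Z' (F G) (sh (F A)) 0 0
      (cmp C.D (F G) (F (sh A)) (sh (F A)) 0 0 (th A) (Fm G (sh A) 0 (diag_mor \<pi>1))) k = diag_mor \<rho>1"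
    using P.D.dg_ext_unique[OF C.tw_cone_dg_ext[OF cone'] F_cone[OF cone]] by blast
  define \<kappa> where "\<kappa> = hclass C.D Z' (F G) k"
  have km: "\<kappa> \<in> lMor ?K Z' (F G)" unfolding \<kappa>_def by (rule P.D.lMor_H0I[OF k])
  have kiso: "l_iso ?K Z' (F G) \<kappa>" using kk Z' FO by (auto simp: P.D.l_iso_H0 \<kappa>_def)
  note Fm = P.FH_Mor[OF O(1,2) m(1)] P.FH_Mor[OF O(2,3) m(2)] P.FH_Mor[OF O(3) s(1) m(3)]
    P.FH_Mor[OF OA(1) O(1) im(1)] P.FH_Mor[OF OA(2) O(2) im(2)] P.FH_Mor[OF OA(3) O(3) im(3)]
    P.FH_Mor[OF OA(1,2) hm(1)] P.FH_Mor[OF OA(2,3) hm(2)] P.FH_Mor[OF OA(3) s(2) hm(3)] P.FH_Mor[OF s(2,1) sm]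
    theta_Mor[OF O(1)] theta_Mor[OF OA(1)]
  have incl: "P.FH B G (hclass E.D B G (diag_mor \<iota>2)) = lcmp ?K (F B) Z' (F G) \<kappa> (hclass C.D (F B) Z' (diag_mor \<kappa>2))"
    unfolding \<kappa>_def P.H0_mor_hclass[OF OA(2,3) c(1)] using FO Z' k c' ki by (simp add: P.D.H0_cmp)
  have proj: "lcmp ?K Z' (F (sh A)) (sh (F A)) (theta A)
      (lcmp ?K Z' (F G) (F (sh A)) (P.FH G (sh A) (hclass E.D G (sh A) (diag_mor \<pi>1))) \<kappa>) =
      hclass C.D Z' (sh (F A)) (diag_mor \<rho>1)"
  proof -
    have "cmp C.D Z' (F G) (sh (F A)) 0 0
      (cmp C.D (F G) (F (sh A)) (sh (F A)) 0 0 (th A) (Fm G (sh A) 0 (diag_mor \<pi>1))) k =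
      cmp C.D Z' (F (sh A)) (sh (F A)) 0 0 (th A) (cmp C.D Z' (F G) (F (sh A)) 0 0 (Fm G (sh A) 0 (diag_mor \<pi>1)) k)"
      using FO sF Z' k th_closed[OF OA(1)] P.F_closed[OF OA(3) s(2) c(2)] by (simp add: P.D.cmp_assoc_0)
    then show ?thesis
      unfolding \<kappa>_def theta_def P.H0_mor_hclass[OF OA(3) s(2) c(2)]
      using FO sF Z' k th_closed[OF OA(1)] P.F_closed[OF OA(3) s(2) c(2)] kp
      by (simp add: P.D.H0_cmp P.D.closed_cmp)
  qed
  show ?thesis
  proof (rule tri_TrI[OF FO(1-3) Fm(1,2) _ cone' P.FH_l_iso[OF OA(1) O(1) iso(1)] P.FH_l_iso[OF OA(2) O(2) iso(2)]
        P.D.l_iso_H0_comp[OF Z' FO(6,3) kiso P.FH_l_iso[OF OA(3) O(3) iso(3)]]])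
    show "lcmp ?K (F Z) (F (sh X)) (sh (F X)) (theta X) (P.FH Z (sh X) \<chi>) \<in> lMor ?K (F Z) (sh (F X))"
      by (rule P.D.lcmp_H0_Mor[OF FO(3,7) sF(1) Fm(11,3)])
    show "lcmp ?K (F A) (F X) (F Y) (P.FH X Y \<phi>) (P.FH A X \<alpha>) =
        lcmp ?K (F A) (F B) (F Y) (P.FH B Y \<beta>) (hclass C.D (F A) (F B) (Fm A B 0 f))"
      using P.FH_cmp[OF OA(1) O(1,2) m(1) im(1)] P.FH_cmp[OF OA(1,2) O(2) im(2) hm(1)] e(1)
      by (simp add: P.H0_mor_hclass[OF OA(1,2) f])
    have "lcmp ?K (F B) (F Y) (F Z) (P.FH Y Z \<psi>) (P.FH B Y \<beta>) =
        lcmp ?K (F B) (F G) (F Z) (P.FH G Z \<gamma>) (P.FH B G (hclass E.D B G (diag_mor \<iota>2)))"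
      using P.FH_cmp[OF OA(2) O(2,3) m(2) im(2)] P.FH_cmp[OF OA(2,3) O(3) im(3) hm(2)] e(2) by simp
    also have "\<dots> = lcmp ?K (F B) Z' (F Z) (lcmp ?K Z' (F G) (F Z) (P.FH G Z \<gamma>) \<kappa>)
        (hclass C.D (F B) Z' (diag_mor \<kappa>2))"
      unfolding incl by (rule P.D.lcmp_H0_assoc[symmetric, OF FO(5) Z' FO(6,3) Fm(6) km P.D.lMor_H0I[OF c'(1)]])
    finally show "lcmp ?K (F B) (F Y) (F Z) (P.FH Y Z \<psi>) (P.FH B Y \<beta>) =
        lcmp ?K (F B) Z' (F Z) (lcmp ?K Z' (F G) (F Z) (P.FH G Z \<gamma>) \<kappa>) (hclass C.D (F B) Z' (diag_mor \<kappa>2))" .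
    let ?p = "P.FH G (sh A) (hclass E.D G (sh A) (diag_mor \<pi>1))"
    have "lcmp ?K Z' (F Z) (sh (F X)) (lcmp ?K (F Z) (F (sh X)) (sh (F X)) (theta X) (P.FH Z (sh X) \<chi>))
        (lcmp ?K Z' (F G) (F Z) (P.FH G Z \<gamma>) \<kappa>) =
      lcmp ?K Z' (F (sh X)) (sh (F X)) (theta X)
        (lcmp ?K Z' (F G) (F (sh X)) (lcmp ?K (F G) (F Z) (F (sh X)) (P.FH Z (sh X) \<chi>) (P.FH G Z \<gamma>)) \<kappa>)"
      using FO sF Z' Fm km by (simp add: P.D.lcmp_H0_assoc P.D.lcmp_H0_Mor)
    also have "lcmp ?K (F G) (F Z) (F (sh X)) (P.FH Z (sh X) \<chi>) (P.FH G Z \<gamma>) =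
        lcmp ?K (F G) (F (sh A)) (F (sh X)) (P.FH (sh A) (sh X) (tw_shift_mor ` \<alpha>)) ?p"
      using P.FH_cmp[OF OA(3) O(3) s(1) m(3) im(3)] P.FH_cmp[OF OA(3) s(2,1) sm hm(3)] e(3) by simp
    also have "lcmp ?K Z' (F (sh X)) (sh (F X)) (theta X) (lcmp ?K Z' (F G) (F (sh X))
          (lcmp ?K (F G) (F (sh A)) (F (sh X)) (P.FH (sh A) (sh X) (tw_shift_mor ` \<alpha>)) ?p) \<kappa>) =
        lcmp ?K Z' (F (sh A)) (sh (F X)) (lcmp ?K (F (sh A)) (F (sh X)) (sh (F X)) (theta X)
          (P.FH (sh A) (sh X) (tw_shift_mor ` \<alpha>))) (lcmp ?K Z' (F G) (F (sh A)) ?p \<kappa>)"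
      using FO sF Z' Fm km by (simp add: P.D.lcmp_H0_assoc P.D.lcmp_H0_Mor)
    also have "\<dots> = lcmp ?K Z' (sh (F A)) (sh (F X)) (tw_shift_mor ` P.FH A X \<alpha>)
          (lcmp ?K Z' (F (sh A)) (sh (F A)) (theta A) (lcmp ?K Z' (F G) (F (sh A)) ?p \<kappa>))"
      unfolding theta_natural[OF OA(1) O(1) im(1)]
      using FO sF Z' Fm km Fsm by (simp add: P.D.lcmp_H0_assoc P.D.lcmp_H0_Mor)
    finally show "lcmp ?K Z' (F Z) (sh (F X)) (lcmp ?K (F Z) (F (sh X)) (sh (F X)) (theta X) (P.FH Z (sh X) \<chi>))
        (lcmp ?K Z' (F G) (F Z) (P.FH G Z \<gamma>) \<kappa>) =
      lcmp ?K Z' (sh (F A)) (sh (F X)) (tw_shift_mor ` P.FH A X \<alpha>) (hclass C.D Z' (sh (F A)) (diag_mor \<rho>1))"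
      unfolding proj .
  qed
qed

lemma tri_functor_FH:
  "tri_functor (Tr E) (Tr C) F P.FH theta"
  unfolding tri_functor_def Tr_simps Tr_iso_simps
proof (intro conjI ballI)
  fix X assume X: "X \<in> Ob E.D"
  show "F X \<in> Ob C.D" by (rule P.F_Ob[OF X])
  show "P.FH X X (lidn (H0 E.D) X) = lidn (H0 C.D) (F X)" by (rule P.FH_idn[OF X])
  show "l_iso (H0 C.D) (F (sh X)) (sh (F X)) (theta X)"
    using th_iso[OF X] P.D.graded_iso_h_inverse[OF th_iso[OF X]]
    by (auto simp: graded_iso_def P.D.l_iso_H0 theta_def)
  fix Y assume Y: "Y \<in> Ob E.D"
  fix \<phi> assume \<phi>: "\<phi> \<in> lMor (H0 E.D) X Y"
  show "P.FH X Y \<phi> \<in> lMor (H0 C.D) (F X) (F Y)" by (rule P.FH_Mor[OF X Y \<phi>])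
  show "lcmp (H0 C.D) (F (sh X)) (F (sh Y)) (sh (F Y)) (theta Y) (P.FH (sh X) (sh Y) (tw_shift_mor ` \<phi>)) =
    lcmp (H0 C.D) (F (sh X)) (sh (F X)) (sh (F Y)) (tw_shift_mor ` P.FH X Y \<phi>) (theta X)"
    by (rule theta_natural[OF X Y \<phi>])
  fix \<psi> assume \<psi>: "\<psi> \<in> lMor (H0 E.D) X Y"
  show "P.FH X Y (ladd (H0 E.D) X Y \<phi> \<psi>) = ladd (H0 C.D) (F X) (F Y) (P.FH X Y \<phi>) (P.FH X Y \<psi>)"
    by (rule P.FH_add[OF X Y \<phi> \<psi>])
next
  fix X Y Z \<phi> \<psi> assume "X \<in> Ob E.D" "Y \<in> Ob E.D" "Z \<in> Ob E.D"
    "\<phi> \<in> lMor (H0 E.D) Y Z" "\<psi> \<in> lMor (H0 E.D) X Y"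
  then show "P.FH X Z (lcmp (H0 E.D) X Y Z \<phi> \<psi>) =
      lcmp (H0 C.D) (F X) (F Y) (F Z) (P.FH Y Z \<phi>) (P.FH X Y \<psi>)"
    by (rule P.FH_cmp)
next
  fix t assume "t \<in> tri (Tr E)"
  then show "case t of (X, Y, Z, \<phi>, \<psi>, \<chi>) \<Rightarrow> (F X, F Y, F Z, P.FH X Y \<phi>, P.FH Y Z \<psi>,
      lcmp (H0 C.D) (F Z) (F (sh X)) (sh (F X)) (theta X) (P.FH Z (sh X) \<chi>)) \<in> tri (Tr C)"
    using tri_Tr_map by (cases t) auto
qed


section \<open>Generated subcategories under the functor\<close>

lemma F_tri_gen:
  assumes S: "S \<subseteq> Ob E.D" and S': "S' \<subseteq> Ob C.D" and "dg_additive E"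
    and FS: "\<And>X. X \<in> S \<Longrightarrow> F X \<in> tri_gen (Tr C) S'" and X: "X \<in> tri_gen (Tr E) S"
  shows "F X \<in> tri_gen (Tr C) S'"
proof -
  let ?G = "tri_gen (Tr C) S'"
  let ?T = "{X \<in> Ob E.D. F X \<in> ?G}"
  note sub = C.tri_subcat_Tr[OF C.tri_subcat_tri_gen[OF additive S']]
  have iso: "Y \<in> ?G" if "X \<in> ?G" "Y \<in> Ob C.D" "l_isomorphic (H0 C.D) X Y" for X Y
    using that by (rule sub(3))
  have "tri_subcat (Tr E) ?T"
    unfolding E.tri_subcat_Tr_iff
  proof (intro conjI ballI allI impI)
    show "?T \<subseteq> Ob E.D" by blast
    obtain Z where Z: "l_zero_ob (H0 E.D) Z" using E.l_zero_ob_exists[OF \<open>dg_additive E\<close>] by blast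
    obtain Z' where Z': "Z' \<in> ?G" "l_zero_ob (H0 C.D) Z'" using sub(2) by blast
    have "F Z \<in> ?G"
      using iso[OF Z'(1)] P.D.l_zero_ob_iso[OF Z'(2) P.F_l_zero_ob[OF Z]] Z by (simp add: P.C.l_zero_ob_H0 P.F_Ob)
    then have "Z \<in> ?T" using Z by (simp add: P.C.l_zero_ob_H0)
    with Z show "\<exists>Z\<in>?T. l_zero_ob (H0 E.D) Z" by (rule bexI)
  next
    fix X Y assume "X \<in> ?T" "Y \<in> Ob E.D" "l_isomorphic (H0 E.D) X Y"
    then show "Y \<in> ?T" using iso[of "F X" "F Y"] P.F_l_isomorphic[of X Y] P.F_Ob by simp
  next
    fix X assume X: "X \<in> Ob E.D"
    note s = E.tw_shift_by_Ob[OF X, of 1] and i = F_shift_isomorphic[OF X]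
    note O = P.F_Ob[OF X] P.F_Ob[OF s] C.tw_shift_by_Ob[OF P.F_Ob[OF X], of 1]
    \<comment> \<open>Strictness of the generated subcategory absorbs the difference between the two
      shifts.\<close>
    have "F (sh X) \<in> ?G \<longleftrightarrow> sh (F X) \<in> ?G"
      using iso[of "F (sh X)" "sh (F X)"] iso[of "sh (F X)" "F (sh X)"] i P.D.l_isomorphic_sym[OF O(2,3) i] O by blast
    then show "sh X \<in> ?T \<longleftrightarrow> X \<in> ?T" using X s sub(4)[OF O(1)] by simp
  next
    fix X Y Z \<phi> \<psi> \<chi> assume t: "(X, Y, Z, \<phi>, \<psi>, \<chi>) \<in> tri (Tr E)" and "X \<in> ?T" "Y \<in> ?T"
    then have "F Z \<in> ?G" using sub(5)[OF tri_Tr_map[OF t]] by simp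
    then show "Z \<in> ?T" using tri_Tr_Ob[OF t] by blast
  qed
  then have "tri_gen (Tr E) S \<subseteq> ?T" by (rule tri_gen_least) (use S FS in blast)
  then show ?thesis using X by blast
qed

text \<open>For closure under cones, a morphism between objects of the image is lifted by fullness,
  and additivity of \<open>E\<close> provides a cone of the lift inside the generating
  subcategory.\<close>

lemma F_essentially_surjective:
  assumes S: "S \<subseteq> Ob E.D" and "dg_additive E"
    and full: "\<And>X Y. X \<in> Ob E.D \<Longrightarrow> Y \<in> Ob E.D \<Longrightarrow>
      bij_betw (P.FH X Y) (lMor (H0 E.D) X Y) (lMor (H0 C.D) (F X) (F Y))"
    and S': "S' \<subseteq> Ob C.D"
    and gen: "\<And>Y. Y \<in> S' \<Longrightarrow> \<exists>X\<in>S. l_isomorphic (H0 C.D) (F X) Y"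
    and Y: "Y \<in> tri_gen (Tr C) S'"
  shows "\<exists>X\<in>tri_gen (Tr E) S. l_isomorphic (H0 C.D) (F X) Y"
proof -
  let ?G = "tri_gen (Tr E) S" and ?K = "H0 C.D"
  let ?T = "{Y \<in> Ob C.D. \<exists>X\<in>?G. l_isomorphic ?K (F X) Y}"
  note sub = E.tri_subcat_Tr[OF E.tri_subcat_tri_gen[OF \<open>dg_additive E\<close> S]]
  have GO: "X \<in> Ob E.D" if "X \<in> ?G" for X using that sub(1) by blast
  note FO = P.F_Ob[OF GO]
  have "tri_subcat (Tr C) ?T"
    unfolding C.tri_subcat_Tr_iff
  proof (intro conjI ballI allI impI)
    show "?T \<subseteq> Ob C.D" by blast
    obtain Z where Z: "Z \<in> ?G" "l_zero_ob (H0 E.D) Z" using sub(2) by blast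
    then show "\<exists>Z\<in>?T. l_zero_ob ?K Z"
      using P.F_l_zero_ob[OF Z(2)] P.D.l_isomorphic_refl[OF FO[OF Z(1)]] FO[OF Z(1)] by blast
  next
    fix Y Y' assume "Y \<in> ?T" "Y' \<in> Ob C.D" "l_isomorphic ?K Y Y'"
    then obtain X where "X \<in> ?G" "l_isomorphic ?K (F X) Y" "Y \<in> Ob C.D" by blast
    with \<open>Y' \<in> Ob C.D\<close> \<open>l_isomorphic ?K Y Y'\<close> show "Y' \<in> ?T"
      using P.D.l_isomorphic_trans[OF FO, of X Y Y'] by blast
  next
    fix Y assume Y: "Y \<in> Ob C.D"
    note sY = C.tw_shift_by_Ob[OF Y, of 1]
    show "sh Y \<in> ?T \<longleftrightarrow> Y \<in> ?T"
    proof
      assume "Y \<in> ?T"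
      then obtain X where X: "X \<in> ?G" "l_isomorphic ?K (F X) Y" by blast
      have sX: "sh X \<in> ?G" using X(1) sub(4)[OF GO[OF X(1)]] by simp
      have "l_isomorphic ?K (sh (F X)) (sh Y)" using X Y FO by (simp add: C.shift_l_isomorphic_iff)
      then have "l_isomorphic ?K (F (sh X)) (sh Y)"
        using P.D.l_isomorphic_trans[OF FO[OF sX] C.tw_shift_by_Ob[OF FO[OF X(1)]] sY F_shift_isomorphic[OF GO[OF X(1)]]] by blast
      then show "sh Y \<in> ?T" using sX sY by blast
    next
      assume "sh Y \<in> ?T"
      then obtain X where X: "X \<in> ?G" "l_isomorphic ?K (F X) (sh Y)" by blast
      \<comment> \<open>Closure under the inverse shift: an object over \<open>sh Y\<close> is
        shifted back.\<close>
      define X' where "X' = tw_shift_by (-1) X"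
      have X': "X' \<in> Ob E.D" "sh X' = X"
        unfolding X'_def using E.tw_shift_by_Ob[OF GO[OF X(1)]] by (simp_all add: tw_shift_by_add tw_shift_by_0)
      then have G: "X' \<in> ?G" using X(1) sub(4)[OF X'(1)] by simp
      note i = F_shift_isomorphic[OF X'(1), unfolded X'(2)]
      note O = FO[OF X(1)] C.tw_shift_by_Ob[OF FO[OF G], of 1]
      have "l_isomorphic ?K (sh (F X')) (sh Y)"
        by (rule P.D.l_isomorphic_trans[OF O(2,1) sY P.D.l_isomorphic_sym[OF O i] X(2)])
      then show "Y \<in> ?T" using Y G FO by (auto simp: C.shift_l_isomorphic_iff)
    qed
  next
    fix Y1 Y2 Y3 \<phi> \<psi> \<chi> assume t: "(Y1, Y2, Y3, \<phi>, \<psi>, \<chi>) \<in> tri (Tr C)" and "Y1 \<in> ?T" "Y2 \<in> ?T"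
    then obtain X1 X2 where X1: "X1 \<in> ?G" "l_isomorphic ?K (F X1) Y1" and X2: "X2 \<in> ?G" "l_isomorphic ?K (F X2) Y2"
      by blast
    note XO = GO[OF X1(1)] GO[OF X2(1)] and XF = FO[OF X1(1)] FO[OF X2(1)]
    obtain A B f Q \<iota>1 \<iota>2 \<pi>1 \<pi>2 \<alpha> \<beta> \<gamma> where YO: "Y1 \<in> Ob C.D" "Y2 \<in> Ob C.D" "Y3 \<in> Ob C.D"
      and cone: "tw_cone C A B f Q \<iota>1 \<iota>2 \<pi>1 \<pi>2" and "l_iso ?K A Y1 \<alpha>" "l_iso ?K B Y2 \<beta>" "l_iso ?K Q Y3 \<gamma>"
      using t by (rule tri_TrE)
    then have iso: "l_isomorphic ?K A Y1" "l_isomorphic ?K B Y2" "l_isomorphic ?K Q Y3"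
      by (auto simp: l_isomorphic_def)
    have O: "A \<in> Ob C.D" "B \<in> Ob C.D" "Q \<in> Ob C.D" and f: "f \<in> closed_mor C.D A B"
      using cone by (simp_all add: tw_cone_def)
    have "l_isomorphic ?K A (F X1)" "l_isomorphic ?K B (F X2)"
      using P.D.l_isomorphic_trans[OF O(1) YO(1) XF(1) iso(1) P.D.l_isomorphic_sym[OF XF(1) YO(1) X1(2)]]
        P.D.l_isomorphic_trans[OF O(2) YO(2) XF(2) iso(2) P.D.l_isomorphic_sym[OF XF(2) YO(2) X2(2)]] by simp_all
    then obtain a a' b b' where a: "h_inverse C.D A (F X1) a a'" and b: "h_inverse C.D B (F X2) b b'"
      using O XF by (auto simp: P.D.l_isomorphic_H0)
    then have c: "a \<in> closed_mor C.D A (F X1)" "a' \<in> closed_mor C.D (F X1) A"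
        "b \<in> closed_mor C.D B (F X2)"
      and a1: "hclass C.D A A (cmp C.D A (F X1) A 0 0 a' a) = hclass C.D A A (idn C.D A)"
      by (simp_all add: h_inverse_def)
    define g' where "g' = cmp C.D (F X1) B (F X2) 0 0 b (cmp C.D (F X1) A B 0 0 f a')"
    have g': "g' \<in> closed_mor C.D (F X1) (F X2)"
      unfolding g'_def using O XF f c by (simp add: P.D.closed_cmp)
    \<comment> \<open>Only the class of \<open>g'\<close> is lifted, so the square for
      \<open>cone_h_inverse\<close> commutes up to homotopy.\<close>
    have "hclass C.D (F X1) (F X2) g' \<in> P.FH X1 X2 ` lMor (H0 E.D) X1 X2"
      using bij_betw_imp_surj_on[OF full[OF XO]] P.D.lMor_H0I[OF g'] by simp
    then obtain g where g: "g \<in> closed_mor E.D X1 X2"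
      and gg: "hclass C.D (F X1) (F X2) (Fm X1 X2 0 g) = hclass C.D (F X1) (F X2) g'"
      by (auto elim!: P.C.lMor_H0E simp: P.H0_mor_hclass[OF XO])
    obtain Z \<kappa>1 \<kappa>2 \<rho>1 \<rho>2 where cone': "tw_cone E X1 X2 g Z \<kappa>1 \<kappa>2 \<rho>1 \<rho>2"
      using E.tw_cone_exists[OF \<open>dg_additive E\<close> XO g] by blast
    have Z: "Z \<in> ?G" by (rule sub(5)[OF E.tw_cone_tri[OF cone'] X1(1) X2(1)])
    have "hclass C.D A (F X2) (cmp C.D A (F X1) (F X2) 0 0 (Fm X1 X2 0 g) a) =
        hclass C.D A (F X2) (cmp C.D A (F X1) (F X2) 0 0 g' a)"
      by (rule P.D.hclass_cmp_right_cong[OF O(1) XF P.F_closed[OF XO g] g' c(1) gg])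
    also have "cmp C.D A (F X1) (F X2) 0 0 g' a =
        cmp C.D A A (F X2) 0 0 (cmp C.D A B (F X2) 0 0 b f) (cmp C.D A (F X1) A 0 0 a' a)"
      unfolding g'_def using O XF f c by (simp add: P.D.cmp_assoc_0 P.D.closed_cmp)
    also have "hclass C.D A (F X2) \<dots> = hclass C.D A (F X2) (cmp C.D A B (F X2) 0 0 b f)"
      using P.D.hclass_cmp_left_cong[OF O(1,1) XF(2) _ _ _ a1, of "cmp C.D A B (F X2) 0 0 b f"] O XF f c
      by (simp add: P.D.closed_cmp P.D.closed_idn P.D.cmp_idn_right_0)
    finally have "l_isomorphic ?K Q (F Z)"
      using C.cone_h_inverse[OF O(1) XF(1) C.tw_cone_dg_ext[OF cone] F_cone[OF cone'] f P.F_closed[OF XO g] a b] by blast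
    then have "l_isomorphic ?K (F Z) Y3"
      using P.D.l_isomorphic_trans[OF FO[OF Z] O(3) YO(3) P.D.l_isomorphic_sym[OF O(3) FO[OF Z]] iso(3)] by blast
    then show "Y3 \<in> ?T" using Z YO(3) by blast
  qed
  then have "tri_gen (Tr C) S' \<subseteq> ?T"
    by (rule tri_gen_least) (use S' gen tri_gen_subset[of S "Tr E"] in blast)
  then show ?thesis using Y by blast
qed

lemma tri_equivalence_tri_gen:
  assumes S: "S \<subseteq> Ob E.D" and add: "dg_additive E"
    and full: "\<And>X Y. X \<in> Ob E.D \<Longrightarrow> Y \<in> Ob E.D \<Longrightarrow>
      bij_betw (P.FH X Y) (lMor (H0 E.D) X Y) (lMor (H0 C.D) (F X) (F Y))"
    and S': "S' \<subseteq> Ob C.D"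
    and FS: "\<And>X. X \<in> S \<Longrightarrow> \<exists>Y\<in>S'. l_isomorphic (H0 C.D) (F X) Y"
    and gen: "\<And>Y. Y \<in> S' \<Longrightarrow> \<exists>X\<in>S. l_isomorphic (H0 C.D) (F X) Y"
  shows "tri_equivalence (t_full (Tr E) (tri_gen (Tr E) S)) (t_full (Tr C) (tri_gen (Tr C) S')) F P.FH"
proof -
  let ?G = "tri_gen (Tr E) S" and ?G' = "tri_gen (Tr C) S'"
  note sub = E.tri_subcat_Tr[OF E.tri_subcat_tri_gen[OF add S]]
  note sub' = C.tri_subcat_Tr[OF C.tri_subcat_tri_gen[OF additive S']]
  have GO: "X \<in> Ob E.D" if "X \<in> ?G" for X using that sub(1) by blast
  have "F X \<in> ?G'" if "X \<in> S" for X
  proof -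
    obtain Y where Y: "Y \<in> S'" "l_isomorphic (H0 C.D) (F X) Y" using FS[OF \<open>X \<in> S\<close>] by blast
    have O: "F X \<in> Ob C.D" "Y \<in> Ob C.D" using P.F_Ob S S' \<open>X \<in> S\<close> Y by blast+
    have "Y \<in> ?G'" using Y(1) tri_gen_subset[of S' "Tr C"] by blast
    then show ?thesis by (rule sub'(3)[OF _ O(1) P.D.l_isomorphic_sym[OF O Y(2)]])
  qed
  then have FG: "F X \<in> ?G'" if "X \<in> ?G" for X
    using F_tri_gen[OF S S' add _ that] by blast
  have t: "lOb (t_full T U) = U" "lMor (t_full T U) = lMor T" "lcmp (t_full T U) = lcmp T" "lidn (t_full T U) = lidn T"
    "ladd (t_full T U) = ladd T" "tsh (t_full T U) = tsh T" "tshm (t_full T U) = tshm T"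
    "tri (t_full T U) = {(X, Y, Z, \<phi>, \<psi>, \<chi>) \<in> tri T. X \<in> U \<and> Y \<in> U \<and> Z \<in> U}"
    "l_iso (t_full T U) = l_iso T" "l_isomorphic (t_full T U) = l_isomorphic T" for T :: "('x, 'y) tcat" and U
    by (simp_all add: t_full_def l_iso_def l_isomorphic_def fun_eq_iff)
  have "tri_functor (t_full (Tr E) ?G) (t_full (Tr C) ?G') F P.FH theta"
    using tri_functor_FH GO FG unfolding tri_functor_def t Tr_simps(1) by (auto simp: split_beta)
  moreover have "bij_betw (P.FH X Y) (lMor (Tr E) X Y) (lMor (Tr C) (F X) (F Y))" if "X \<in> ?G" "Y \<in> ?G" for X Y
    unfolding Tr_simps using full GO that by blast
  moreover have "\<exists>X\<in>?G. l_isomorphic (Tr C) (F X) Y" if "Y \<in> ?G'" for Y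
    unfolding Tr_iso_simps by (rule F_essentially_surjective[OF S add full S' gen that])
  ultimately show ?thesis
    unfolding tri_equivalence_def t by blast
qed

end

text \<open>An arbitrary additive dg category \<open>C\<close> takes the place of \<open>J\<close>.
  Convolution is carried out in \<open>PreTr C\<close> and restricted to \<open>B'\<close>; the
  generators on both sides match up to isomorphism by the last two assumptions.\<close>

lemma dg_full_pretr_equivalence:
  fixes C :: "('o, 'm::ab_group_add) dgcat" and B B' :: "('o, 'm) tw set"
  assumes C: "dg_category C" and add: "dg_additive C" and B: "B \<subseteq> Ob (PreTr C)" and B': "B' \<subseteq> Ob (PreTr C)"
    and add': "dg_additive (dg_full (PreTr C) B')"
    and 1: "\<forall>b\<in>B'. \<exists>c\<in>B. l_isomorphic (Tr C) b c" and 2: "\<forall>c\<in>B. \<exists>b\<in>B'. l_isomorphic (Tr C) b c"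
  shows "\<exists>F Fm.
    dg_functor (PreTr (dg_full (PreTr C) B')) (PreTr C) F Fm \<and>
    (\<forall>b\<in>B'. F (tw_single (dg_full (PreTr C) B') b) = b) \<and>
    (\<forall>b\<in>B'. \<forall>c\<in>B'. \<forall>l. \<forall>f\<in>Mor (PreTr C) b c l.
       Fm (tw_single (dg_full (PreTr C) B') b) (tw_single (dg_full (PreTr C) B') c) l (tw_single_mor f) = f) \<and>
    tri_equivalence (Tr_plus (dg_full (PreTr C) B')) (t_full (Tr C) (tri_gen (Tr C) B)) F (H0_mor (PreTr C) F Fm)"
proof -
  let ?E = "dg_full (PreTr C) B'"
  interpret C: dg_category C by fact
  interpret D: dg_category "PreTr C" by (rule C.dg_category_PreTr)
  interpret E: dg_category ?E by (rule dg_category_full[OF C.dg_category_PreTr B'])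
  obtain z where z: "zero_ob ?E z" using add' by (auto simp: dg_additive_def)
  then have zD: "zero_ob (PreTr C) z" by (simp add: zero_ob_full[OF B'])
  obtain F Fm where F: "dg_functor (PreTr (PreTr C)) (PreTr C) F Fm"
    and bij: "\<And>X Y l. X \<in> Ob (PreTr (PreTr C)) \<Longrightarrow> Y \<in> Ob (PreTr (PreTr C)) \<Longrightarrow>
      bij_betw (Fm X Y l) (Mor (PreTr (PreTr C)) X Y l) (Mor (PreTr C) (F X) (F Y) l)"
    and con: "\<And>X. X \<in> Ob (PreTr (PreTr C)) \<Longrightarrow> concentrated (PreTr C) X \<Longrightarrow> F X = fst X 0"
    and con_mor: "\<And>X Y l f. X \<in> Ob (PreTr (PreTr C)) \<Longrightarrow> Y \<in> Ob (PreTr (PreTr C)) \<Longrightarrow> concentrated (PreTr C) X \<Longrightarrow>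
      concentrated (PreTr C) Y \<Longrightarrow> f \<in> Mor (PreTr (PreTr C)) X Y l \<Longrightarrow> Fm X Y l f = f 0 0"
    using D.convolution_functor[OF zD C.PreTr_has_shifted_sums[OF add] C.PreTr_has_twists] by blast
  have FE: "dg_functor (PreTr ?E) (PreTr C) F Fm" by (rule dg_functor_full[OF B' F])
  interpret P: pretr_functor ?E C F Fm
    by unfold_locales (rule add, rule FE)
  have sO: "tw_single ?E b \<in> Ob (PreTr ?E)" if "b \<in> B'" for b using E.tw_single_Ob[OF z] that by simp
  have sD: "tw_single ?E b \<in> Ob (PreTr (PreTr C))" if "b \<in> B'" for b
    using sO[OF that] by (simp add: PreTr_full_Ob[OF B'])
  \<comment> \<open>Singles over \<open>B'\<close> are padded by a zero object of \<open>B'\<close>.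
    It is also zero in \<open>PreTr C\<close>, so the normalisation of \<open>F\<close> on
    concentrated complexes applies.\<close>
  have sc: "concentrated (PreTr C) (tw_single ?E b)" for b
    using E.zero_ob_tw_single[OF z] by (auto simp: concentrated_def zero_ob_full[OF B'])
  have Fs: "F (tw_single ?E b) = b" if "b \<in> B'" for b using con[OF sD[OF that] sc] by simp
  have Fms: "Fm (tw_single ?E b) (tw_single ?E c) l (tw_single_mor f) = f"
    if "b \<in> B'" "c \<in> B'" "f \<in> Mor (PreTr C) b c l" for b c l f
  proof -
    have "tw_single_mor f \<in> Mor (PreTr (PreTr C)) (tw_single ?E b) (tw_single ?E c) l"
      using E.tw_single_mor_Mor[OF z, of b c f l] that by (simp add: PreTr_full_Mor)
    then show ?thesis using con_mor[OF sD[OF that(1)] sD[OF that(2)] sc sc] by simp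
  qed
  have "tri_equivalence (t_full (Tr ?E) (tri_gen (Tr ?E) (tw_single ?E ` B'))) (t_full (Tr C) (tri_gen (Tr C) B)) F P.P.FH"
  proof (rule P.tri_equivalence_tri_gen[OF _ add' _ B])
    show "tw_single ?E ` B' \<subseteq> Ob (PreTr ?E)" using sO by blast
    show "bij_betw (P.P.FH X Y) (lMor (H0 (PreTr ?E)) X Y) (lMor (H0 (PreTr C)) (F X) (F Y))"
      if "X \<in> Ob (PreTr ?E)" "Y \<in> Ob (PreTr ?E)" for X Y
      using P.P.FH_bij[OF that] bij that by (simp add: PreTr_full_Ob[OF B'] PreTr_full_Mor)
    show "\<exists>Y\<in>B. l_isomorphic (H0 (PreTr C)) (F X) Y" if "X \<in> tw_single ?E ` B'" for X
      using that 1 Fs by (auto simp: Tr_iso_simps)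
    show "\<exists>X\<in>tw_single ?E ` B'. l_isomorphic (H0 (PreTr C)) (F X) Y" if "Y \<in> B" for Y
      using that 2 Fs by (auto simp: Tr_iso_simps)
  qed
  then have "tri_equivalence (Tr_plus ?E) (t_full (Tr C) (tri_gen (Tr C) B)) F (H0_mor (PreTr C) F Fm)"
    by (simp add: Tr_plus_def)
  then show ?thesis using FE Fs Fms by blast
qed

theorem proposition8p1p1:
  fixes B B' :: "('k::field_char_0 jobj, 'k jmor) tw set"
  assumes "dg_category (J :: ('k jobj, 'k jmor) dgcat)"
    and "dg_additive (J :: ('k jobj, 'k jmor) dgcat)"
    and "B \<subseteq> lOb (Tr J)"
    and "\<forall>b\<in>B. \<forall>c\<in>B. \<exists>s\<in>B. l_direct_sum (Tr J) b c s"
    and "B' \<subseteq> Ob (PreTr J)"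
    and "dg_additive (dg_full (PreTr J) B')"
    and "\<forall>b\<in>B'. \<exists>c\<in>B. l_isomorphic (Tr J) b c"
    and "\<forall>c\<in>B. \<exists>b\<in>B'. l_isomorphic (Tr J) b c"
  shows "\<exists>F Fm.
    dg_functor (PreTr (dg_full (PreTr J) B')) (PreTr J) F Fm \<and>
    (\<forall>b\<in>B'. F (tw_single (dg_full (PreTr J) B') b) = b) \<and>
    (\<forall>b\<in>B'. \<forall>c\<in>B'. \<forall>l. \<forall>f\<in>Mor (PreTr J) b c l.
       Fm (tw_single (dg_full (PreTr J) B') b) (tw_single (dg_full (PreTr J) B') c) l
         (tw_single_mor f) = f) \<and>
    tri_equivalence (Tr_plus (dg_full (PreTr J) B')) (t_full (Tr J) (tri_gen (Tr J) B))
      F (H0_mor (PreTr J) F Fm)"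
  using assms(1,2) assms(3)[unfolded Tr_simps(1)] assms(5-8) by (rule dg_full_pretr_equivalence)

end
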